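(* There exist constants $A>0$ and $t_0>0$ such that for all $s=\sigma+it$ with $t>t_0$ and $1-\sigma\ge A\,t^{2/5}\log t$, $$\mathcal{R}(s)=-\chi(s)\eta^{s-1}e^{-\pi i\eta^2}\frac{\sqrt2\,e^{3\pi i/8}\sin\pi\eta}{2\cos 2\pi\eta}(1+U)\quad\text{with } |U|<1.$$
   Context: $\mathcal{R}(s)=\int_{0\swarrow 1}\frac{x^{-s}e^{\pi i x^2}}{e^{\pi i x}-e^{-\pi i x}}\,dx$ (Riemann's auxiliary function), where $0\swarrow1$ is a straight line of direction $e^{-3\pi i/4}$ crossing the real axis in $(0,1)$ and $x^{-s}$ is the principal branch. $\chi(s)=\pi^{s-1/2}\Gamma(\frac{1-s}{2})/\Gamma(\frac s2)$. $\eta:=\sqrt{(s-1)/(2\pi i)}$ with $-\pi/4<\arg\eta<3\pi/4$; $\eta^{s-1}$ is the principal power. *)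

theory Defs
  imports "HOL-Analysis.Analysis"
begin

definition omega_dir :: complex where
  "omega_dir = exp (- 3 * pi * \<i> / 4)"

definition R_integrand :: "complex \<Rightarrow> complex \<Rightarrow> complex" where
  "R_integrand s x = x powr (- s) * exp (pi * \<i> * x\<^sup>2) /
                     (exp (pi * \<i> * x) - exp (- pi * \<i> * x))"

text \<open>Riemann's auxiliary function: integral along the straight line through 1/2
  (a point of (0,1)) with direction e^{-3 pi i/4}, parametrised by
  x = 1/2 + u * omega_dir, u from -infinity to +infinity.\<close>
definition riemann_R :: "complex \<Rightarrow> complex" where
  "riemann_R s = integral UNIV (\<lambda>u::real. R_integrand s (1/2 + of_real u * omega_dir) * omega_dir)"

definition chi :: "complex \<Rightarrow> complex" where
  "chi s = of_real pi powr (s - 1/2) * Gamma ((1 - s) / 2) / Gamma (s / 2)"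

definition eta :: "complex \<Rightarrow> complex" where
  "eta s = (THE w. w\<^sup>2 = (s - 1) / (2 * pi * \<i>) \<and> - pi / 4 < Arg w \<and> Arg w < 3 * pi / 4)"

end

theory Submission
  imports Defs "HOL-Complex_Analysis.Cauchy_Integral_Theorem" "HOL-Probability.Characteristic_Functions"
    "HOL-Real_Asymp.Real_Asymp"
begin

text \<open>
  Moving the line to the origin and folding it gives
  \<open>R(s) = (1 - exp (\<pi> \<i> s)) \<integral> x powr (-s) * exp (\<pi> \<i> x\<^sup>2) * \<i> / (2 sin (\<pi> x))\<close> over the ray of direction
  \<open>exp (\<pi> \<i> / 4)\<close>. Expanding \<open>1 / sin\<close> into a geometric series yields Gaussian Mellin integrals with
  parameters \<open>m = k + 1/2\<close>. Writing \<open>x powr (-s)\<close> against a Gaussian as a Laplace transform turns each of them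
  into \<open>Gamma (1 - s)\<close> times \<open>\<integral> y powr (s - 1) * exp (- \<pi> \<i> y\<^sup>2 + 2 \<pi> \<i> m y)\<close>, over any line of direction
  \<open>exp (- \<pi> \<i> / 4)\<close> that passes above the origin, and the Gamma factors recombine exactly to \<open>\<chi>(s)\<close>; no
  Stirling formula is needed.

  Since the integrands have no poles, the line may depend on \<open>m\<close>. For \<open>m\<^sup>3 \<le> |\<eta>|\<close> the line through
  \<open>\<eta> + m / 2\<close> gives a Gaussian with relative error \<open>O(m\<^sup>3 / |\<eta>|)\<close>; for larger \<open>m\<close> the line through the exact
  saddle gives a bound decaying in \<open>m\<close>. The Gaussian values \<open>exp (\<pi> \<i> m\<^sup>2 / 2 + 2 \<pi> \<i> m \<eta>)\<close> sum to a multiple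
  of \<open>sin (\<pi> \<eta>) / cos (2 \<pi> \<eta>)\<close>. With \<open>Y = Im \<eta>\<close> this is at least of size \<open>Y\<close> for small \<open>Y\<close>, whereas the
  errors sum to \<open>O(1 / (|\<eta>| Y\<^sup>4))\<close>, so that \<open>Y\<close> has to exceed a multiple of \<open>|\<eta>| powr (-1/5)\<close>. This is the
  origin of the exponent \<open>2/5\<close>.
\<close>

section \<open>Integrals over lines and rays\<close>

lemma cmod_powr_le:
  fixes x w :: complex
  shows "cmod (x powr w) \<le> cmod x powr Re w * exp (pi * \<bar>Im w\<bar>)"
proof -
  have "- (Im w * Arg x) \<le> \<bar>Im w\<bar> * \<bar>Arg x\<bar>"
    using abs_ge_minus_self[of "Im w * Arg x"] by (simp add: abs_mult)
  also have "\<dots> \<le> \<bar>Im w\<bar> * pi"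
    using Arg_bounded[of x] by (intro mult_left_mono) auto
  finally show ?thesis
    unfolding norm_powr_complex by (intro mult_left_mono) (auto simp: mult.commute)
qed

lemma has_bochner_integral_std_normal_iexp:
  fixes t :: real
  shows "has_bochner_integral lborel (\<lambda>x. std_normal_density x *\<^sub>R iexp (t * x)) (exp (- (t\<^sup>2) / 2))"
proof -
  have "(LINT x|lborel. std_normal_density x *\<^sub>R iexp (t * x)) = exp (- (t\<^sup>2) / 2)"
    using fun_cong[OF char_std_normal_distribution, of t]
    unfolding char_def by (subst (asm) integral_density) auto
  moreover have "integrable lborel (\<lambda>x. std_normal_density x *\<^sub>R iexp (t * x))"
    using integrable_std_normal_moment[of 0] by (rule Bochner_Integration.integrable_bound) auto
  ultimately show ?thesis by (simp add: has_bochner_integral_iff)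
qed

lemma has_bochner_integral_gaussian_iexp:
  fixes a \<beta> :: real
  assumes "a > 0"
  shows "has_bochner_integral lborel (\<lambda>x. exp (\<i> * of_real (\<beta> * x) - of_real (a * x\<^sup>2)))
    (of_real (sqrt (pi / a) * exp (- (\<beta>\<^sup>2 / (4 * a)))))"
proof -
  define c where "c = sqrt (2 * a)"
  have c: "c > 0" "c\<^sup>2 = 2 * a" using assms by (auto simp: c_def)
  have "has_bochner_integral lborel (\<lambda>x. std_normal_density (0 + c * x) *\<^sub>R iexp (\<beta> / c * (0 + c * x)))
      (complex_of_real (exp (- ((\<beta> / c)\<^sup>2) / 2)) /\<^sub>R \<bar>c\<bar>)"
    using has_bochner_integral_std_normal_iexp[of "\<beta> / c"]
    by (rule iffD1[OF lborel_has_bochner_integral_real_affine_iff[of c _ _ 0], rotated]) (use c in simp)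
  then have "has_bochner_integral lborel
      (\<lambda>x. of_real (sqrt (2 * pi)) * (std_normal_density (0 + c * x) *\<^sub>R iexp (\<beta> / c * (0 + c * x))))
      (of_real (sqrt (2 * pi)) * (complex_of_real (exp (- ((\<beta> / c)\<^sup>2) / 2)) /\<^sub>R \<bar>c\<bar>))"
    by (rule has_bochner_integral_mult_right)
  moreover have "of_real (sqrt (2 * pi))
      * (std_normal_density (0 + c * x) *\<^sub>R iexp (\<beta> / c * (0 + c * x)))
      = exp (\<i> * of_real (\<beta> * x) - of_real (a * x\<^sup>2))" for x
  proof -
    have "std_normal_density (0 + c * x) = exp (- (a * x\<^sup>2)) / sqrt (2 * pi)"
      using c by (simp add: std_normal_density_def power_mult_distrib)
    moreover have "\<beta> / c * (0 + c * x) = \<beta> * x" using c by simp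
    moreover have "exp (\<i> * of_real (\<beta> * x) - of_real (a * x\<^sup>2))
        = of_real (exp (- (a * x\<^sup>2))) * iexp (\<beta> * x)"
      unfolding exp_of_real[symmetric] exp_add[symmetric] by simp
    ultimately show ?thesis by (simp only:) (simp add: scaleR_conv_of_real)
  qed
  moreover have "of_real (sqrt (2 * pi)) * (complex_of_real (exp (- ((\<beta> / c)\<^sup>2) / 2)) /\<^sub>R \<bar>c\<bar>)
      = of_real (sqrt (pi / a) * exp (- (\<beta>\<^sup>2 / (4 * a))))"
  proof -
    have "sqrt (2 * pi) / c = sqrt (pi / a)" by (simp add: c_def flip: real_sqrt_divide)
    moreover have "- ((\<beta> / c)\<^sup>2) / 2 = - (\<beta>\<^sup>2 / (4 * a))" by (simp add: power_divide c(2))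
    moreover have "of_real (sqrt (2 * pi)) * (complex_of_real E /\<^sub>R \<bar>c\<bar>)
        = of_real (sqrt (2 * pi) / c * E)" for E
      using c(1) by (simp add: scaleR_conv_of_real divide_inverse)
    ultimately show ?thesis by (simp only:)
  qed
  ultimately show ?thesis by (simp only:)
qed

lemma has_bochner_integral_gaussian:
  fixes a :: real and b :: complex
  assumes "a > 0"
  shows "has_bochner_integral lborel (\<lambda>x::real. exp (b * of_real x - of_real (a * x\<^sup>2)))
    (of_real (sqrt (pi / a)) * exp (b\<^sup>2 / of_real (4 * a)))"
proof -
  define m where "m = Re b / (2 * a)"
  define \<beta> where "\<beta> = Im b"
  define C where "C = exp (of_real (a * m\<^sup>2) + \<i> * of_real (\<beta> * m))"
  have b: "b = of_real (2 * a * m) + \<i> * of_real \<beta>"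
    using assms by (simp add: m_def \<beta>_def complex_eq_iff)
  have "has_bochner_integral lborel
      (\<lambda>x. exp (\<i> * of_real (\<beta> * (- m + 1 * x)) - of_real (a * (- m + 1 * x)\<^sup>2)))
      (of_real (sqrt (pi / a) * exp (- (\<beta>\<^sup>2 / (4 * a)))) /\<^sub>R \<bar>1\<bar>)"
    using has_bochner_integral_gaussian_iexp[OF assms, of \<beta>]
    by (rule iffD1[OF lborel_has_bochner_integral_real_affine_iff[of 1 _ _ "- m"], rotated]) simp
  then have "has_bochner_integral lborel
      (\<lambda>x. C * exp (\<i> * of_real (\<beta> * (- m + 1 * x)) - of_real (a * (- m + 1 * x)\<^sup>2)))
      (C * (of_real (sqrt (pi / a) * exp (- (\<beta>\<^sup>2 / (4 * a)))) /\<^sub>R \<bar>1\<bar>))"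
    by (rule has_bochner_integral_mult_right)
  moreover have "C * exp (\<i> * of_real (\<beta> * (- m + 1 * x)) - of_real (a * (- m + 1 * x)\<^sup>2))
      = exp (b * of_real x - of_real (a * x\<^sup>2))" for x
    unfolding C_def exp_add[symmetric] b by (simp add: power2_eq_square algebra_simps)
  moreover have "C * (of_real (sqrt (pi / a) * exp (- (\<beta>\<^sup>2 / (4 * a)))) /\<^sub>R \<bar>1\<bar>)
      = of_real (sqrt (pi / a)) * exp (b\<^sup>2 / of_real (4 * a))"
  proof -
    have "b\<^sup>2 / of_real (4 * a) = of_real (a * m\<^sup>2) + \<i> * of_real (\<beta> * m) + of_real (- (\<beta>\<^sup>2 / (4 * a)))"
      using assms by (simp add: b complex_eq_iff power2_eq_square field_simps)
    then show ?thesis by (simp only: C_def exp_add exp_of_real of_real_mult) simp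
  qed
  ultimately show ?thesis by (simp only:)
qed

lemma has_bochner_integral_exp_neg_square:
  fixes a :: real
  assumes "a > 0"
  shows "has_bochner_integral lborel (\<lambda>x::real. exp (- (a * x\<^sup>2))) (sqrt (pi / a))"
proof -
  have "has_bochner_integral lborel (\<lambda>x. complex_of_real (exp (- (a * x\<^sup>2))))
      (complex_of_real (sqrt (pi / a)))"
    using has_bochner_integral_gaussian[OF assms, of 0] by (simp add: exp_of_real[symmetric])
  then show ?thesis
    using has_bochner_integral_bounded_linear[OF bounded_linear_Re] by fastforce
qed

lemma integrable_exp_neg_square:
  fixes a :: real
  assumes "a > 0"
  shows "integrable lborel (\<lambda>x::real. exp (- (a * x\<^sup>2)))"
  using has_bochner_integral_exp_neg_square[OF assms] by (rule integrable.intros)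

lemma norm_integral_diff_le:
  fixes f g :: "'a \<Rightarrow> 'b::{banach, second_countable_topology}"
  assumes [measurable]: "f \<in> borel_measurable M" and g: "integrable M g" and w: "integrable M w"
    and bound: "\<And>x. norm (f x - g x) \<le> w x"
  shows "norm ((LINT x|M. f x) - (LINT x|M. g x)) \<le> (LINT x|M. w x)"
proof -
  have [measurable]: "g \<in> borel_measurable M" using g by simp
  have diff: "integrable M (\<lambda>x. f x - g x)"
  proof (rule Bochner_Integration.integrable_bound[OF w])
    show "AE x in M. norm (f x - g x) \<le> norm (w x)"
      by (intro AE_I2 order_trans[OF bound]) simp
  qed measurable
  have "integrable M (\<lambda>x. (f x - g x) + g x)"
    using diff g by (rule Bochner_Integration.integrable_add)
  then have "(LINT x|M. f x) - (LINT x|M. g x) = (LINT x|M. f x - g x)"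
    using g by (simp add: Bochner_Integration.integral_diff)
  also have "norm \<dots> \<le> (LINT x|M. norm (f x - g x))"
    by (rule integral_norm_bound)
  also have "\<dots> \<le> (LINT x|M. w x)"
    using diff w bound by (intro integral_mono integrable_norm) auto
  finally show ?thesis .
qed

lemma (in pair_sigma_finite) integrable_pair_bound:
  fixes f :: "'a \<times> 'b \<Rightarrow> 'c::{banach, second_countable_topology}"
  assumes [measurable]: "f \<in> borel_measurable (M1 \<Otimes>\<^sub>M M2)"
    and g: "integrable M1 g" and h: "integrable M2 h"
    and bound: "\<And>x y. norm (f (x, y)) \<le> g x * h y"
  shows "integrable (M1 \<Otimes>\<^sub>M M2) f"
proof -
  have [measurable]: "g \<in> borel_measurable M1" "h \<in> borel_measurable M2"
    using g h by auto
  have "integrable (M1 \<Otimes>\<^sub>M M2) (\<lambda>(x, y). g x * h y)"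
  proof (rule Fubini_integrable)
    show "integrable M1 (\<lambda>x. LINT y|M2. norm (case (x, y) of (x, y) \<Rightarrow> g x * h y))"
      using g by (simp add: abs_mult integrable_norm)
    show "AE x in M1. integrable M2 (\<lambda>y. case (x, y) of (x, y) \<Rightarrow> g x * h y)"
      using h by simp
  qed measurable
  then show ?thesis
  proof (rule Bochner_Integration.integrable_bound)
    have "norm (f (x, y)) \<le> norm (g x * h y)" for x y
      using bound[of x y] by simp
    then show "AE z in M1 \<Otimes>\<^sub>M M2. norm (f z) \<le> norm (case z of (x, y) \<Rightarrow> g x * h y)"
      by (auto intro!: AE_I2)
  qed measurable
qed

lemma norm_geometric_partial_sum_le:
  fixes g q :: complex
  assumes "cmod q < 1"
  shows "cmod (\<Sum>k<n. g * q ^ k) \<le> 2 * cmod (g / (1 - q))"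
proof -
  have "q \<noteq> 1" using assms by auto
  then have "(\<Sum>k<n. g * q ^ k) = g * ((1 - q ^ n) / (1 - q))"
    by (simp add: sum_gp_strict flip: sum_distrib_left)
  also have "\<dots> = g / (1 - q) - g / (1 - q) * q ^ n"
    by (simp add: diff_divide_distrib right_diff_distrib)
  also have "cmod \<dots> \<le> cmod (g / (1 - q)) + cmod (g / (1 - q)) * cmod (q ^ n)"
    by (metis norm_triangle_ineq4 norm_mult)
  also have "\<dots> \<le> cmod (g / (1 - q)) + cmod (g / (1 - q)) * 1"
    using assms by (intro add_left_mono mult_left_mono) (auto simp: norm_power power_le_one)
  finally show ?thesis by simp
qed

lemma integral_geometric_series_sums:
  fixes g q :: "'a \<Rightarrow> complex"
  assumes [measurable]: "g \<in> borel_measurable M" "q \<in> borel_measurable M"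
    and int: "integrable M (\<lambda>x. g x / (1 - q x))"
    and q: "\<And>x. g x \<noteq> 0 \<Longrightarrow> cmod (q x) < 1"
  shows "(\<lambda>k. LINT x|M. g x * q x ^ k) sums (LINT x|M. g x / (1 - q x))"
proof -
  let ?G = "\<lambda>x. g x / (1 - q x)" and ?S = "\<lambda>n x. \<Sum>k<n. g x * q x ^ k"
  have bound: "cmod (?S n x) \<le> 2 * cmod (?G x)" for n x
    using norm_geometric_partial_sum_le[OF q] by (cases "g x = 0") simp_all
  have dominated: "integrable M (\<lambda>x. 2 * cmod (?G x))"
    using int by (intro integrable_mult_right integrable_norm)
  have "integrable M (\<lambda>x. g x * q x ^ k)" for k
  proof -
    have "integrable M (?S n)" for n
      using dominated by (rule Bochner_Integration.integrable_bound) (use bound in auto)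
    then have "integrable M (\<lambda>x. ?S (Suc k) x - ?S k x)"
      by (intro Bochner_Integration.integrable_diff)
    then show ?thesis by simp
  qed
  then have "(LINT x|M. ?S n x) = (\<Sum>k<n. LINT x|M. g x * q x ^ k)" for n
    by (intro Bochner_Integration.integral_sum)
  moreover have "(\<lambda>n. LINT x|M. ?S n x) \<longlonglongrightarrow> (LINT x|M. ?G x)"
  proof (rule integral_dominated_convergence[OF _ _ dominated])
    have "(\<lambda>k. g x * q x ^ k) sums ?G x" for x
      using sums_mult[OF geometric_sums[OF q], of x "g x"] by (cases "g x = 0") simp_all
    then show "AE x in M. (\<lambda>n. ?S n x) \<longlonglongrightarrow> ?G x"
      by (simp add: sums_def)
  qed (use bound in auto)
  ultimately show ?thesis by (simp add: sums_def)
qed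

lemma integral_line_primitive:
  fixes f P :: "complex \<Rightarrow> complex"
  assumes "a \<le> b"
    and P: "\<And>u. u \<in> {a..b} \<Longrightarrow> (P has_field_derivative f (z + of_real u * d)) (at (z + of_real u * d))"
  shows "integral {a..b} (\<lambda>u. f (z + of_real u * d) * d)
    = P (z + of_real b * d) - P (z + of_real a * d)"
proof (rule integral_unique, rule fundamental_theorem_of_calculus[OF \<open>a \<le> b\<close>])
  fix u assume "u \<in> {a..b}"
  then have "((P \<circ> (\<lambda>u. z + of_real u * d)) has_vector_derivative d * f (z + of_real u * d))
      (at u within {a..b})"
    by (intro field_vector_diff_chain_within has_field_derivative_at_within[OF P])
       (auto intro!: derivative_eq_intros)
  then show "((\<lambda>u. P (z + of_real u * d)) has_vector_derivative f (z + of_real u * d) * d)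
      (at u within {a..b})"
    by (simp add: o_def mult.commute)
qed

lemma set_integral_line_primitive_tendsto:
  fixes f P :: "complex \<Rightarrow> complex"
  assumes exhaust: "\<And>n. \<alpha> n \<le> \<beta> n" "incseq (\<lambda>n. {\<alpha> n..\<beta> n})" "(\<Union>n. {\<alpha> n..\<beta> n}) = T"
    and P: "\<And>u. u \<in> T \<Longrightarrow> (P has_field_derivative f (z + of_real u * d)) (at (z + of_real u * d))"
    and int: "set_integrable lborel T (\<lambda>u. f (z + of_real u * d) * d)"
  shows "(\<lambda>n. P (z + of_real (\<beta> n) * d) - P (z + of_real (\<alpha> n) * d))
    \<longlonglongrightarrow> (LINT u:T|lborel. f (z + of_real u * d) * d)"
proof -
  have "(LINT u:{\<alpha> n..\<beta> n}|lborel. f (z + of_real u * d) * d)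
      = P (z + of_real (\<beta> n) * d) - P (z + of_real (\<alpha> n) * d)" for n
  proof -
    have sub: "{\<alpha> n..\<beta> n} \<subseteq> T" using exhaust(3) by blast
    then have "set_integrable lborel {\<alpha> n..\<beta> n} (\<lambda>u. f (z + of_real u * d) * d)"
      by (intro set_integrable_subset[OF int]) auto
    moreover have "integral {\<alpha> n..\<beta> n} (\<lambda>u. f (z + of_real u * d) * d)
        = P (z + of_real (\<beta> n) * d) - P (z + of_real (\<alpha> n) * d)"
      using sub exhaust(1) by (intro integral_line_primitive P) auto
    ultimately show ?thesis by (simp only: set_borel_integral_eq_integral)
  qed
  moreover have "(\<lambda>n. LINT u:{\<alpha> n..\<beta> n}|lborel. f (z + of_real u * d) * d)
      \<longlonglongrightarrow> (LINT u:(\<Union>n. {\<alpha> n..\<beta> n})|lborel. f (z + of_real u * d) * d)"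
    using exhaust int by (intro set_integral_cont_up) auto
  ultimately show ?thesis by (simp only: exhaust(3))
qed

lemma norm_primitive_diff_le:
  fixes f P :: "complex \<Rightarrow> complex"
  assumes P: "\<And>y. y \<in> closed_segment x x' \<Longrightarrow> (P has_field_derivative f y) (at y)"
    and bound: "\<And>y. y \<in> closed_segment x x' \<Longrightarrow> cmod (f y) * cmod (x - x') \<le> B"
  shows "cmod (P x - P x') \<le> B"
proof (cases "x = x'")
  case True
  then show ?thesis using bound[of x] by simp
next
  case False
  then have "cmod (P x - P x') \<le> B / cmod (x - x') * cmod (x - x')"
    using bound
    by (intro field_differentiable_bound[of "closed_segment x x'" P f]
          has_field_derivative_at_within[OF P])
       (auto simp: pos_le_divide_eq)
  then show ?thesis using False by simp
qed

text \<open>The function \<open>B\<close> bounds the integral of \<open>f\<close> along the segment that joins the two lines at parameter \<open>u\<close>.\<close>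

lemma set_integral_line_shift:
  fixes f :: "complex \<Rightarrow> complex" and z d z' d' :: complex and \<alpha> \<beta> :: "nat \<Rightarrow> real" and B :: "real \<Rightarrow> real"
  assumes S: "open S" "convex S" and f: "f holomorphic_on S"
    and exhaust: "\<And>n. \<alpha> n \<le> \<beta> n" "incseq (\<lambda>n. {\<alpha> n..\<beta> n})" "(\<Union>n. {\<alpha> n..\<beta> n}) = T"
    and lines: "\<And>u. u \<in> T \<Longrightarrow> z + of_real u * d \<in> S" "\<And>u. u \<in> T \<Longrightarrow> z' + of_real u * d' \<in> S"
    and int: "set_integrable lborel T (\<lambda>u. f (z + of_real u * d) * d)"
      "set_integrable lborel T (\<lambda>u. f (z' + of_real u * d') * d')"
    and bound: "\<And>u x. u \<in> T \<Longrightarrow> x \<in> closed_segment (z + of_real u * d) (z' + of_real u * d') \<Longrightarrow>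
      cmod (f x) * cmod ((z + of_real u * d) - (z' + of_real u * d')) \<le> B u"
    and ends: "(\<lambda>n. B (\<alpha> n)) \<longlonglongrightarrow> 0" "(\<lambda>n. B (\<beta> n)) \<longlonglongrightarrow> 0"
  shows "(LINT u:T|lborel. f (z + of_real u * d) * d) = (LINT u:T|lborel. f (z' + of_real u * d') * d')"
proof -
  obtain P where "\<And>x. x \<in> S \<Longrightarrow> (P has_field_derivative f x) (at x within S)"
    using holomorphic_convex_primitive'[OF \<open>convex S\<close> \<open>open S\<close> f] by blast
  then have P: "(P has_field_derivative f x) (at x)" if "x \<in> S" for x
    using that \<open>open S\<close> by (metis at_within_open)
  have connect: "cmod (P (z + of_real u * d) - P (z' + of_real u * d')) \<le> B u" if "u \<in> T" for u
  proof (rule norm_primitive_diff_le[where P = P and f = f])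
    have "closed_segment (z + of_real u * d) (z' + of_real u * d') \<subseteq> S"
      using lines[OF that] \<open>convex S\<close> by (simp add: closed_segment_subset)
    then show "\<And>y. y \<in> closed_segment (z + of_real u * d) (z' + of_real u * d') \<Longrightarrow>
        (P has_field_derivative f y) (at y)"
      using P by blast
  qed (rule bound[OF that])
  have "(\<lambda>n. (P (z + of_real (\<beta> n) * d) - P (z + of_real (\<alpha> n) * d)) -
      (P (z' + of_real (\<beta> n) * d') - P (z' + of_real (\<alpha> n) * d'))) \<longlonglongrightarrow> 0"
  proof (rule Lim_null_comparison, intro always_eventually allI)
    fix n
    have "\<alpha> n \<in> {\<alpha> n..\<beta> n}" "\<beta> n \<in> {\<alpha> n..\<beta> n}" using exhaust(1)[of n] by auto
    then have "\<alpha> n \<in> T" "\<beta> n \<in> T" using exhaust(3) by blast+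
    from order_trans[OF norm_triangle_ineq4 add_mono[OF connect[OF this(2)] connect[OF this(1)]]]
    have "cmod ((P (z + of_real (\<beta> n) * d) - P (z' + of_real (\<beta> n) * d'))
        - (P (z + of_real (\<alpha> n) * d) - P (z' + of_real (\<alpha> n) * d'))) \<le> B (\<beta> n) + B (\<alpha> n)"
      .
    then show "cmod ((P (z + of_real (\<beta> n) * d) - P (z + of_real (\<alpha> n) * d)) -
        (P (z' + of_real (\<beta> n) * d') - P (z' + of_real (\<alpha> n) * d'))) \<le> B (\<beta> n) + B (\<alpha> n)"
      by (simp add: algebra_simps)
  next
    show "(\<lambda>n. B (\<beta> n) + B (\<alpha> n)) \<longlonglongrightarrow> 0" using tendsto_add[OF ends(2,1)] by simp
  qed
  moreover note tendsto_diff[OF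
      set_integral_line_primitive_tendsto[OF exhaust P[OF lines(1)] int(1)]
      set_integral_line_primitive_tendsto[OF exhaust P[OF lines(2)] int(2)]]
  ultimately have "(LINT u:T|lborel. f (z + of_real u * d) * d)
      - (LINT u:T|lborel. f (z' + of_real u * d') * d') = 0"
    using LIMSEQ_unique by blast
  then show ?thesis by (simp only: right_minus_eq)
qed

lemma UN_symmetric_interval: "(\<Union>n. {- real n..real n}) = UNIV"
proof (rule UNIV_eq_I[symmetric])
  fix x :: real
  obtain n where "\<bar>x\<bar> \<le> real n" using real_arch_simple by blast
  then have "x \<in> {- real n..real n}" by auto
  then show "x \<in> (\<Union>n. {- real n..real n})" by blast
qed

lemma powr_le_add:
  fixes a l u x :: real
  assumes "0 < l" "l \<le> x" "x \<le> u"
  shows "x powr a \<le> l powr a + u powr a"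
proof (cases "a \<ge> 0")
  case True
  then have "x powr a \<le> u powr a" using assms by (intro powr_mono2) auto
  then show ?thesis by (simp add: add_increasing)
next
  case False
  then have "x powr a \<le> l powr a" using assms by (intro powr_mono2') auto
  then show ?thesis by (simp add: add_increasing2)
qed

lemma UN_inverse_Suc_Suc_interval: "(\<Union>n. {1 / (real n + 1)..real n + 1}) = {0<..}"
proof (intro equalityI subsetI)
  fix x :: real assume "x \<in> {0<..}"
  obtain n where "real n \<ge> max x (1 / x)" using real_arch_simple by blast
  then have "1 / (real n + 1) \<le> x" "x \<le> real n + 1"
    using \<open>x \<in> {0<..}\<close> by (auto simp: field_simps)
  then show "x \<in> (\<Union>n. {1 / (real n + 1)..real n + 1})" by auto
next
  fix x :: real assume "x \<in> (\<Union>n. {1 / (real n + 1)..real n + 1})"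
  then obtain n where "1 / (real n + 1) \<le> x" by auto
  then have "0 < x" by (rule less_le_trans[rotated]) simp
  then show "x \<in> {0<..}" by simp
qed

definition Gamma_integrand :: "complex \<Rightarrow> complex \<Rightarrow> complex" where
  "Gamma_integrand z x = x powr (z - 1) * exp (- x)"

lemma Gamma_integrand_ray:
  assumes "u > 0" "c \<noteq> 0"
  shows "Gamma_integrand z (of_real u * c) * c
    = c powr z * (of_real u powr (z - 1) * exp (- (c * of_real u)))"
proof -
  have "(of_real u * c) powr (z - 1) = of_real u powr (z - 1) * c powr (z - 1)"
    using assms by (intro powr_times_real_left) auto
  moreover have "c powr (z - 1) * c = c powr z" using assms by (simp add: powr_diff)
  ultimately show ?thesis by (simp add: Gamma_integrand_def mult_ac)
qed

lemma set_integrable_powr_exp: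
  fixes z c :: complex
  assumes "Re z > 0" "Re c > 0"
  shows "set_integrable lborel {0<..} (\<lambda>u::real. of_real u powr (z - 1) * exp (- (c * of_real u)))"
proof -
  let ?f = "\<lambda>u::real. indicator {0<..} u *\<^sub>R (of_real u powr (z - 1) * exp (- (c * of_real u)))"
  have "?f \<in> borel_measurable borel"
    by (intro borel_measurable_continuous_on_indicator continuous_intros)
       (auto simp: complex_nonpos_Reals_iff)
  then have measurable: "?f \<in> borel_measurable lborel" by simp
  have "(\<lambda>u. complex_of_real u powr (z - 1) / of_real (exp (Re c * u))) absolutely_integrable_on {0<..}"
    using assms by (intro absolutely_integrable_Gamma_integral) auto
  then have "integrable lebesgue ?f"
    unfolding set_integrable_def
    by (rule Bochner_Integration.integrable_bound)
       (use measurable in \<open>auto simp: norm_mult norm_divide exp_minus field_simps measurable_completion\<close>)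
  then show ?thesis
    using integrable_completion[OF measurable] by (simp add: set_integrable_def)
qed

lemma set_integrable_Gamma_integrand_ray:
  assumes "Re z > 0" "Re c > 0"
  shows "set_integrable lborel {0<..} (\<lambda>u. Gamma_integrand z (of_real u * c) * c)"
proof -
  have "c \<noteq> 0" using assms by auto
  have "set_integrable lborel {0<..} (\<lambda>u. c powr z
      * (of_real u powr (z - 1) * exp (- (c * of_real u))))"
    using set_integrable_powr_exp[OF assms] by simp
  then show ?thesis
    by (rule set_integrable_cong[THEN iffD2, rotated -1]) (use Gamma_integrand_ray \<open>c \<noteq> 0\<close> in auto)
qed

lemma cmod_Gamma_integrand_le:
  assumes u: "u > 0" and \<kappa>: "0 < \<kappa>" and x: "u * \<kappa> \<le> Re x" "cmod x \<le> u * M"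
  shows "cmod (Gamma_integrand z x) \<le>
    (\<kappa> powr (Re z - 1) + M powr (Re z - 1)) * exp (pi * \<bar>Im z\<bar>) * (u powr (Re z - 1) * exp (- (\<kappa> * u)))"
proof -
  have "0 < u * M" using complex_Re_le_cmod[of x] x u \<kappa> by (smt (verit) mult_pos_pos)
  then have M: "M > 0" using u by (simp add: zero_less_mult_iff)
  have "cmod x powr (Re z - 1) \<le> (u * \<kappa>) powr (Re z - 1) + (u * M) powr (Re z - 1)"
    using u \<kappa> x complex_Re_le_cmod[of x] by (intro powr_le_add) auto
  also have "\<dots> = (\<kappa> powr (Re z - 1) + M powr (Re z - 1)) * u powr (Re z - 1)"
    using u \<kappa> M by (simp add: powr_mult distrib_right)
  finally have "cmod x powr Re (z - 1) * exp (pi * \<bar>Im (z - 1)\<bar>) \<le>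
      (\<kappa> powr (Re z - 1) + M powr (Re z - 1)) * u powr (Re z - 1) * exp (pi * \<bar>Im z\<bar>)"
    by (simp add: mult_right_mono)
  with cmod_powr_le[of x "z - 1"] have "cmod (x powr (z - 1)) \<le>
      (\<kappa> powr (Re z - 1) + M powr (Re z - 1)) * u powr (Re z - 1) * exp (pi * \<bar>Im z\<bar>)"
    by (rule order_trans)
  then have "cmod (Gamma_integrand z x) \<le>
      (\<kappa> powr (Re z - 1) + M powr (Re z - 1)) * u powr (Re z - 1) * exp (pi * \<bar>Im z\<bar>) * exp (- (\<kappa> * u))"
    unfolding Gamma_integrand_def norm_mult using x by (intro mult_mono) (auto simp: mult.commute)
  then show ?thesis by (simp add: mult_ac)
qed

lemma set_integral_Gamma_integrand_ray:
  assumes z: "Re z > 0" and c: "Re c > 0"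
  shows "(LINT u:{0<..}|lborel. Gamma_integrand z (0 + of_real u * c) * c)
    = (LINT u:{0<..}|lborel. Gamma_integrand z (0 + of_real u * 1) * 1)"
proof (rule set_integral_line_shift)
  define \<kappa> M where "\<kappa> = min 1 (Re c)" and "M = max 1 (cmod c)"
  define K where "K = (\<kappa> powr (Re z - 1) + M powr (Re z - 1)) * exp (pi * \<bar>Im z\<bar>)"
  let ?B = "\<lambda>u. K * cmod (c - 1) * (u powr Re z * exp (- (\<kappa> * u)))"
  have \<kappa>: "\<kappa> > 0" using c by (simp add: \<kappa>_def)
  show "cmod (Gamma_integrand z x) * cmod ((0 + of_real u * c) - (0 + of_real u * 1)) \<le> ?B u"
    if u: "u \<in> {0<..}" and x: "x \<in> closed_segment (0 + of_real u * c) (0 + of_real u * 1)" for u x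
  proof -
    have "closed_segment (0 + of_real u * c) (0 + of_real u * 1) \<subseteq> {x. u * \<kappa> \<le> Re x} \<inter> cball 0 (u * M)"
      using u by (intro closed_segment_subset convex_Int convex_cball convex_halfspace_Re_ge)
        (auto simp: \<kappa>_def M_def norm_mult)
    then have "u * \<kappa> \<le> Re x" "cmod x \<le> u * M" using x by auto
    then have "cmod (Gamma_integrand z x) \<le> K * (u powr (Re z - 1) * exp (- (\<kappa> * u)))"
      unfolding K_def using u \<kappa> by (intro cmod_Gamma_integrand_le) auto
    moreover have "cmod ((0 + of_real u * c) - (0 + of_real u * 1)) = u * cmod (c - 1)"
      using u norm_mult[of "of_real u" "c - 1"] by (simp add: algebra_simps)
    ultimately have "cmod (Gamma_integrand z x) * cmod ((0 + of_real u * c) - (0 + of_real u * 1)) \<le>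
        (K * (u powr (Re z - 1) * exp (- (\<kappa> * u)))) * (u * cmod (c - 1))"
      using u by (simp only:) (intro mult_right_mono, auto)
    also have "\<dots> = K * cmod (c - 1) * ((u powr (Re z - 1) * u powr 1) * exp (- (\<kappa> * u)))"
      using u by (simp add: mult_ac)
    also have "u powr (Re z - 1) * u powr 1 = u powr Re z"
      by (simp only: flip: powr_add) simp
    finally show ?thesis .
  qed
  show "open {x. 0 < Re x}" "convex {x. 0 < Re x}"
    by (rule open_halfspace_Re_gt convex_halfspace_Re_gt)+
  show "Gamma_integrand z holomorphic_on {x. 0 < Re x}"
    unfolding Gamma_integrand_def by (intro holomorphic_intros) (auto simp: complex_nonpos_Reals_iff)
  show "1 / (real n + 1) \<le> real n + 1" for n by (simp add: field_simps)
  show "incseq (\<lambda>n. {1 / (real n + 1)..real n + 1})"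
    by (intro incseq_SucI) (simp add: frac_le)
  show "(\<lambda>n. ?B (1 / (real n + 1))) \<longlonglongrightarrow> 0" "(\<lambda>n. ?B (real n + 1)) \<longlonglongrightarrow> 0"
    using \<kappa> z by (intro tendsto_mult_right_zero; real_asymp)+
qed (use set_integrable_Gamma_integrand_ray[OF z c] set_integrable_Gamma_integrand_ray[OF z, of 1]
       c UN_inverse_Suc_Suc_interval in auto)

lemma Gamma_integral_ray:
  fixes z c :: complex
  assumes z: "Re z > 0" and c: "Re c > 0"
  shows "(LINT u:{0<..}|lborel. of_real u powr (z - 1) * exp (- (c * of_real u)))
    = Gamma z * c powr (- z)"
proof -
  have "c \<noteq> 0" using c by auto
  have "c powr z * (LINT u:{0<..}|lborel. of_real u powr (z - 1) * exp (- (c * of_real u)))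
      = (LINT u:{0<..}|lborel. c powr z * (of_real u powr (z - 1) * exp (- (c * of_real u))))"
    by simp
  also have "\<dots> = (LINT u:{0<..}|lborel. Gamma_integrand z (0 + of_real u * c) * c)"
    using Gamma_integrand_ray \<open>c \<noteq> 0\<close> by (intro set_lebesgue_integral_cong) auto
  also have "\<dots> = (LINT u:{0<..}|lborel. Gamma_integrand z (0 + of_real u * 1) * 1)"
    by (rule set_integral_Gamma_integrand_ray[OF z c])
  also have "\<dots> = integral {0<..} (\<lambda>u. Gamma_integrand z (0 + of_real u * 1) * 1)"
    using set_integrable_Gamma_integrand_ray[OF z, of 1]
    by (intro set_borel_integral_eq_integral(2)) simp
  also have "\<dots> = Gamma z"
    using Gamma_integral_complex'[OF z]
    by (intro integral_unique) (simp add: Gamma_integrand_def exp_minus field_simps exp_of_real)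
  finally show ?thesis
    using \<open>c \<noteq> 0\<close> by (simp add: powr_minus field_simps)
qed

section \<open>Mellin transforms of Gaussians\<close>

definition gauss_mellin :: "complex \<Rightarrow> complex \<Rightarrow> complex" where
  "gauss_mellin s \<mu> = (LINT x:{0<..}|lborel.
     of_real x powr (- s) * exp (- (of_real pi * (of_real x)\<^sup>2) - 2 * of_real pi * \<mu> * of_real x))"

definition bromwich_integrand :: "complex \<Rightarrow> complex \<Rightarrow> complex \<Rightarrow> complex" where
  "bromwich_integrand s \<mu> q = q powr (s - 1) * exp (of_real pi * q\<^sup>2 - 2 * of_real pi * \<mu> * q)"

definition bromwich :: "complex \<Rightarrow> complex \<Rightarrow> real \<Rightarrow> complex" where
  "bromwich s \<mu> \<kappa> = (LINT r|lborel. bromwich_integrand s \<mu> (of_real \<kappa> + \<i> * of_real r))"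

lemma has_bochner_integral_gaussian_vertical_line:
  fixes \<mu> :: complex and \<kappa> :: real
  defines "q \<equiv> \<lambda>r::real. of_real \<kappa> + \<i> * of_real r"
  shows "has_bochner_integral lborel (\<lambda>r. exp (of_real pi * (q r)\<^sup>2 - 2 * of_real pi * \<mu> * q r))
    (exp (- (of_real pi * \<mu>\<^sup>2)))"
proof -
  define b where "b = 2 * of_real pi * \<i> * (of_real \<kappa> - \<mu>)"
  define C where "C = exp (of_real pi * (of_real \<kappa>)\<^sup>2 - 2 * of_real pi * \<mu> * of_real \<kappa>)"
  have "has_bochner_integral lborel (\<lambda>r. C * exp (b * of_real r - of_real (pi * r\<^sup>2)))
      (C * (of_real (sqrt (pi / pi)) * exp (b\<^sup>2 / of_real (4 * pi))))"
    by (intro has_bochner_integral_mult_right has_bochner_integral_gaussian) simp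
  moreover have "C * exp (b * of_real r - of_real (pi * r\<^sup>2))
      = exp (of_real pi * (q r)\<^sup>2 - 2 * of_real pi * \<mu> * q r)" for r
    unfolding C_def b_def q_def exp_add[symmetric] by (simp add: power2_eq_square algebra_simps)
  moreover have "C * (of_real (sqrt (pi / pi)) * exp (b\<^sup>2 / of_real (4 * pi)))
      = exp (- (of_real pi * \<mu>\<^sup>2))"
  proof -
    have "C * (of_real (sqrt (pi / pi)) * exp (b\<^sup>2 / of_real (4 * pi))) =
        exp (of_real pi * (of_real \<kappa>)\<^sup>2 - 2 * of_real pi * \<mu> * of_real \<kappa> + b\<^sup>2 / of_real (4 * pi))"
      by (simp add: C_def exp_add)
    also have "of_real pi * (of_real \<kappa>)\<^sup>2 - 2 * of_real pi * \<mu> * of_real \<kappa> + b\<^sup>2 / of_real (4 * pi)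
        = - (of_real pi * \<mu>\<^sup>2)"
    proof -
      have "b\<^sup>2 / of_real (4 * pi) = - (of_real pi * (of_real \<kappa> - \<mu>)\<^sup>2)"
        by (simp add: b_def power_mult_distrib) (simp add: power2_eq_square)
      then show ?thesis by (simp only:) (simp add: power2_eq_square algebra_simps)
    qed
    finally show ?thesis .
  qed
  ultimately show ?thesis by (simp only:)
qed

lemma integral_gaussian_vertical_line_translate:
  fixes \<mu> :: complex and \<kappa> x :: real
  defines "q \<equiv> \<lambda>r::real. of_real \<kappa> + \<i> * of_real r"
  shows "(LINT r|lborel. exp (- (2 * of_real pi * q r * of_real x))
    * exp (of_real pi * (q r)\<^sup>2 - 2 * of_real pi * \<mu> * q r))
    = exp (- (of_real pi * \<mu>\<^sup>2))
    * exp (- (of_real pi * (of_real x)\<^sup>2) - 2 * of_real pi * \<mu> * of_real x)"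
proof -
  have "exp (- (2 * of_real pi * q r * of_real x))
      * exp (of_real pi * (q r)\<^sup>2 - 2 * of_real pi * \<mu> * q r)
      = exp (of_real pi * (q r)\<^sup>2 - 2 * of_real pi * (of_real x + \<mu>) * q r)" for r
    unfolding exp_add[symmetric] by (simp add: algebra_simps)
  then have "(LINT r|lborel. exp (- (2 * of_real pi * q r * of_real x))
      * exp (of_real pi * (q r)\<^sup>2 - 2 * of_real pi * \<mu> * q r))
      = exp (- (of_real pi * (of_real x + \<mu>)\<^sup>2))"
    unfolding q_def
    by (simp only: has_bochner_integral_integral_eq[OF has_bochner_integral_gaussian_vertical_line])
  then show ?thesis
    by (simp add: power2_eq_square algebra_simps flip: exp_add)
qed

definition laplace_kernel :: "complex \<Rightarrow> complex \<Rightarrow> real \<Rightarrow> real \<Rightarrow> real \<Rightarrow> complex" where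
  "laplace_kernel s \<mu> \<kappa> x r = (let q = of_real \<kappa> + \<i> * of_real r in
     indicat_real {0<..} x *\<^sub>R (of_real x powr (- s)) * exp (- (2 * of_real pi * q * of_real x)) *
       exp (of_real pi * q\<^sup>2 - 2 * of_real pi * \<mu> * q))"

lemma has_bochner_integral_powr_exp_vertical_line:
  assumes s: "Re s < 1" and \<kappa>: "\<kappa> > 0"
  defines "q \<equiv> \<lambda>r::real. of_real \<kappa> + \<i> * of_real r"
  shows "has_bochner_integral lborel
      (\<lambda>x. indicat_real {0<..} x *\<^sub>R (of_real x powr (- s))
      * exp (- (2 * of_real pi * q r * of_real x)))
      (Gamma (1 - s) * (2 * of_real pi * q r) powr (s - 1))"
proof -
  have Re_q: "Re (2 * of_real pi * q r) > 0" using \<kappa> by (simp add: q_def)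
  show ?thesis
    using set_integrable_powr_exp[OF _ Re_q, of "1 - s"] Gamma_integral_ray[OF _ Re_q, of "1 - s"] s
    by (simp add: has_bochner_integral_iff set_integrable_def set_lebesgue_integral_def)
qed

lemma integrable_laplace_kernel:
  assumes "Re s < 1" and "\<kappa> > 0"
  shows "integrable (lborel \<Otimes>\<^sub>M lborel) (case_prod (laplace_kernel s \<mu> \<kappa>))"
proof -
  define a where "a x = indicat_real {0<..} x *\<^sub>R (complex_of_real x powr (- s))" for x
  define q where "q r = of_real \<kappa> + \<i> * of_real r" for r :: real
  define E where "E r = exp (of_real pi * (q r)\<^sup>2 - 2 * of_real pi * \<mu> * q r)" for r
  have kernel: "laplace_kernel s \<mu> \<kappa> x r
      = a x * exp (- (2 * of_real pi * q r * of_real x)) * E r" for x r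
    by (simp add: laplace_kernel_def a_def q_def E_def Let_def)
  have [measurable]: "a \<in> borel_measurable borel"
    unfolding a_def
    by (intro borel_measurable_continuous_on_indicator continuous_intros)
       (auto simp: complex_nonpos_Reals_iff)
  have [measurable]: "q \<in> borel_measurable borel" "E \<in> borel_measurable borel"
    unfolding E_def q_def by (intro borel_measurable_continuous_onI continuous_intros)+
  have integrable_E: "integrable lborel E"
    unfolding E_def q_def
    by (intro integrable.intros[OF has_bochner_integral_gaussian_vertical_line])
  show ?thesis
  proof (rule lborel_pair.integrable_pair_bound)
    show "case_prod (laplace_kernel s \<mu> \<kappa>) \<in> borel_measurable (lborel \<Otimes>\<^sub>M lborel)"
      unfolding kernel[abs_def] by measurable
    show "integrable lborel (\<lambda>x. norm (a x * exp (- (2 * of_real pi * q 0 * of_real x))))"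
      using has_bochner_integral_powr_exp_vertical_line[OF assms, of 0]
      by (intro integrable_norm) (simp add: has_bochner_integral_iff a_def q_def)
    show "norm (case (x, r) of (x, r) \<Rightarrow> laplace_kernel s \<mu> \<kappa> x r)
        \<le> norm (a x * exp (- (2 * of_real pi * q 0 * of_real x))) * norm (E r)" for x r
      by (simp add: kernel norm_mult q_def)
  qed (intro integrable_norm integrable_E)
qed

text \<open>The power \<open>x powr (- s)\<close> times a Gaussian is written as a Laplace transform along the vertical line;
  by Cauchy's theorem the result cannot depend on \<open>\<kappa>\<close>.\<close>

lemma gauss_mellin_eq_bromwich:
  fixes s \<mu> :: complex
  assumes s: "Re s < 1" and \<kappa>: "\<kappa> > 0"
  shows "gauss_mellin s \<mu>
    = exp (of_real pi * \<mu>\<^sup>2) * Gamma (1 - s) * of_real (2 * pi) powr (s - 1) * bromwich s \<mu> \<kappa>"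
proof -
  define q where "q r = of_real \<kappa> + \<i> * of_real r" for r :: real
  have inner_r: "(LINT r|lborel. laplace_kernel s \<mu> \<kappa> x r) = exp (- (of_real pi * \<mu>\<^sup>2)) *
      (indicat_real {0<..} x *\<^sub>R
        (of_real x powr (- s) * exp (- (of_real pi * (of_real x)\<^sup>2) - 2 * of_real pi * \<mu> * of_real x)))"
        for x
    using integral_gaussian_vertical_line_translate[of \<kappa> x \<mu>]
    unfolding laplace_kernel_def Let_def mult.assoc integral_mult_right_zero by (simp add: mult_ac)
  have inner_x: "(LINT x|lborel. laplace_kernel s \<mu> \<kappa> x r)
      = Gamma (1 - s) * of_real (2 * pi) powr (s - 1) * bromwich_integrand s \<mu> (q r)" for r
  proof -
    have "(2 * of_real pi * q r) powr (s - 1) = of_real (2 * pi) powr (s - 1) * q r powr (s - 1)"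
      using powr_times_real_left[of "of_real (2 * pi)" "q r" "s - 1"] by simp
    then show ?thesis
      unfolding laplace_kernel_def Let_def q_def[symmetric] integral_mult_left_zero
      using has_bochner_integral_powr_exp_vertical_line[OF s \<kappa>, of r]
      by (simp add: has_bochner_integral_integral_eq bromwich_integrand_def q_def)
  qed
  have "exp (- (of_real pi * \<mu>\<^sup>2)) * gauss_mellin s \<mu>
      = (LINT x|lborel. LINT r|lborel. laplace_kernel s \<mu> \<kappa> x r)"
    unfolding inner_r integral_mult_right_zero
    by (simp add: gauss_mellin_def set_lebesgue_integral_def)
  also have "\<dots> = (LINT r|lborel. LINT x|lborel. laplace_kernel s \<mu> \<kappa> x r)"
    by (rule lborel_pair.Fubini_integral[OF integrable_laplace_kernel[OF s \<kappa>], symmetric])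
  also have "\<dots> = Gamma (1 - s) * of_real (2 * pi) powr (s - 1) * bromwich s \<mu> \<kappa>"
    unfolding inner_x integral_mult_right_zero by (simp add: bromwich_def q_def)
  finally show ?thesis by (simp add: exp_minus field_simps)
qed

lemma Gamma_duplication_reflection:
  fixes s :: complex
  assumes s: "1 - s \<notin> \<int>\<^sub>\<le>\<^sub>0"
  shows "Gamma ((1 - s) / 2) / Gamma (s / 2)
    = exp (s * of_real (ln 2)) * of_real (sqrt pi) * Gamma (1 - s) * sin (of_real pi * (s / 2))
    / of_real pi"
proof -
  have "(1 - s) / 2 \<notin> \<int>\<^sub>\<le>\<^sub>0"
  proof
    assume "(1 - s) / 2 \<in> \<int>\<^sub>\<le>\<^sub>0"
    then obtain n :: int where "n \<le> 0" "(1 - s) / 2 = of_int n" by (auto elim: nonpos_Ints_cases)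
    then have "1 - s = of_int (2 * n)" "2 * n \<le> 0" by (simp_all add: field_simps)
    then show False using s by (metis nonpos_Ints_of_int)
  qed
  moreover have "1 - s / 2 \<notin> \<int>\<^sub>\<le>\<^sub>0"
  proof
    assume "1 - s / 2 \<in> \<int>\<^sub>\<le>\<^sub>0"
    then obtain n :: int where "n \<le> 0" "1 - s / 2 = of_int n" by (auto elim: nonpos_Ints_cases)
    then have "1 - s = of_int (2 * n - 1)" "2 * n - 1 \<le> 0" by (simp_all add: field_simps)
    then show False using s by (metis nonpos_Ints_of_int)
  qed
  moreover have halves: "(1 - s) / 2 + 1 / 2 = 1 - s / 2" "2 * ((1 - s) / 2) = 1 - s"
    by (simp_all add: field_simps)
  ultimately have duplication: "Gamma ((1 - s) / 2) * Gamma (1 - s / 2)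
      = exp (s * of_real (ln 2)) * of_real (sqrt pi) * Gamma (1 - s)"
    using Gamma_legendre_duplication[of "(1 - s) / 2", unfolded halves] by simp
  have "1 / Gamma (s / 2) = Gamma (1 - s / 2) * sin (of_real pi * (s / 2)) / of_real pi"
    using rGamma_reflection_complex[of "s / 2"] \<open>1 - s / 2 \<notin> \<int>\<^sub>\<le>\<^sub>0\<close>
    by (simp add: Gamma_def rGamma_eq_zero_iff field_simps)
  then have "Gamma ((1 - s) / 2) / Gamma (s / 2)
      = Gamma ((1 - s) / 2) * (Gamma (1 - s / 2) * sin (of_real pi * (s / 2)) / of_real pi)"
    by (metis mult.right_neutral times_divide_eq_right)
  also have "\<dots> = (Gamma ((1 - s) / 2) * Gamma (1 - s / 2)) * sin (of_real pi * (s / 2)) / of_real pi"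
    by simp
  finally show ?thesis unfolding duplication .
qed

lemma two_sin_half_pi:
  fixes s :: complex
  shows "2 * sin (of_real pi * (s / 2)) = \<i> * exp (- (pi * \<i> * s / 2)) * (1 - exp (pi * \<i> * s))"
proof -
  have "exp (pi * \<i> * s) = exp (pi * \<i> * s / 2) * exp (pi * \<i> * s / 2)"
    by (simp add: mult_ac flip: exp_add)
  then show ?thesis by (simp only:) (simp add: sin_exp_eq exp_minus field_simps)
qed

lemma chi_eq_Gamma:
  assumes s: "1 - s \<notin> \<int>\<^sub>\<le>\<^sub>0"
  shows "chi s = of_real (2 * pi) powr (s - 1) * Gamma (1 - s) * \<i> * exp (- (pi * \<i> * s / 2))
    * (1 - exp (pi * \<i> * s))"
proof -
  have pi_power: "of_real pi powr (s - 1 / 2) * of_real (sqrt pi) / of_real pi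
      = of_real pi powr (s - 1)"
  proof -
    have "complex_of_real (sqrt pi) = of_real pi powr (1 / 2)"
      using powr_of_real[of pi "1/2"] by (simp add: powr_half_sqrt)
    then show ?thesis by (simp add: powr_diff)
  qed
  have two_pi_power: "of_real (2 * pi) powr (s - 1)
      = exp (s * of_real (ln 2)) / 2 * of_real pi powr (s - 1)"
  proof -
    have "complex_of_real 2 powr s = exp (s * of_real (ln 2))"
      using Ln_of_real[of 2] by (simp add: powr_def)
    then show ?thesis
      using powr_times_real[of "of_real 2" "of_real pi" "s - 1"] by (simp add: powr_diff)
  qed
  have "chi s = of_real pi powr (s - 1 / 2) * (Gamma ((1 - s) / 2) / Gamma (s / 2))"
    by (simp add: chi_def)
  also have "\<dots> = (of_real pi powr (s - 1 / 2) * of_real (sqrt pi) / of_real pi) *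
      (exp (s * of_real (ln 2)) * Gamma (1 - s) * sin (of_real pi * (s / 2)))"
    unfolding Gamma_duplication_reflection[OF s] by simp
  also have "\<dots> = of_real (2 * pi) powr (s - 1) * Gamma (1 - s) * (2 * sin (of_real pi * (s / 2)))"
    unfolding pi_power two_pi_power by simp
  finally show ?thesis unfolding two_sin_half_pi by (simp add: mult_ac)
qed

section \<open>The integral through the origin\<close>

lemma abs_le_abs_sinh: "\<bar>x\<bar> \<le> \<bar>sinh x\<bar>" for x :: real
  using real_le_abs_sinh[of x] by (simp add: sinh_def exp_minus)

lemma abs_sin_pi_ge:
  fixes y :: real
  assumes "\<bar>y\<bar> \<le> 3 / 4"
  shows "\<bar>y\<bar> / 2 \<le> \<bar>sin (pi * y)\<bar>"
proof -
  define u where "u = \<bar>y\<bar> * (4 / 3)"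
  have u: "0 \<le> u" "u \<le> 1" using assms by (auto simp: u_def)
  have "convex_on {0..pi} (\<lambda>x. - sin x)"
    by (rule f''_ge0_imp_convex[where f' = "\<lambda>x. - cos x" and f'' = sin])
       (auto intro!: derivative_eq_intros sin_ge_zero)
  from convex_onD[OF this u, of 0 "3 / 4 * pi"]
  have chord: "u * sin (3 / 4 * pi) \<le> sin (pi * \<bar>y\<bar>)"
    by (simp add: u_def mult.commute)
  have "\<bar>y\<bar> / 2 \<le> u * (1 / 2)" by (simp add: u_def)
  also have "\<dots> \<le> u * (sqrt 2 / 2)" using u by (intro mult_left_mono) auto
  also have "\<dots> = u * sin (3 / 4 * pi)"
    using sin_pi_minus[of "pi / 4"] by (simp add: sin_45 field_simps)
  also note chord
  also have "sin (pi * \<bar>y\<bar>) \<le> \<bar>sin (pi * y)\<bar>" by (simp add: abs_if)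
  finally show ?thesis .
qed

lemma cmod_sin_squared: "(cmod (sin z))\<^sup>2 = (sin (Re z))\<^sup>2 + (sinh (Im z))\<^sup>2"
proof -
  have "cos (2 * Re z) = 1 - 2 * (sin (Re z))\<^sup>2" by (simp add: cos_double_sin)
  moreover have "(sinh (Im z))\<^sup>2 = (exp (2 * Im z) + inverse (exp (2 * Im z)) - 2) / 4"
    by (simp add: sinh_def power2_eq_square field_simps exp_minus flip: exp_add)
  ultimately show ?thesis unfolding norm_sin_squared by simp
qed

lemma abs_sinh_Im_le_cmod_sin: "\<bar>sinh (Im z)\<bar> \<le> cmod (sin z)"
  by (rule power2_le_imp_le) (simp_all add: cmod_sin_squared)

lemma cmod_sin_pi_ge:
  fixes x :: complex
  assumes "0 \<le> Re x - Im x" "Re x - Im x \<le> 1 / 2"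
  shows "cmod x / 2 \<le> cmod (sin (pi * x))"
proof (cases "\<bar>Im x\<bar> \<le> 1 / 4")
  case True
  then have "\<bar>Re x\<bar> / 2 \<le> \<bar>sin (pi * Re x)\<bar>" using assms by (intro abs_sin_pi_ge) linarith
  then have "(\<bar>Re x\<bar> / 2)\<^sup>2 \<le> \<bar>sin (pi * Re x)\<bar>\<^sup>2" by (intro power_mono) auto
  moreover have "\<bar>Im x\<bar> / 2 \<le> \<bar>sinh (pi * Im x)\<bar>"
    using abs_le_abs_sinh[of "pi * Im x"] mult_right_mono[of "1 / 2" pi "\<bar>Im x\<bar>"] pi_gt3
    by (simp add: abs_mult)
  then have "(\<bar>Im x\<bar> / 2)\<^sup>2 \<le> \<bar>sinh (pi * Im x)\<bar>\<^sup>2" by (intro power_mono) auto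
  ultimately have "(cmod x / 2)\<^sup>2 \<le> (cmod (sin (pi * x)))\<^sup>2"
    unfolding cmod_sin_squared by (simp add: cmod_power2 power_divide)
  then show ?thesis by (rule power2_le_imp_le) simp
next
  case False
  have "cmod x \<le> \<bar>Re x\<bar> + \<bar>Im x\<bar>" by (rule cmod_le)
  also have "\<dots> \<le> 4 * \<bar>Im x\<bar>" using False assms by linarith
  finally have "cmod x / 2 \<le> 2 * \<bar>Im x\<bar>" by simp
  also have "\<dots> \<le> pi * \<bar>Im x\<bar>" using pi_gt3 by (intro mult_right_mono) auto
  also have "\<dots> \<le> \<bar>sinh (pi * Im x)\<bar>" using abs_le_abs_sinh[of "pi * Im x"] by (simp add: abs_mult)
  also have "\<dots> \<le> cmod (sin (pi * x))" using abs_sinh_Im_le_cmod_sin[of "pi * x"] by simp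
  finally show ?thesis .
qed

lemma R_integrand_eq:
  fixes s x :: complex
  shows "R_integrand s x = x powr (- s) * exp (pi * \<i> * x\<^sup>2) / (2 * \<i> * sin (pi * x))"
proof -
  have "exp (pi * \<i> * x) - exp (- pi * \<i> * x) = 2 * \<i> * sin (pi * x)"
    by (simp add: sin_exp_eq field_simps)
  then show ?thesis by (simp add: R_integrand_def)
qed

lemma Re_pi_i_square_le:
  fixes x :: complex
  assumes "0 \<le> Re x - Im x" "Re x - Im x \<le> 1 / 2"
  shows "Re (pi * \<i> * x\<^sup>2) \<le> pi * \<bar>Im x\<bar> - 2 * pi * (Im x)\<^sup>2"
proof -
  have "(Re x - Im x) * (- Im x) \<le> (1 / 2) * \<bar>Im x\<bar>"
  proof -
    have "(Re x - Im x) * (- Im x) \<le> (Re x - Im x) * \<bar>Im x\<bar>"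
      using assms by (intro mult_left_mono) auto
    also have "\<dots> \<le> (1 / 2) * \<bar>Im x\<bar>"
      using assms by (intro mult_right_mono) auto
    finally show ?thesis .
  qed
  then have "2 * pi * ((Re x - Im x) * (- Im x)) \<le> 2 * pi * ((1 / 2) * \<bar>Im x\<bar>)"
    by (intro mult_left_mono) auto
  then show ?thesis by (simp add: power2_eq_square algebra_simps)
qed

lemma cmod_R_integrand_le:
  fixes s x :: complex
  assumes s: "Re s \<le> -1" and x: "0 \<le> Re x - Im x" "Re x - Im x \<le> 1 / 2"
  shows "cmod (R_integrand s x) \<le> exp (pi * \<bar>Im s\<bar> + (1 - Re s)\<^sup>2 / 2) * exp (- (4 * (Im x)\<^sup>2))"
proof (cases "x = 0")
  case False
  define v where "v = \<bar>Im x\<bar>"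
  define b where "b = - Re s - 1"
  have b: "b \<ge> 0" and v: "v \<ge> 0" using s by (auto simp: b_def v_def)
  have "cmod x \<le> 1 + 2 * v" using cmod_le[of x] x by (simp add: v_def)
  also have "\<dots> \<le> exp (2 * v)" by simp
  finally have "cmod x powr b \<le> exp (2 * v) powr b" using b by (intro powr_mono2) auto
  then have power_le: "cmod x powr b \<le> exp (2 * b * v)" using False by (simp add: powr_def)
  have "cmod (R_integrand s x)
      = cmod (x powr (- s)) * exp (Re (pi * \<i> * x\<^sup>2)) / (2 * cmod (sin (pi * x)))"
    by (simp add: R_integrand_eq norm_mult norm_divide)
  also have "\<dots> \<le> (cmod x powr Re (- s) * exp (pi * \<bar>Im (- s)\<bar>)) * exp (pi * v - 2 * pi * v\<^sup>2) / cmod x"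
    using cmod_sin_pi_ge[OF x] False Re_pi_i_square_le[OF x]
    by (intro frac_le mult_mono cmod_powr_le) (auto simp: v_def)
  also have "\<dots> = cmod x powr b * exp (pi * \<bar>Im s\<bar>) * exp (pi * v - 2 * pi * v\<^sup>2)"
    using False powr_add[of "cmod x" b 1] by (simp add: b_def)
  also have "\<dots> \<le> exp (2 * b * v) * exp (pi * \<bar>Im s\<bar>) * exp (pi * v - 2 * pi * v\<^sup>2)"
    by (intro mult_right_mono power_le) auto
  also have "\<dots> = exp (pi * \<bar>Im s\<bar> + (2 * b * v + pi * v - 2 * pi * v\<^sup>2))"
    by (simp add: algebra_simps flip: exp_add)
  also have "\<dots> \<le> exp (pi * \<bar>Im s\<bar> + ((b + 2)\<^sup>2 / 2 - 4 * v\<^sup>2))"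
  proof -
    have "pi * v \<le> 4 * v" "3 * v\<^sup>2 \<le> pi * v\<^sup>2"
      using pi_less_4 pi_gt3 v by (auto intro!: mult_right_mono)
    moreover have "0 \<le> (2 * v - (b + 2))\<^sup>2" by simp
    ultimately have "2 * b * v + pi * v - 2 * pi * v\<^sup>2 \<le> (b + 2)\<^sup>2 / 2 - 4 * v\<^sup>2"
      by (simp add: power2_eq_square algebra_simps)
    then show ?thesis by simp
  qed
  also have "\<dots> = exp (pi * \<bar>Im s\<bar> + (1 - Re s)\<^sup>2 / 2) * exp (- (4 * (Im x)\<^sup>2))"
    by (simp add: b_def v_def add_diff_eq flip: exp_add)
  finally show ?thesis .
qed (simp add: R_integrand_def)

lemma sin_pi_nonzero:
  fixes x :: complex
  assumes "x \<notin> \<int>"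
  shows "sin (pi * x) \<noteq> 0"
proof
  assume "sin (pi * x) = 0"
  then obtain n :: int where "pi * x = of_real (n * pi)" by (auto simp: sin_eq_0)
  then have "x = of_int n" by (simp add: mult.commute)
  with assms show False by auto
qed

lemma holomorphic_on_R_integrand:
  assumes "A \<inter> \<real>\<^sub>\<le>\<^sub>0 = {}" "A \<inter> \<int> = {}"
  shows "R_integrand s holomorphic_on A"
  unfolding R_integrand_eq[abs_def] using assms sin_pi_nonzero by (intro holomorphic_intros) auto

lemma isCont_R_integrand:
  assumes "x \<notin> \<real>\<^sub>\<le>\<^sub>0" "x \<notin> \<int>"
  shows "isCont (R_integrand s) x"
  unfolding R_integrand_eq[abs_def] using assms sin_pi_nonzero[of x] by (intro continuous_intros) auto

lemma omega_dir_eq_cis: "omega_dir = cis (- (3 * pi / 4))"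
  by (simp add: omega_dir_def cis_conv_exp field_simps)

lemma omega_dir_eq_uminus_cis: "omega_dir = - cis (pi / 4)"
proof -
  have "omega_dir = cis (pi / 4 - pi)" by (simp add: omega_dir_eq_cis field_simps)
  then show ?thesis using cis_divide[of "pi / 4" pi] by simp
qed

lemma norm_omega_dir: "cmod omega_dir = 1"
  by (simp add: omega_dir_eq_cis)

definition R_line :: "complex \<Rightarrow> real \<Rightarrow> real \<Rightarrow> complex" where
  "R_line s a u = R_integrand s (of_real a + of_real u * omega_dir) * omega_dir"

lemma R_line_coordinates:
  fixes a u :: real
  defines "x \<equiv> of_real a + of_real u * omega_dir"
  shows "Re x - Im x = a" "Im x = - (u * (sqrt 2 / 2))"
  by (simp_all add: x_def omega_dir_eq_uminus_cis cos_45 sin_45)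

lemma R_line_avoids_singularities:
  fixes a u :: real
  assumes "0 < a \<and> a < 1 \<or> u \<noteq> 0"
  defines "x \<equiv> of_real a + of_real u * omega_dir"
  shows "x \<notin> \<real>\<^sub>\<le>\<^sub>0" "x \<notin> \<int>"
proof -
  have "Im x \<noteq> 0" if "u \<noteq> 0" using that R_line_coordinates(2)[of a u] by (simp add: x_def)
  moreover have "x = of_real a" if "u = 0" using that by (simp add: x_def)
  moreover have "of_real a \<notin> (\<int> :: complex set)" if "0 < a" "a < 1"
    using that by (auto elim!: Ints_cases simp: complex_eq_iff)
  ultimately show "x \<notin> \<real>\<^sub>\<le>\<^sub>0" "x \<notin> \<int>"
    using assms(1) by (cases "u = 0"; force simp: complex_nonpos_Reals_iff complex_is_Int_iff)+
qed

lemma cmod_R_line_le: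
  assumes "Re s \<le> -1" "0 \<le> a" "a \<le> 1 / 2"
  shows "cmod (R_line s a u) \<le> exp (pi * \<bar>Im s\<bar> + (1 - Re s)\<^sup>2 / 2) * exp (- (2 * u\<^sup>2))"
proof -
  have "4 * (Im (of_real a + of_real u * omega_dir))\<^sup>2 = 2 * u\<^sup>2"
    unfolding R_line_coordinates by (simp add: power_mult_distrib power_divide)
  then show ?thesis
    using cmod_R_integrand_le[OF assms(1), of "of_real a + of_real u * omega_dir",
        unfolded R_line_coordinates(1), OF assms(2,3)]
    by (simp only: R_line_def norm_mult norm_omega_dir mult_1_right)
qed

lemma borel_measurable_R_line:
  assumes "0 \<le> a" "a < 1"
  shows "R_line s a \<in> borel_measurable lborel"
proof -
  let ?A = "if a = 0 then - {0} else UNIV :: real set"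
  have "isCont (\<lambda>u. R_integrand s (of_real a + of_real u * omega_dir)) u" if "u \<in> ?A" for u
  proof (rule isCont_o2[where g = "R_integrand s"])
    have "0 < a \<and> a < 1 \<or> u \<noteq> 0" using assms that by (auto split: if_splits)
    then show "isCont (R_integrand s) (of_real a + of_real u * omega_dir)"
      by (intro isCont_R_integrand R_line_avoids_singularities)
  qed (intro continuous_intros)
  then have "continuous_on ?A (R_line s a)"
    unfolding R_line_def by (intro continuous_at_imp_continuous_on ballI continuous_intros) auto
  then have "(\<lambda>u. indicat_real ?A u *\<^sub>R R_line s a u) \<in> borel_measurable borel"
    by (intro borel_measurable_continuous_on_indicator) auto
  moreover have "(\<lambda>u. indicat_real ?A u *\<^sub>R R_line s a u) = R_line s a"
    by (auto simp: fun_eq_iff indicator_def R_line_def R_integrand_def)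
  ultimately show ?thesis by simp
qed

lemma integrable_R_line:
  assumes "Re s \<le> -1" "0 \<le> a" "a \<le> 1 / 2"
  shows "integrable lborel (R_line s a)"
proof (rule Bochner_Integration.integrable_bound)
  show "integrable lborel (\<lambda>u. exp (pi * \<bar>Im s\<bar> + (1 - Re s)\<^sup>2 / 2) * exp (- (2 * u\<^sup>2)))"
    by (intro integrable_mult_right integrable_exp_neg_square) simp
  show "R_line s a \<in> borel_measurable lborel" using assms by (intro borel_measurable_R_line) auto
qed (use cmod_R_line_le[OF assms] in auto)

lemma cmod_R_integrand_horizontal_segment_le:
  fixes a b u :: real
  defines "A \<equiv> of_real a + of_real u * omega_dir" and "B \<equiv> of_real b + of_real u * omega_dir"
  assumes s: "Re s \<le> -1" and ab: "0 \<le> a" "a \<le> 1 / 2" "0 \<le> b" "b \<le> 1 / 2" and x: "x \<in> closed_segment A B"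
  shows "cmod (R_integrand s x) * cmod (A - B)
    \<le> exp (pi * \<bar>Im s\<bar> + (1 - Re s)\<^sup>2 / 2) * exp (- (2 * u\<^sup>2))"
proof -
  obtain v where v: "0 \<le> v" "v \<le> 1"
    and x_eq: "x = of_real ((1 - v) * a + v * b) + of_real u * omega_dir"
    using x by (auto simp: in_segment A_def B_def scaleR_conv_of_real algebra_simps)
  have "0 \<le> (1 - v) * a + v * b" "(1 - v) * a + v * b \<le> 1 / 2"
    using v ab convex_bound_le[of a "1 / 2" b "1 - v" v] by auto
  then have "cmod (R_integrand s x) \<le> exp (pi * \<bar>Im s\<bar> + (1 - Re s)\<^sup>2 / 2) * exp (- (2 * u\<^sup>2))"
    using cmod_R_line_le[OF s, of "(1 - v) * a + v * b" u]
    by (simp add: x_eq R_line_def norm_mult norm_omega_dir)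
  moreover have "cmod (A - B) \<le> 1"
    unfolding A_def B_def add_diff_cancel_right of_real_diff[symmetric] norm_of_real using ab by simp
  ultimately have "cmod (R_integrand s x) * cmod (A - B)
      \<le> exp (pi * \<bar>Im s\<bar> + (1 - Re s)\<^sup>2 / 2) * exp (- (2 * u\<^sup>2)) * 1"
    by (intro mult_mono) auto
  then show ?thesis by simp
qed

lemma riemann_R_eq_R_line:
  assumes s: "Re s \<le> -1" and a: "0 < a" "a \<le> 1 / 2"
  shows "riemann_R s = (LINT u|lborel. R_line s a u)"
proof -
  let ?strip = "{x. 0 < Re x - Im x} \<inter> {x. Re x - Im x < 1}"
  let ?B = "\<lambda>u. exp (pi * \<bar>Im s\<bar> + (1 - Re s)\<^sup>2 / 2) * exp (- (2 * u\<^sup>2))"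
  have strip: "?strip = {x. inner (Complex 1 (-1)) x > 0} \<inter> {x. inner (Complex 1 (-1)) x < 1}"
    by (simp add: inner_complex_def)
  have "(LINT u:UNIV|lborel. R_integrand s (of_real (1 / 2) + of_real u * omega_dir) * omega_dir)
      = (LINT u:UNIV|lborel. R_integrand s (of_real a + of_real u * omega_dir) * omega_dir)"
  proof (rule set_integral_line_shift)
    show "open ?strip" "convex ?strip"
      unfolding strip
      by (intro open_Int open_halfspace_gt open_halfspace_lt
            convex_Int convex_halfspace_gt convex_halfspace_lt)+
    show "R_integrand s holomorphic_on ?strip"
      by (rule holomorphic_on_R_integrand) (auto simp: complex_nonpos_Reals_iff elim!: Ints_cases)
    show "incseq (\<lambda>n. {- real n..real n})" by (intro incseq_SucI) auto
    show "(\<lambda>n. ?B (- real n)) \<longlonglongrightarrow> 0" "(\<lambda>n. ?B (real n)) \<longlonglongrightarrow> 0"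
      by (intro tendsto_mult_right_zero; real_asymp)+
    show "of_real (1 / 2) + of_real u * omega_dir \<in> ?strip"
      "of_real a + of_real u * omega_dir \<in> ?strip" for u
      unfolding Int_iff mem_Collect_eq R_line_coordinates(1) using a by auto
    show "cmod (R_integrand s x)
        * cmod ((of_real (1 / 2) + of_real u * omega_dir) - (of_real a + of_real u * omega_dir))
        \<le> ?B u"
      if "x \<in> closed_segment (of_real (1 / 2) + of_real u * omega_dir)
          (of_real a + of_real u * omega_dir)" for u x
      using cmod_R_integrand_horizontal_segment_le[OF s _ _ _ _ that] a by simp
  qed (use a UN_symmetric_interval integrable_R_line[OF s, of a] integrable_R_line[OF s, of "1 / 2"]
      in \<open>auto simp: set_integrable_def R_line_def[abs_def]\<close>)
  moreover have "riemann_R s = (LINT u|lborel. R_line s (1 / 2) u)"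
    using integral_lborel[OF integrable_R_line[OF s, of "1 / 2"]]
    by (simp add: riemann_R_def R_line_def[abs_def])
  ultimately show ?thesis
    by (simp add: set_lebesgue_integral_def R_line_def)
qed

lemma riemann_R_eq_R_line_origin:
  assumes s: "Re s \<le> -1"
  shows "riemann_R s = (LINT u|lborel. R_line s 0 u)"
proof -
  define a where "a n = 1 / (real n + 2)" for n
  have a: "0 < a n" "a n \<le> 1 / 2" for n by (auto simp: a_def field_simps)
  have "(\<lambda>n. LINT u|lborel. R_line s (a n) u) \<longlonglongrightarrow> (LINT u|lborel. R_line s 0 u)"
  proof (rule integral_dominated_convergence)
    show "integrable lborel (\<lambda>u. exp (pi * \<bar>Im s\<bar> + (1 - Re s)\<^sup>2 / 2) * exp (- (2 * u\<^sup>2)))"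
      by (intro integrable_mult_right integrable_exp_neg_square) simp
    show "AE u in lborel. (\<lambda>n. R_line s (a n) u) \<longlonglongrightarrow> R_line s 0 u"
    proof (rule eventually_mono[OF AE_lborel_singleton[of 0]])
      fix u :: real assume "u \<noteq> 0"
      have "a \<longlonglongrightarrow> 0" unfolding a_def by real_asymp
      then have "(\<lambda>n. of_real (a n) + of_real u * omega_dir) \<longlonglongrightarrow> of_real 0 + of_real u * omega_dir"
        by (intro tendsto_intros)
      then show "(\<lambda>n. R_line s (a n) u) \<longlonglongrightarrow> R_line s 0 u"
        unfolding R_line_def using \<open>u \<noteq> 0\<close>
        by (intro tendsto_mult isCont_tendsto_compose[OF isCont_R_integrand] R_line_avoids_singularities
              tendsto_const) auto
    qed
    have "0 \<le> a n" "a n < 1" for n using a[of n] by auto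
    then show "R_line s (a n) \<in> borel_measurable lborel" for n by (rule borel_measurable_R_line)
    show "R_line s 0 \<in> borel_measurable lborel" by (rule borel_measurable_R_line) auto
  qed (use a cmod_R_line_le[OF s] in \<open>auto simp: less_imp_le\<close>)
  then show ?thesis
    using riemann_R_eq_R_line[OF s a] by (simp add: LIMSEQ_const_iff)
qed

lemma lborel_integral_fold:
  fixes f :: "real \<Rightarrow> complex"
  assumes f: "integrable lborel f"
  shows "set_integrable lborel {0<..} (\<lambda>x. f (- x))"
    and "(LINT x|lborel. f x) = (LINT x:{0<..}|lborel. f (- x)) + (LINT x:{0<..}|lborel. f x)"
proof -
  have "integrable lborel (\<lambda>x. f (- x))"
    using lborel_integrable_real_affine[OF f, of "-1" 0] by simp
  then show "set_integrable lborel {0<..} (\<lambda>x. f (- x))"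
    unfolding set_integrable_def by (intro integrable_mult_indicator) simp
  have parts: "set_integrable lborel {..<0} f" "set_integrable lborel {0<..} f"
    using f unfolding set_integrable_def by (auto intro!: integrable_mult_indicator)
  have "(LINT x|lborel. f x) = (LINT x:{..<0} \<union> {0<..}|lborel. f x)"
    unfolding set_lebesgue_integral_def
  proof (rule integral_cong_AE)
    show "AE x in lborel. f x = indicat_real ({..<0} \<union> {0<..}) x *\<^sub>R f x"
      using AE_lborel_singleton[of "0::real"] by eventually_elim (auto simp: indicator_def)
  qed (use f in auto)
  also have "\<dots> = (LINT x:{..<0}|lborel. f x) + (LINT x:{0<..}|lborel. f x)"
    using parts by (intro set_integral_Un) auto
  also have "(LINT x:{..<0}|lborel. f x) = (LINT x:{0<..}|lborel. f (- x))"
    by (subst set_integral_reflect) (simp add: greaterThan_def)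
  finally show "(LINT x|lborel. f x) = (LINT x:{0<..}|lborel. f (- x)) + (LINT x:{0<..}|lborel. f x)" .
qed

lemma of_real_mult_cis_powr:
  fixes z :: complex
  assumes "r > 0" "- pi < t" "t \<le> pi"
  shows "(of_real r * cis t) powr z = of_real r powr z * exp (\<i> * of_real t * z)"
proof -
  have "cis t powr z = exp (\<i> * of_real t * z)"
    using assms by (simp add: cis_conv_exp exp_powr_complex)
  then show ?thesis using assms by (simp add: powr_times_real_left)
qed

definition rot :: complex where
  "rot = cis (- pi / 4)"

lemma rot_square: "rot\<^sup>2 = - \<i>"
  by (simp add: rot_def power2_eq_square cis_mult)

lemma i_times_cis_pi_quarter: "\<i> * cis (pi / 4) = - rot"
  by (simp add: rot_def complex_eq_iff cos_45 sin_45)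

definition ray_kernel :: "complex \<Rightarrow> real \<Rightarrow> complex" where
  "ray_kernel s r = (let w = exp (- (of_real pi * rot * of_real r)) in
     of_real r powr (- s) * exp (- (of_real pi * (of_real r)\<^sup>2)) * w / (1 - w\<^sup>2))"

lemma ray_kernel_eq:
  fixes r :: real
  defines "x \<equiv> of_real r * cis (pi / 4)"
  shows "ray_kernel s r
    = of_real r powr (- s) * exp (pi * \<i> * x\<^sup>2) / (exp (- pi * \<i> * x) - exp (pi * \<i> * x))"
proof -
  define w where "w = exp (pi * \<i> * x)"
  have "pi * \<i> * x = of_real pi * (\<i> * cis (pi / 4)) * of_real r" by (simp add: x_def)
  then have "pi * \<i> * x = - (of_real pi * rot * of_real r)" by (simp add: i_times_cis_pi_quarter)
  then have "ray_kernel s r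
      = of_real r powr (- s) * exp (- (of_real pi * (of_real r)\<^sup>2)) * (w / (1 - w\<^sup>2))"
    by (simp add: ray_kernel_def w_def Let_def)
  moreover have "pi * \<i> * x\<^sup>2 = - (of_real pi * (of_real r)\<^sup>2)"
    by (simp add: x_def power_mult_distrib mult_ac cis_mult power2_eq_square[of "cis (pi / 4)"])
  moreover have "exp (- pi * \<i> * x) - exp (pi * \<i> * x) = (1 - w\<^sup>2) / w"
    by (simp add: w_def exp_minus field_simps power2_eq_square)
  ultimately show ?thesis by (simp only: divide_divide_eq_right times_divide_eq_right)
qed

lemma R_integrand_ray:
  fixes s :: complex and r :: real
  assumes r: "r > 0"
  defines "x \<equiv> of_real r * cis (pi / 4)"
  shows "R_integrand s x = - exp (- (\<i> * pi * s / 4)) * ray_kernel s r"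
    and "R_integrand s (- x) = exp (3 * (\<i> * pi * s / 4)) * ray_kernel s r"
proof -
  have "x powr (- s) = of_real r powr (- s) * exp (- (\<i> * pi * s / 4))"
    using of_real_mult_cis_powr[of r "pi / 4" "- s"] r by (simp add: x_def mult_ac)
  moreover have "exp (pi * \<i> * x) - exp (- pi * \<i> * x) = - (exp (- pi * \<i> * x) - exp (pi * \<i> * x))"
    by simp
  ultimately show "R_integrand s x = - exp (- (\<i> * pi * s / 4)) * ray_kernel s r"
    unfolding R_integrand_def ray_kernel_eq x_def[symmetric] by (simp only: divide_minus_right) simp
  have "- x = of_real r * cis (- (3 * pi / 4))"
    using omega_dir_eq_uminus_cis by (simp add: x_def omega_dir_eq_cis)
  then have "(- x) powr (- s) = of_real r powr (- s) * exp (3 * (\<i> * pi * s / 4))"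
    using of_real_mult_cis_powr[of r "- (3 * pi / 4)" "- s"] r pi_gt_zero by (simp add: mult_ac)
  then show "R_integrand s (- x) = exp (3 * (\<i> * pi * s / 4)) * ray_kernel s r"
    unfolding R_integrand_def ray_kernel_eq x_def[symmetric] by simp
qed

lemma R_line_origin_rays:
  fixes s :: complex and r :: real
  assumes r: "r > 0"
  shows "R_line s 0 (- r) = exp (\<i> * pi * (1 - s) / 4) * ray_kernel s r"
    and "R_line s 0 r = - exp (pi * \<i> * s) * exp (\<i> * pi * (1 - s) / 4) * ray_kernel s r"
proof -
  define x where "x = of_real r * cis (pi / 4)"
  have line: "of_real 0 + of_real (- r) * omega_dir = x" "of_real 0 + of_real r * omega_dir = - x"
    by (simp_all add: x_def omega_dir_eq_uminus_cis)
  have cis: "cis (pi / 4) = exp (\<i> * pi / 4)" by (simp add: cis_conv_exp)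
  have phases: "exp (- (\<i> * pi * s / 4)) * cis (pi / 4) = exp (\<i> * pi * (1 - s) / 4)"
    "exp (3 * (\<i> * pi * s / 4)) * cis (pi / 4) = exp (pi * \<i> * s) * exp (\<i> * pi * (1 - s) / 4)"
    unfolding cis exp_add[symmetric] by (simp_all add: field_simps)
  have "R_line s 0 (- r) = (exp (- (\<i> * pi * s / 4)) * cis (pi / 4)) * ray_kernel s r"
    unfolding R_line_def line unfolding x_def R_integrand_ray(1)[OF r] omega_dir_eq_uminus_cis by simp
  then show "R_line s 0 (- r) = exp (\<i> * pi * (1 - s) / 4) * ray_kernel s r"
    unfolding phases .
  have "R_line s 0 r = - (exp (3 * (\<i> * pi * s / 4)) * cis (pi / 4)) * ray_kernel s r"
    unfolding R_line_def line unfolding x_def R_integrand_ray(2)[OF r] omega_dir_eq_uminus_cis by simp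
  then show "R_line s 0 r = - exp (pi * \<i> * s) * exp (\<i> * pi * (1 - s) / 4) * ray_kernel s r"
    unfolding phases by simp
qed

lemma riemann_R_eq_ray_integral:
  assumes s: "Re s \<le> -1"
  shows "set_integrable lborel {0<..} (ray_kernel s)"
    and "riemann_R s = (1 - exp (pi * \<i> * s)) * exp (\<i> * pi * (1 - s) / 4)
      * (LINT r:{0<..}|lborel. ray_kernel s r)"
proof -
  define C where "C = exp (\<i> * pi * (1 - s) / 4)"
  have integrable: "integrable lborel (R_line s 0)" using s by (intro integrable_R_line) auto
  have "set_integrable lborel {0<..} (\<lambda>r. C * ray_kernel s r)"
    using lborel_integral_fold(1)[OF integrable]
    by (rule set_integrable_cong[THEN iffD1, rotated -1]) (auto simp: R_line_origin_rays(1) C_def)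
  then show "set_integrable lborel {0<..} (ray_kernel s)" by (simp add: C_def)
  have "riemann_R s = (LINT r:{0<..}|lborel. R_line s 0 (- r)) + (LINT r:{0<..}|lborel. R_line s 0 r)"
    unfolding riemann_R_eq_R_line_origin[OF s] by (rule lborel_integral_fold(2)[OF integrable])
  also have "(LINT r:{0<..}|lborel. R_line s 0 (- r)) = (LINT r:{0<..}|lborel. C * ray_kernel s r)"
    by (rule set_lebesgue_integral_cong) (auto simp: R_line_origin_rays(1) C_def)
  also have "(LINT r:{0<..}|lborel. R_line s 0 r)
      = (LINT r:{0<..}|lborel. (- exp (pi * \<i> * s) * C) * ray_kernel s r)"
    by (rule set_lebesgue_integral_cong) (auto simp: R_line_origin_rays(2) C_def)
  finally show "riemann_R s
      = (1 - exp (pi * \<i> * s)) * exp (\<i> * pi * (1 - s) / 4) * (LINT r:{0<..}|lborel. ray_kernel s r)"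
    unfolding set_integral_mult_right by (simp add: C_def algebra_simps)
qed

definition node :: "nat \<Rightarrow> complex" where
  "node k = of_real (real k + 1 / 2) * rot"

lemma gauss_mellin_node_sums:
  assumes s: "Re s \<le> -1"
  shows "(\<lambda>k. gauss_mellin s (node k)) sums (LINT r:{0<..}|lborel. ray_kernel s r)"
proof -
  define w where "w r = exp (- (of_real pi * rot * of_real r))" for r :: real
  define g where "g r = indicat_real {0<..} r *\<^sub>R (of_real r powr (- s)
      * exp (- (of_real pi * (of_real r)\<^sup>2)) * w r)" for r :: real
  have g_measurable: "g \<in> borel_measurable borel"
    unfolding g_def w_def
    by (intro borel_measurable_continuous_on_indicator continuous_intros)
       (auto simp: complex_nonpos_Reals_iff)
  have w_measurable: "(\<lambda>r. (w r)\<^sup>2) \<in> borel_measurable borel"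
    unfolding w_def by (intro borel_measurable_continuous_onI continuous_intros)
  have kernel: "g r / (1 - (w r)\<^sup>2) = indicat_real {0<..} r *\<^sub>R ray_kernel s r" for r
    by (cases "r > 0") (simp_all add: g_def w_def ray_kernel_def Let_def)
  have "cmod ((w r)\<^sup>2) < 1" if "g r \<noteq> 0" for r
  proof -
    have "r > 0" using that by (cases "r > 0") (auto simp: g_def)
    then show ?thesis by (simp add: w_def rot_def norm_power power_less_one_iff cos_45)
  qed
  then have "(\<lambda>k. LINT r|lborel. g r * (w r)\<^sup>2 ^ k) sums (LINT r|lborel. g r / (1 - (w r)\<^sup>2))"
    using g_measurable w_measurable riemann_R_eq_ray_integral(1)[OF s]
    by (intro integral_geometric_series_sums) (auto simp: kernel set_integrable_def)
  moreover have "(LINT r|lborel. g r * (w r)\<^sup>2 ^ k) = gauss_mellin s (node k)" for k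
  proof -
    have "w r * (w r)\<^sup>2 ^ k = exp (- (2 * of_real pi * node k * of_real r))" for r
    proof -
      have "w r * (w r)\<^sup>2 ^ k = w r ^ (2 * k + 1)" by (simp add: power_mult)
      also have "\<dots> = exp (of_nat (2 * k + 1) * - (of_real pi * rot * of_real r))"
        by (simp only: w_def exp_of_nat_mult)
      also have "of_nat (2 * k + 1) * - (of_real pi * rot * of_real r)
          = - (2 * of_real pi * node k * of_real r)"
        by (simp add: node_def algebra_simps)
      finally show ?thesis .
    qed
    then have "g r * (w r)\<^sup>2 ^ k = indicat_real {0<..} r *\<^sub>R
        (of_real r powr (- s)
        * exp (- (of_real pi * (of_real r)\<^sup>2) - 2 * of_real pi * node k * of_real r))" for r
      unfolding g_def diff_conv_add_uminus exp_add by (simp add: mult.assoc)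
    then show ?thesis by (simp add: gauss_mellin_def set_lebesgue_integral_def)
  qed
  ultimately show ?thesis by (simp add: kernel set_lebesgue_integral_def)
qed

text \<open>Completing the square produces the same constant for every \<open>k\<close> because \<open>k * (k + 1)\<close> is even.\<close>

lemma exp_pi_node_square: "exp (of_real pi * (node k)\<^sup>2) = exp (- (\<i> * pi / 4))"
proof -
  obtain n where "k * (k + 1) = 2 * n" by (metis dvdE even_mult_iff even_plus_one_iff)
  then have "real (k * (k + 1)) = real (2 * n)" by (simp only:)
  moreover have "(real k + 1 / 2)\<^sup>2 = real (k * (k + 1)) + 1 / 4"
    by (simp add: power2_eq_square field_simps)
  ultimately have "(real k + 1 / 2)\<^sup>2 = 2 * real n + 1 / 4" by linarith
  then have "(node k)\<^sup>2 = of_real (2 * real n + 1 / 4) * - \<i>"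
    by (simp only: node_def power_mult_distrib rot_square of_real_power[symmetric])
  then have "of_real pi * (node k)\<^sup>2 = - (\<i> * pi / 4) + of_int (- int n) * (2 * of_real pi * \<i>)"
    by (simp only:) (simp add: field_simps)
  moreover have "exp (of_int (- int n) * (2 * of_real pi * \<i>)) = 1"
    using exp_integer_2pi[of "of_int (- int n)"] by (simp add: mult_ac)
  ultimately show ?thesis by (simp only: exp_add) simp
qed

lemma riemann_R_bromwich_sums:
  fixes s :: complex and \<kappa> :: "nat \<Rightarrow> real"
  assumes s: "Re s \<le> -1" and \<kappa>: "\<And>k. \<kappa> k > 0"
  shows "(\<lambda>k. chi s * (- \<i>) * exp (\<i> * pi * s / 4) * bromwich s (node k) (\<kappa> k)) sums riemann_R s"
proof -
  define C where "C = (1 - exp (pi * \<i> * s)) * exp (\<i> * pi * (1 - s) / 4)"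
  have "1 - s \<notin> \<int>\<^sub>\<le>\<^sub>0" using s by (auto elim!: nonpos_Ints_cases simp: complex_eq_iff)
  moreover have "exp (\<i> * pi * (1 - s) / 4) * exp (- (\<i> * pi / 4))
      = exp (- (pi * \<i> * s / 2)) * exp (\<i> * pi * s / 4)"
    unfolding exp_add[symmetric] by (simp add: field_simps)
  ultimately have "C * (exp (- (\<i> * pi / 4)) * Gamma (1 - s) * of_real (2 * pi) powr (s - 1))
      = chi s * (- \<i>) * exp (\<i> * pi * s / 4)"
    by (simp add: C_def chi_eq_Gamma algebra_simps)
  moreover have "C * gauss_mellin s (node k) =
      C * (exp (- (\<i> * pi / 4)) * Gamma (1 - s) * of_real (2 * pi) powr (s - 1)) * bromwich s (node k)
      (\<kappa> k)" for k
    using gauss_mellin_eq_bromwich[of s "\<kappa> k" "node k"] s \<kappa>[of k]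
    by (simp only: exp_pi_node_square mult.assoc)
  ultimately have "C * gauss_mellin s (node k)
      = chi s * (- \<i>) * exp (\<i> * pi * s / 4) * bromwich s (node k) (\<kappa> k)" for k
    by (simp only:)
  then show ?thesis
    using sums_mult[OF gauss_mellin_node_sums[OF s], of C] riemann_R_eq_ray_integral(2)[OF s]
    by (simp add: C_def)
qed

section \<open>Steepest descent\<close>

lemma Re_divide_cone_ge:
  fixes c q :: complex
  assumes "\<bar>Im c\<bar> \<le> Re c" "Re q > 0"
  shows "- Re c / (4 * Re q) \<le> Re (c / q)"
proof -
  define x y where "x = Re q" and "y = \<bar>Im q\<bar>"
  have x: "x > 0" using assms by (simp add: x_def)
  then have pos: "x\<^sup>2 + y\<^sup>2 > 0" by (simp add: add_pos_nonneg)
  have "0 \<le> (y - 2 * x)\<^sup>2 + x\<^sup>2" by simp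
  also have "\<dots> = (x\<^sup>2 + y\<^sup>2) + 4 * x * (x - y)"
    by (simp add: power2_eq_square algebra_simps)
  finally have "- (1 / (4 * x)) \<le> (x - y) / (x\<^sup>2 + y\<^sup>2)"
    using x pos by (simp add: field_simps)
  then have "Re c * - (1 / (4 * x)) \<le> Re c * ((x - y) / (x\<^sup>2 + y\<^sup>2))"
    using assms by (intro mult_left_mono) auto
  also have "\<dots> = (Re c * x - Re c * y) / (x\<^sup>2 + y\<^sup>2)" by (simp add: right_diff_distrib)
  also have "\<dots> \<le> (Re c * x + Im c * Im q) / (x\<^sup>2 + y\<^sup>2)"
  proof (intro divide_right_mono)
    have "\<bar>Im c * Im q\<bar> \<le> Re c * y"
      unfolding abs_mult y_def using assms by (intro mult_right_mono) auto
    then show "Re c * x - Re c * y \<le> Re c * x + Im c * Im q" by (simp add: abs_le_iff)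
  qed (use pos in simp)
  also have "\<dots> = Re (c / q)" by (simp add: Re_divide x_def y_def)
  finally show ?thesis by (simp add: x_def)
qed

lemma Re_Ln_vertical_remainder_le:
  fixes b q :: complex and r K :: real
  assumes q: "Re q > 0" and K: "\<And>Q. Re Q = Re q \<Longrightarrow> Re (b / (q * Q)) \<le> K"
  shows "Re (b * (Ln (q + \<i> * of_real r) - Ln q - \<i> * of_real r / q)) \<le> K * r\<^sup>2 / 2"
proof -
  define f where "f z = b * (Ln (q + z * (\<i> * of_real r)) - Ln q - z * (\<i> * of_real r / q))" for z
  define \<psi> where "\<psi> u = Re (f (of_real u)) - K * r\<^sup>2 * u\<^sup>2 / 2" for u :: real
  have "\<psi> 1 \<le> \<psi> 0"
  proof (rule DERIV_nonpos_imp_nonincreasing[of 0 1 \<psi>])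
    fix u :: real assume u: "0 \<le> u" "u \<le> 1"
    define Q where "Q = q + of_real u * (\<i> * of_real r)"
    have Re_Q: "Re Q = Re q" by (simp add: Q_def)
    have Q: "Q \<notin> \<real>\<^sub>\<le>\<^sub>0" "Q \<noteq> 0" "q \<noteq> 0" using q Re_Q by (auto simp: complex_nonpos_Reals_iff)
    have "(f has_field_derivative b * (\<i> * of_real r / Q - \<i> * of_real r / q)) (at (of_real u))"
      unfolding f_def using Q by (auto intro!: derivative_eq_intros simp: Q_def divide_inverse mult_ac)
    also have "b * (\<i> * of_real r / Q - \<i> * of_real r / q) = of_real (r\<^sup>2 * u) * (b / (q * Q))"
    proof -
      have "\<i> * of_real r / Q - \<i> * of_real r / q = \<i> * of_real r * (q - Q) / (q * Q)"
        using Q by (simp add: field_simps)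
      also have "q - Q = - (of_real u * (\<i> * of_real r))" by (simp add: Q_def)
      finally show ?thesis by (simp add: power2_eq_square mult_ac)
    qed
    finally have "((\<lambda>u. Re (f (of_real u))) has_field_derivative Re (of_real (r\<^sup>2 * u) * (b / (q * Q))))
        (at u)"
      by (intro has_field_derivative_Re has_vector_derivative_real_field)
    also have "Re (of_real (r\<^sup>2 * u) * (b / (q * Q))) = r\<^sup>2 * u * Re (b / (q * Q))"
      by (simp only: times_complex.sel Re_complex_of_real Im_complex_of_real)
    finally have "(\<psi> has_field_derivative r\<^sup>2 * u * Re (b / (q * Q)) - K * r\<^sup>2 * u) (at u)"
      unfolding \<psi>_def by (rule DERIV_diff) (auto intro!: derivative_eq_intros)
    moreover have "r\<^sup>2 * u * Re (b / (q * Q)) \<le> r\<^sup>2 * u * K"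
      using u by (intro mult_left_mono K Re_Q) auto
    ultimately show "\<exists>y. (\<psi> has_real_derivative y) (at u) \<and> y \<le> 0"
      by (intro exI[of _ "r\<^sup>2 * u * Re (b / (q * Q)) - K * r\<^sup>2 * u"]) (simp add: mult_ac)
  qed simp
  then show ?thesis by (simp add: \<psi>_def f_def)
qed

lemma norm_Ln_Taylor_2_le:
  fixes w z :: complex
  assumes d: "0 < d" "d \<le> Re w" "d \<le> Re z"
  shows "cmod (Ln z - (Ln w + (z - w) / w - (z - w)\<^sup>2 / (2 * w\<^sup>2))) \<le> (cmod (z - w) / d) ^ 3"
proof -
  define f :: "nat \<Rightarrow> complex \<Rightarrow> complex" where
    "f i x = [Ln x, 1 / x, - 1 / x\<^sup>2, 2 / x ^ 3] ! i" for i x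
  have "cmod (f 0 z - (\<Sum>i\<le>2. f i w * (z - w) ^ i / fact i)) \<le> 2 / d ^ 3 * cmod (z - w) ^ Suc 2 / fact 2"
  proof (rule complex_Taylor)
    show "convex {x. d \<le> Re x}" by (rule convex_halfspace_Re_ge)
    fix x assume "x \<in> {x. d \<le> Re x}"
    then have Re_x: "d \<le> Re x" and x: "x \<notin> \<real>\<^sub>\<le>\<^sub>0" "x \<noteq> 0" using d
      by (auto simp: complex_nonpos_Reals_iff)
    show "(f i has_field_derivative f (Suc i) x) (at x within {x. d \<le> Re x})" if "i \<le> 2" for i
    proof -
      have "i = 0 \<or> i = 1 \<or> i = 2" using that by auto
      then show ?thesis
        unfolding f_def using x
        by (elim disjE) (auto intro!: derivative_eq_intros simp: eval_nat_numeral field_simps)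
    qed
    have "d \<le> cmod x" using Re_x complex_Re_le_cmod[of x] by simp
    then have "2 / cmod x ^ 3 \<le> 2 / d ^ 3"
      using d by (intro divide_left_mono power_mono mult_pos_pos zero_less_power) auto
    then show "cmod (f (Suc 2) x) \<le> 2 / d ^ 3"
      by (simp add: f_def numeral_2_eq_2 norm_divide norm_power)
  qed (use d in auto)
  moreover have "(\<Sum>i\<le>2. f i w * (z - w) ^ i / fact i) = Ln w + (z - w) / w - (z - w)\<^sup>2 / (2 * w\<^sup>2)"
    by (simp add: f_def numeral_2_eq_2)
  moreover have "2 / d ^ 3 * cmod (z - w) ^ Suc 2 / fact 2 = (cmod (z - w) / d) ^ 3"
    by (simp add: power_divide eval_nat_numeral)
  moreover have "f 0 z = Ln z" by (simp add: f_def)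
  ultimately show ?thesis by (simp only:)
qed

lemma norm_exp_minus_one_le:
  fixes w :: complex
  shows "cmod (exp w - 1) \<le> exp (max 0 (Re w)) * cmod w"
proof -
  have "cmod (exp w - exp 0) \<le> exp (max 0 (Re w)) * cmod (w - 0)"
  proof (rule field_differentiable_bound[where S = "closed_segment 0 w"])
    show "(exp has_field_derivative exp z) (at z within closed_segment 0 w)" for z :: complex
      by (rule DERIV_subset[OF DERIV_exp]) simp
    fix z assume "z \<in> closed_segment 0 w"
    then obtain u where u: "0 \<le> u" "u \<le> 1" "z = u *\<^sub>R w" by (auto simp: in_segment)
    have "u * Re w \<le> u * max 0 (Re w)" using u by (intro mult_left_mono) auto
    also have "\<dots> \<le> 1 * max 0 (Re w)" using u by (intro mult_right_mono) auto
    finally show "cmod (exp z) \<le> exp (max 0 (Re w))" using u by simp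
  qed auto
  then show ?thesis by simp
qed

lemma cmod_rot: "cmod rot = 1"
  by (simp add: rot_def)

lemma rot_nonzero: "rot \<noteq> 0"
  using cmod_rot by auto

lemma Re_rot_mult: "Re (rot * z) = (Re z + Im z) * (sqrt 2 / 2)"
  and Im_rot_mult: "Im (rot * z) = (Im z - Re z) * (sqrt 2 / 2)"
  by (simp_all add: rot_def cos_45 sin_45 algebra_simps)

lemma abs_Im_rot_mult_le:
  assumes "0 \<le> Re z" "0 \<le> Im z"
  shows "\<bar>Im (rot * z)\<bar> \<le> Re (rot * z)"
  unfolding Re_rot_mult Im_rot_mult abs_mult using assms by (auto intro!: mult_mono)

lemma Re_rot_mult_ge:
  assumes "0 \<le> Re z" "0 \<le> Im z"
  shows "cmod z * (sqrt 2 / 2) \<le> Re (rot * z)"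
  unfolding Re_rot_mult using cmod_le[of z] assms by (intro mult_right_mono) auto

text \<open>In the variable \<open>q = rot * y\<close> the substitution \<open>s - 1 = 2 \<pi> \<i> \<eta>\<^sup>2\<close> puts the saddle of the
  \<open>m\<close>-free integrand at \<open>rot * \<eta>\<close>, and vertical lines are lines of steepest descent.\<close>

locale saddle =
  fixes \<eta> s :: complex
  assumes s_eq: "s = 1 + 2 * of_real pi * \<i> * \<eta>\<^sup>2"
    and Im_pos: "0 < Im \<eta>" and Im_le: "Im \<eta> \<le> Re \<eta>"
begin

definition phase :: "complex \<Rightarrow> complex \<Rightarrow> complex" where
  "phase m q = (s - 1) * Ln q + of_real pi * q\<^sup>2 - 2 * of_real pi * (m * rot) * q"

definition phase_deriv :: "complex \<Rightarrow> complex \<Rightarrow> complex" where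
  "phase_deriv m q = (s - 1) / q + 2 * of_real pi * q - 2 * of_real pi * (m * rot)"

definition amplitude :: complex where
  "amplitude = exp (phase 0 (rot * \<eta>))"

lemma Re_pos: "0 < Re \<eta>"
  using Im_pos Im_le by simp

lemma \<eta>_nonzero: "\<eta> \<noteq> 0"
  using Im_pos by auto

lemma Re_s: "Re s = 1 - 2 * pi * Im (\<eta>\<^sup>2)"
  by (simp add: s_eq)

lemma s_minus_1: "s - 1 = - 2 * of_real pi * (rot * \<eta>)\<^sup>2"
  unfolding power_mult_distrib rot_square s_eq by simp

lemma \<eta>_square_quadrant: "0 \<le> Re (\<eta>\<^sup>2)" "0 < Im (\<eta>\<^sup>2)"
  using Im_pos Im_le Re_pos by (auto simp: power2_eq_square intro!: mult_mono)

lemma bromwich_eq_phase_integral: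
  assumes "0 < Re q"
  shows "bromwich s (of_real m * rot) (Re q)
    = (LINT r|lborel. exp (phase (of_real m) (q + \<i> * of_real r)))"
proof -
  have line: "of_real (Re q) + \<i> * of_real (Im q + 1 * r) = q + \<i> * of_real r" for r
    by (simp add: complex_eq_iff)
  have "bromwich_integrand s (of_real m * rot) (of_real (Re q) + \<i> * of_real r)
      = exp (phase (of_real m) (of_real (Re q) + \<i> * of_real r))" for r
  proof -
    have "of_real (Re q) + \<i> * of_real r \<noteq> 0" using assms by (auto simp: complex_eq_iff)
    then show ?thesis
      unfolding bromwich_integrand_def phase_def powr_def by (simp add: exp_add[symmetric] add_diff_eq)
  qed
  then have "bromwich s (of_real m * rot) (Re q)
      = (LINT r|lborel. exp (phase (of_real m) (of_real (Re q) + \<i> * of_real r)))"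
    by (simp add: bromwich_def)
  also have "\<dots> = (LINT r|lborel. exp (phase (of_real m) (of_real (Re q) + \<i> * of_real (Im q + 1 * r))))"
    by (subst lborel_integral_real_affine[of 1 _ "Im q"]) auto
  finally show ?thesis unfolding line .
qed

lemma borel_measurable_exp_phase:
  assumes "0 < Re q"
  shows "(\<lambda>r. exp (phase m (q + \<i> * of_real r))) \<in> borel_measurable lborel"
proof -
  have "continuous_on UNIV (\<lambda>r. exp (phase m (q + \<i> * of_real r)))"
    unfolding phase_def using assms
    by (intro continuous_intros) (auto simp: complex_nonpos_Reals_iff)
  then show ?thesis using borel_measurable_continuous_onI by simp
qed

lemma has_field_derivative_phase:
  assumes "q \<notin> \<real>\<^sub>\<le>\<^sub>0"
  shows "(phase m has_field_derivative phase_deriv m q) (at q)"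
  unfolding phase_def phase_deriv_def using assms
  by (auto intro!: derivative_eq_intros simp: divide_inverse mult_ac)

lemma \<eta>_square_divide_cone:
  assumes p: "Re \<eta> \<le> Re p" "0 \<le> Im p" "Im p \<le> Im \<eta>"
  shows "\<bar>Im (rot * \<eta>\<^sup>2 / p)\<bar> \<le> Re (rot * \<eta>\<^sup>2 / p)"
proof -
  have p_pos: "0 < Re p" "p \<noteq> 0" using p Re_pos by auto
  have "Re (\<eta>\<^sup>2) * Im p \<le> (Re \<eta>)\<^sup>2 * Im \<eta>"
    using p \<eta>_square_quadrant by (intro mult_mono) (auto simp: power2_eq_square)
  also have "\<dots> = (Re \<eta> * Im \<eta>) * Re \<eta>" by (simp add: power2_eq_square)
  also have "\<dots> \<le> Im (\<eta>\<^sup>2) * Re p"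
    using p Re_pos Im_pos by (intro mult_mono) (auto simp: power2_eq_square)
  finally have "Re (\<eta>\<^sup>2) * Im p \<le> Im (\<eta>\<^sup>2) * Re p" .
  moreover have "Re (\<eta>\<^sup>2) * Re p \<ge> 0" "Im (\<eta>\<^sup>2) * Im p \<ge> 0"
    using \<eta>_square_quadrant p p_pos by auto
  ultimately have "\<bar>Im (rot * (\<eta>\<^sup>2 * cnj p))\<bar> \<le> Re (rot * (\<eta>\<^sup>2 * cnj p))"
    by (intro abs_Im_rot_mult_le) auto
  moreover have "rot * \<eta>\<^sup>2 / p = rot * (\<eta>\<^sup>2 * cnj p) / of_real ((cmod p)\<^sup>2)"
  proof -
    have "rot * \<eta>\<^sup>2 / p = rot * (\<eta>\<^sup>2 * cnj p) / (p * cnj p)" using p_pos by simp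
    then show ?thesis by (simp only: complex_norm_square[symmetric] of_real_power)
  qed
  ultimately show ?thesis
    by (simp only: Re_divide_of_real Im_divide_of_real) (simp add: divide_right_mono)
qed

lemma Re_\<eta>_square_divide_le:
  assumes p: "0 < Re p" "0 \<le> Im p" "cmod \<eta> \<le> cmod p"
  shows "Re (rot * \<eta>\<^sup>2 / p) \<le> 2 * Re (rot * p)"
proof -
  have "0 < cmod p" using p by auto
  have "Re (rot * \<eta>\<^sup>2 / p) \<le> cmod (rot * \<eta>\<^sup>2 / p)" by (rule complex_Re_le_cmod)
  also have "\<dots> = (cmod \<eta>)\<^sup>2 / cmod p" by (simp add: norm_divide norm_mult norm_power cmod_rot)
  also have "\<dots> \<le> (cmod p)\<^sup>2 / cmod p" using p by (intro divide_right_mono power_mono) auto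
  also have "\<dots> = sqrt 2 * (cmod p * (sqrt 2 / 2))" using \<open>0 < cmod p\<close> by (simp add: power2_eq_square)
  also have "\<dots> \<le> 2 * Re (rot * p)"
    using p sqrt2_less_2 by (intro mult_mono Re_rot_mult_ge) auto
  finally show ?thesis .
qed

text \<open>On a vertical line the values \<open>1 / q\<close> run over a circle tangent to the imaginary axis at 0,
  while \<open>rot * \<eta>\<^sup>2 / p\<close> lies in the cone \<open>\<bar>Im\<bar> \<le> Re\<close>. Hence the logarithm destroys at most half
  of the Gaussian decay.\<close>

lemma Re_phase_vertical_le:
  fixes p m :: complex and r :: real
  assumes p: "Re \<eta> \<le> Re p" "0 \<le> Im p" "Im p \<le> Im \<eta>" "cmod \<eta> \<le> cmod p"
  shows "Re (phase m (rot * p + \<i> * of_real r)) \<le>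
    Re (phase m (rot * p)) + Re (\<i> * of_real r * phase_deriv m (rot * p)) - pi / 2 * r\<^sup>2"
proof -
  define q where "q = rot * p"
  define c where "c = rot * \<eta>\<^sup>2 / p"
  have "0 < Re p" using p Re_pos by auto
  then have Re_q: "0 < Re q" unfolding q_def Re_rot_mult using p by (intro mult_pos_pos) auto
  then have "q \<noteq> 0" by auto
  have Re_c: "Re c \<le> 2 * Re q"
    unfolding c_def q_def using \<open>0 < Re p\<close> p by (intro Re_\<eta>_square_divide_le)
  have "Re ((s - 1) / (q * Q)) \<le> pi" if "Re Q = Re q" for Q
  proof -
    have "(s - 1) / (q * Q) = of_real (- 2 * pi) * (c / Q)"
      using rot_nonzero by (simp add: s_minus_1 c_def q_def power2_eq_square)
    then have "Re ((s - 1) / (q * Q)) = 2 * pi * (- Re (c / Q))"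
      by (simp only: Re_complex_of_real Im_complex_of_real times_complex.sel)
    also have "\<dots> \<le> 2 * pi * (1 / 2)"
    proof (intro mult_left_mono)
      have "- (Re c / (4 * Re q)) \<le> Re (c / Q)"
        using Re_divide_cone_ge[OF \<eta>_square_divide_cone[OF p(1-3)], of Q] that Re_q by (simp add: c_def)
      moreover have "Re c / (4 * Re q) \<le> 1 / 2" using Re_c Re_q by (simp add: field_simps)
      ultimately show "- Re (c / Q) \<le> 1 / 2" by linarith
    qed simp
    finally show ?thesis by simp
  qed
  then have "Re ((s - 1) * (Ln (q + \<i> * of_real r) - Ln q - \<i> * of_real r / q)) \<le> pi * r\<^sup>2 / 2"
    using Re_q by (intro Re_Ln_vertical_remainder_le)
  moreover have "phase m (q + \<i> * of_real r) = phase m q + \<i> * of_real r * phase_deriv m q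
      + ((s - 1) * (Ln (q + \<i> * of_real r) - Ln q - \<i> * of_real r / q) - of_real (pi * r\<^sup>2))"
    using \<open>q \<noteq> 0\<close> by (simp add: phase_def phase_deriv_def power2_eq_square algebra_simps)
  ultimately show ?thesis by (simp add: q_def)
qed

subsection \<open>Lines through the exact saddle\<close>

definition saddle_pt :: "complex \<Rightarrow> complex" where
  "saddle_pt m = m / 2 + csqrt (m\<^sup>2 / 4 + \<eta>\<^sup>2)"

lemma saddle_pt_square: "(saddle_pt m)\<^sup>2 = \<eta>\<^sup>2 + m * saddle_pt m"
proof -
  define S where "S = csqrt (m\<^sup>2 / 4 + \<eta>\<^sup>2)"
  have "S\<^sup>2 = m\<^sup>2 / 4 + \<eta>\<^sup>2" by (simp add: S_def)
  then show ?thesis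
    unfolding saddle_pt_def S_def[symmetric] by (simp add: power2_eq_square field_simps)
qed

lemma saddle_pt_0: "saddle_pt 0 = \<eta>"
  using Re_pos csqrt_square[of \<eta>] by (simp add: saddle_pt_def)

lemma csqrt_real_plus_\<eta>_square:
  fixes x :: real
  assumes "x \<ge> 0"
  defines "S \<equiv> csqrt (of_real x + \<eta>\<^sup>2)"
  shows "Re \<eta> \<le> Re S" "Re S \<le> sqrt (x + (cmod \<eta>)\<^sup>2)" "Re S * Im S = Re \<eta> * Im \<eta>"
    "0 < Im S" "Im S \<le> Im \<eta>" "cmod \<eta> \<le> cmod S"
proof -
  define z where "z = of_real x + \<eta>\<^sup>2"
  have S_square: "S\<^sup>2 = z" by (simp add: S_def z_def)
  have "cmod (\<eta>\<^sup>2) = (cmod \<eta>)\<^sup>2" by (simp add: norm_power)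
  then have \<eta>_sq: "cmod (\<eta>\<^sup>2) + Re (\<eta>\<^sup>2) = 2 * (Re \<eta>)\<^sup>2" "cmod (\<eta>\<^sup>2) = (cmod \<eta>)\<^sup>2"
    by (simp_all add: cmod_power2) (simp_all add: power2_eq_square)
  have z_ge: "cmod (\<eta>\<^sup>2) \<le> cmod z"
  proof (rule power2_le_imp_le)
    have "(Re (\<eta>\<^sup>2))\<^sup>2 \<le> (x + Re (\<eta>\<^sup>2))\<^sup>2" using assms \<eta>_square_quadrant by (intro power_mono) auto
    then show "(cmod (\<eta>\<^sup>2))\<^sup>2 \<le> (cmod z)\<^sup>2" by (simp add: cmod_power2 z_def)
  qed simp
  have Re_z: "Re z = x + Re (\<eta>\<^sup>2)" by (simp add: z_def)
  have Re_S: "Re S = sqrt ((cmod z + Re z) / 2)" by (simp add: S_def z_def)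
  show "Re \<eta> \<le> Re S"
    unfolding Re_S using z_ge Re_z \<eta>_sq assms by (intro real_le_rsqrt) simp
  have "cmod z \<le> x + (cmod \<eta>)\<^sup>2" "Re z \<le> x + (cmod \<eta>)\<^sup>2"
    using norm_triangle_ineq[of "of_real x" "\<eta>\<^sup>2"] complex_Re_le_cmod[of "\<eta>\<^sup>2"] assms
    by (auto simp: z_def norm_power)
  then show "Re S \<le> sqrt (x + (cmod \<eta>)\<^sup>2)" unfolding Re_S by simp
  show Re_Im: "Re S * Im S = Re \<eta> * Im \<eta>"
    using arg_cong[OF S_square, of Im] by (simp add: z_def power2_eq_square mult.commute)
  moreover have "0 < Re S" using \<open>Re \<eta> \<le> Re S\<close> Re_pos by linarith
  moreover have "0 < Re \<eta> * Im \<eta>" using Re_pos Im_pos by simp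
  ultimately show "0 < Im S" by (metis zero_less_mult_pos)
  have "Re \<eta> * Im S \<le> Re \<eta> * Im \<eta>"
    using Re_Im mult_right_mono[OF \<open>Re \<eta> \<le> Re S\<close>, of "Im S"] \<open>0 < Im S\<close> by simp
  then show "Im S \<le> Im \<eta>" using Re_pos by simp
  have "cmod S = sqrt (cmod z)" by (simp add: S_def z_def)
  then show "cmod \<eta> \<le> cmod S" using z_ge \<eta>_sq by (simp add: real_le_rsqrt)
qed

lemma saddle_pt_bounds:
  fixes m :: real
  assumes "m \<ge> 0"
  shows "Re \<eta> \<le> Re (saddle_pt m)" "0 < Im (saddle_pt m)" "Im (saddle_pt m) \<le> Im \<eta>"
    "cmod \<eta> \<le> cmod (saddle_pt m)" "Im (\<eta>\<^sup>2) / (2 * cmod \<eta> + m) \<le> Im (saddle_pt m)"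
proof -
  define S where "S = csqrt (of_real (m\<^sup>2 / 4) + \<eta>\<^sup>2)"
  have S: "saddle_pt m = of_real (m / 2) + S" by (simp add: saddle_pt_def S_def)
  note root = csqrt_real_plus_\<eta>_square[of "m\<^sup>2 / 4", folded S_def, simplified]
  show "Re \<eta> \<le> Re (saddle_pt m)" "0 < Im (saddle_pt m)" "Im (saddle_pt m) \<le> Im \<eta>"
    using root assms by (auto simp: S)
  have "(Re S)\<^sup>2 \<le> (m / 2 + Re S)\<^sup>2" using root(1) Re_pos assms by (intro power_mono) auto
  then have "(cmod S)\<^sup>2 \<le> (cmod (saddle_pt m))\<^sup>2" by (simp add: S cmod_power2)
  then have "cmod S \<le> cmod (saddle_pt m)" by (rule power2_le_imp_le) simp
  then show "cmod \<eta> \<le> cmod (saddle_pt m)" using root(6) by linarith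
  have "sqrt (m\<^sup>2 / 4 + (cmod \<eta>)\<^sup>2) \<le> m / 2 + cmod \<eta>"
    using assms by (intro real_le_lsqrt) (auto simp: power2_sum power_divide)
  then have "Re S \<le> m / 2 + cmod \<eta>" using root(2) by linarith
  then have "Re \<eta> * Im \<eta> / (m / 2 + cmod \<eta>) \<le> Re \<eta> * Im \<eta> / Re S"
    using root(1) Re_pos Im_pos assms by (intro divide_left_mono mult_pos_pos) auto
  also have "\<dots> = Im (saddle_pt m)" using root(1,3) Re_pos by (simp add: S field_simps)
  also have "Re \<eta> * Im \<eta> / (m / 2 + cmod \<eta>) = Im (\<eta>\<^sup>2) / (2 * cmod \<eta> + m)"
    using assms \<eta>_nonzero by (simp add: power2_eq_square divide_simps add_nonneg_eq_0_iff)
  finally show "Im (\<eta>\<^sup>2) / (2 * cmod \<eta> + m) \<le> Im (saddle_pt m)" .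
qed

lemma phase_deriv_saddle_pt:
  assumes "saddle_pt m \<noteq> 0"
  shows "phase_deriv m (rot * saddle_pt m) = 0"
proof -
  have "s - 1 = - 2 * of_real pi * (rot\<^sup>2 * (saddle_pt m * (saddle_pt m - m)))"
    using saddle_pt_square[of m]
    by (simp add: s_minus_1 power_mult_distrib power2_eq_square algebra_simps)
  then have "(s - 1) / (rot * saddle_pt m) = - 2 * of_real pi * (rot * (saddle_pt m - m))"
    using assms rot_nonzero by (simp add: power2_eq_square)
  then show ?thesis by (simp add: phase_deriv_def algebra_simps)
qed

lemma saddle_pt_field_differentiable:
  fixes m :: real
  shows "saddle_pt field_differentiable (at (of_real m))"
proof -
  have "Im ((of_real m)\<^sup>2 / 4 + \<eta>\<^sup>2) > 0"
    using \<eta>_square_quadrant by (simp flip: of_real_power)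
  then have "(of_real m)\<^sup>2 / 4 + \<eta>\<^sup>2 \<notin> \<real>\<^sub>\<le>\<^sub>0" by (auto simp: complex_nonpos_Reals_iff)
  moreover have "((\<lambda>z. z\<^sup>2 / 4 + \<eta>\<^sup>2) has_field_derivative of_real m / 2) (at (of_real m))"
    by (auto intro!: derivative_eq_intros)
  ultimately have "((\<lambda>z. csqrt (z\<^sup>2 / 4 + \<eta>\<^sup>2)) has_field_derivative
      of_real m / 2 / (2 * csqrt ((of_real m)\<^sup>2 / 4 + \<eta>\<^sup>2))) (at (of_real m))"
    by (intro has_field_derivative_csqrt')
  from DERIV_add[OF DERIV_cdivide[OF DERIV_ident, of 2] this] show ?thesis
    unfolding saddle_pt_def[abs_def] field_differentiable_def by blast
qed

lemma has_field_derivative_phase_saddle_pt: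
  fixes m :: real
  assumes m: "m \<ge> 0"
  shows "((\<lambda>z. phase z (rot * saddle_pt z)) has_field_derivative 2 * of_real pi * \<i> * saddle_pt m)
    (at (of_real m))"
proof -
  let ?y = "saddle_pt m"
  have y: "Re ?y > 0" "Im ?y > 0" "?y \<noteq> 0" using saddle_pt_bounds[OF m] Re_pos by auto
  obtain y' where y': "(saddle_pt has_field_derivative y') (at (of_real m))"
    using saddle_pt_field_differentiable by (auto simp: field_differentiable_def)
  have "Re (rot * ?y) > 0" unfolding Re_rot_mult using y by simp
  then have "rot * ?y \<notin> \<real>\<^sub>\<le>\<^sub>0" by (auto simp: complex_nonpos_Reals_iff)
  then have chain: "((\<lambda>z. phase 0 (rot * saddle_pt z))
      has_field_derivative phase_deriv 0 (rot * ?y) * (rot * y')) (at (of_real m))"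
    by (intro DERIV_chain2[OF has_field_derivative_phase] DERIV_cmult y')
  have product: "((\<lambda>z. 2 * of_real pi * \<i> * (z * saddle_pt z)) has_field_derivative
      2 * of_real pi * \<i> * (1 * ?y + y' * of_real m)) (at (of_real m))"
    by (intro DERIV_cmult DERIV_mult DERIV_ident y')
  have "phase_deriv 0 (rot * ?y) * (rot * y') = - (2 * of_real pi * \<i> * (y' * of_real m))"
  proof -
    have "phase_deriv 0 (rot * ?y) = 2 * of_real pi * (of_real m * rot)"
      using phase_deriv_saddle_pt[OF y(3)] by (simp add: phase_deriv_def)
    then have "phase_deriv 0 (rot * ?y) * (rot * y') = 2 * of_real pi * of_real m * y' * rot\<^sup>2"
      by (simp add: power2_eq_square)
    then show ?thesis by (simp add: rot_square)
  qed
  then have "((\<lambda>z. phase 0 (rot * saddle_pt z) + 2 * of_real pi * \<i> * (z * saddle_pt z))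
      has_field_derivative
      2 * of_real pi * \<i> * ?y) (at (of_real m))"
    by (intro DERIV_cong[OF DERIV_add[OF chain product]]) (simp add: algebra_simps)
  moreover have "phase z (rot * saddle_pt z)
      = phase 0 (rot * saddle_pt z) + 2 * of_real pi * \<i> * (z * saddle_pt z)" for z
  proof -
    have "phase z (rot * saddle_pt z)
        = phase 0 (rot * saddle_pt z) - 2 * of_real pi * z * saddle_pt z * rot\<^sup>2"
      by (simp add: phase_def power2_eq_square)
    then show ?thesis by (simp add: rot_square)
  qed
  ultimately show ?thesis by simp
qed

lemma Re_phase_saddle_pt_le:
  fixes m :: real
  assumes m: "m \<ge> 0"
  shows "Re (phase m (rot * saddle_pt m))
    \<le> Re (phase 0 (rot * \<eta>)) - (1 - Re s) * ln (1 + m / (2 * cmod \<eta>))"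
proof -
  define f where "f x = Re (phase (of_real x) (rot * saddle_pt (of_real x)))
      + (1 - Re s) * ln (1 + x / (2 * cmod \<eta>))" for x
  have "f m \<le> f 0"
  proof (rule DERIV_nonpos_imp_nonincreasing[OF m])
    fix x assume x: "0 \<le> x" "x \<le> m"
    have phase_deriv: "((\<lambda>x. Re (phase (of_real x) (rot * saddle_pt (of_real x)))) has_field_derivative
        Re (2 * of_real pi * \<i> * saddle_pt (of_real x))) (at x)"
      by (intro has_field_derivative_Re has_vector_derivative_real_field
            has_field_derivative_phase_saddle_pt x)
    have log_deriv: "((\<lambda>x. (1 - Re s) * ln (1 + x / (2 * cmod \<eta>))) has_field_derivative
        (1 - Re s) * (1 / (2 * cmod \<eta> + x))) (at x)"
    proof (rule DERIV_cmult)
      have "1 + x / (2 * cmod \<eta>) > 0" "2 * cmod \<eta> + x > 0" using x \<eta>_nonzero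
        by (auto simp: add_pos_nonneg)
      then show "((\<lambda>x. ln (1 + x / (2 * cmod \<eta>))) has_field_derivative (1 / (2 * cmod \<eta> + x))) (at x)"
        using \<eta>_nonzero by (auto intro!: derivative_eq_intros simp: field_simps)
    qed
    have "(f has_field_derivative - (2 * pi * Im (saddle_pt (of_real x))) +
        (1 - Re s) * (1 / (2 * cmod \<eta> + x))) (at x)"
      unfolding f_def using DERIV_add[OF phase_deriv log_deriv] by simp
    moreover have "(1 - Re s) * (1 / (2 * cmod \<eta> + x)) \<le> 2 * pi * Im (saddle_pt (of_real x))"
      using mult_left_mono[OF saddle_pt_bounds(5)[OF x(1)], of "2 * pi"] by (simp add: Re_s)
    ultimately show "\<exists>y. (f has_real_derivative y) (at x) \<and> y \<le> 0"
      by (intro exI[of _ "- (2 * pi * Im (saddle_pt (of_real x))) + (1 - Re s) * (1 / (2 * cmod \<eta> + x))"]) simp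
  qed
  then show ?thesis by (simp add: f_def saddle_pt_0)
qed

lemma cmod_bromwich_saddle_pt_le:
  fixes m :: real
  assumes m: "m \<ge> 0"
  shows "cmod (bromwich s (of_real m * rot) (Re (rot * saddle_pt m))) \<le>
    cmod amplitude * (sqrt 2 * (1 + m / (2 * cmod \<eta>)) powr (Re s - 1))"
proof -
  let ?q = "rot * saddle_pt m"
  define M where "M = exp (Re (phase m ?q))"
  note bounds = saddle_pt_bounds[OF m]
  have "0 < Re ?q" unfolding Re_rot_mult using bounds Re_pos by simp
  have "saddle_pt m \<noteq> 0" using bounds(2) by auto
  have gauss: "has_bochner_integral lborel (\<lambda>r. M * exp (- (pi / 2 * r\<^sup>2))) (M * sqrt (pi / (pi / 2)))"
    by (intro has_bochner_integral_mult_right has_bochner_integral_exp_neg_square) simp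
  have "cmod ((LINT r|lborel. exp (phase m (?q + \<i> * of_real r))) - (LINT r::real|lborel. 0))
      \<le> (LINT r|lborel. M * exp (- (pi / 2 * r\<^sup>2)))"
  proof (rule norm_integral_diff_le[OF borel_measurable_exp_phase[OF \<open>0 < Re ?q\<close>]])
    fix r :: real
    have "Re (phase m (?q + \<i> * of_real r)) \<le> Re (phase m ?q) - pi / 2 * r\<^sup>2"
      using Re_phase_vertical_le[of "saddle_pt m" m r] bounds phase_deriv_saddle_pt[OF \<open>saddle_pt m \<noteq> 0\<close>]
      by simp
    then show "cmod (exp (phase m (?q + \<i> * of_real r)) - 0) \<le> M * exp (- (pi / 2 * r\<^sup>2))"
      by (simp add: M_def flip: exp_add)
  qed (use gauss in \<open>auto simp: has_bochner_integral_iff\<close>)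
  then have "cmod (bromwich s (of_real m * rot) (Re ?q)) \<le> M * sqrt 2"
    unfolding bromwich_eq_phase_integral[OF \<open>0 < Re ?q\<close>] has_bochner_integral_integral_eq[OF gauss]
    by simp
  also have "M \<le> cmod amplitude * (1 + m / (2 * cmod \<eta>)) powr (Re s - 1)"
  proof -
    have "1 + m / (2 * cmod \<eta>) > 0" using m by (simp add: add_pos_nonneg)
    then have "exp (Re (phase 0 (rot * \<eta>)) - (1 - Re s) * ln (1 + m / (2 * cmod \<eta>)))
        = cmod amplitude * (1 + m / (2 * cmod \<eta>)) powr (Re s - 1)"
      by (simp add: amplitude_def powr_def algebra_simps flip: exp_add)
    then show ?thesis unfolding M_def using Re_phase_saddle_pt_le[OF m] by (metis exp_le_cancel_iff)
  qed
  finally show ?thesis by (simp add: mult_ac)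
qed

end

definition cubic_const :: real where
  "cubic_const = 27 * exp 54 * sqrt pi"

definition error_bound :: "real \<Rightarrow> real \<Rightarrow> real \<Rightarrow> real \<Rightarrow> real" where
  "error_bound L Y \<tau> m = cubic_const * m ^ 3 / L * exp (- (2 * pi * m * Y)) +
     (if m ^ 3 \<le> L then 0 else sqrt 2 * (1 + m / (2 * L)) powr (- \<tau>))"

lemma cubic_const_ge_1: "1 \<le> cubic_const"
proof -
  have "(1::real) * 1 * 1 \<le> 27 * exp 54 * sqrt pi"
    using pi_gt3 by (intro mult_mono) (auto intro: real_le_rsqrt)
  then show ?thesis by (simp add: cubic_const_def)
qed

context saddle
begin

subsection \<open>Lines through the approximate saddle\<close>

text \<open>The line through \<open>\<eta> + m / 2\<close> misses the exact saddle, but expanding the phase around \<open>\<eta>\<close>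
  there leaves a pure Gaussian, and the cubic remainder is the only error.\<close>

definition gaussian_amplitude :: "real \<Rightarrow> complex" where
  "gaussian_amplitude m
    = amplitude * exp (2 * of_real pi * \<i> * of_real m * \<eta> + \<i> * of_real (pi * m\<^sup>2 / 2))"

definition gaussian_term :: "real \<Rightarrow> complex" where
  "gaussian_term m = gaussian_amplitude m / of_real (sqrt 2)"

definition cubic_remainder :: "real \<Rightarrow> real \<Rightarrow> complex" where
  "cubic_remainder m r = (let \<epsilon> = rot * \<eta>; \<delta> = of_real (m / 2) * rot + \<i> * of_real r
     in (s - 1) * (Ln (\<epsilon> + \<delta>) - (Ln \<epsilon> + \<delta> / \<epsilon> - \<delta>\<^sup>2 / (2 * \<epsilon>\<^sup>2))))"

lemma phase_shifted_line:
  fixes m r :: real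
  shows "phase m (rot * (\<eta> + of_real (m / 2)) + \<i> * of_real r) =
    phase 0 (rot * \<eta>) + (2 * of_real pi * \<i> * of_real m * \<eta> + \<i> * of_real (pi * m\<^sup>2 / 2))
      - of_real (2 * pi * r\<^sup>2) + cubic_remainder m r"
proof -
  define \<epsilon> where "\<epsilon> = rot * \<eta>"
  define \<mu> where "\<mu> = of_real m * rot"
  define \<delta> where "\<delta> = \<mu> / 2 + \<i> * of_real r"
  have "\<epsilon> \<noteq> 0" using rot_nonzero \<eta>_nonzero by (simp add: \<epsilon>_def)
  have line: "rot * (\<eta> + of_real (m / 2)) + \<i> * of_real r = \<epsilon> + \<delta>"
    by (simp add: \<epsilon>_def \<delta>_def \<mu>_def algebra_simps)
  have s: "s - 1 = - 2 * of_real pi * \<epsilon>\<^sup>2" by (simp add: s_minus_1 \<epsilon>_def)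
  have "(s - 1) * (\<delta> / \<epsilon>) = - 2 * of_real pi * \<epsilon> * \<delta>" "(s - 1) * (\<delta>\<^sup>2 / (2 * \<epsilon>\<^sup>2)) = - of_real pi * \<delta>\<^sup>2"
    unfolding s using \<open>\<epsilon> \<noteq> 0\<close> by (simp_all add: power2_eq_square)
  then have remainder: "cubic_remainder m r
      = (s - 1) * Ln (\<epsilon> + \<delta>) - (s - 1) * Ln \<epsilon> + 2 * of_real pi * \<epsilon> * \<delta> - of_real pi * \<delta>\<^sup>2"
    by (simp add: cubic_remainder_def \<epsilon>_def[symmetric] \<delta>_def \<mu>_def Let_def right_diff_distrib distrib_left)
  have "\<mu> * \<epsilon> = rot\<^sup>2 * (of_real m * \<eta>)" "\<mu>\<^sup>2 = rot\<^sup>2 * of_real (m\<^sup>2)"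
    by (simp_all add: \<mu>_def \<epsilon>_def power2_eq_square)
  then have cross: "\<mu> * \<epsilon> = - (\<i> * of_real m * \<eta>)" "\<mu>\<^sup>2 = - (\<i> * of_real (m\<^sup>2))"
    unfolding rot_square by simp_all
  have "phase m (\<epsilon> + \<delta>) = phase 0 \<epsilon> - 2 * of_real pi * (\<mu> * \<epsilon>) - of_real pi * \<mu>\<^sup>2 / 2
      + 2 * of_real pi * (\<delta> - \<mu> / 2)\<^sup>2 + cubic_remainder m r"
    unfolding remainder phase_def \<mu>_def[symmetric] by (simp add: power2_eq_square field_simps)
  also have "(\<delta> - \<mu> / 2)\<^sup>2 = - of_real (r\<^sup>2)" by (simp add: \<delta>_def power_mult_distrib)
  finally show ?thesis unfolding line cross by (simp add: \<epsilon>_def mult_ac)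
qed

lemma cmod_cubic_remainder_le:
  assumes m: "m \<ge> 0"
  shows "cmod (cubic_remainder m r) \<le> 27 * (m / 2 + \<bar>r\<bar>) ^ 3 / cmod \<eta>"
proof -
  define \<epsilon> where "\<epsilon> = rot * \<eta>"
  define \<delta> where "\<delta> = of_real (m / 2) * rot + \<i> * of_real r"
  define L where "L = cmod \<eta>"
  have L: "L > 0" using \<eta>_nonzero by (simp add: L_def)
  have "4 / 3 \<le> sqrt 2" by (rule real_le_rsqrt) (simp add: power2_eq_square)
  then have "2 / 3 * L \<le> L * (sqrt 2 / 2)" using L by simp
  also have "\<dots> \<le> Re \<epsilon>"
    unfolding \<epsilon>_def L_def using Im_pos Re_pos by (intro Re_rot_mult_ge) auto
  finally have "2 / 3 * L \<le> Re \<epsilon>" .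
  moreover have "Re \<epsilon> \<le> Re (\<epsilon> + \<delta>)" using m by (simp add: \<delta>_def rot_def cos_45)
  ultimately have taylor: "cmod (Ln (\<epsilon> + \<delta>) - (Ln \<epsilon> + \<delta> / \<epsilon> - \<delta>\<^sup>2 / (2 * \<epsilon>\<^sup>2)))
      \<le> (cmod \<delta> / (2 / 3 * L)) ^ 3"
    using norm_Ln_Taylor_2_le[of "2 / 3 * L" \<epsilon> "\<epsilon> + \<delta>"] L by simp
  have "cmod \<delta> \<le> cmod (of_real (m / 2) * rot) + cmod (\<i> * of_real r)" unfolding \<delta>_def
    by (rule norm_triangle_ineq)
  then have \<delta>_le: "cmod \<delta> \<le> m / 2 + \<bar>r\<bar>" using m by (simp add: norm_mult cmod_rot)
  have "cmod (cubic_remainder m r)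
      = 2 * pi * L\<^sup>2 * cmod (Ln (\<epsilon> + \<delta>) - (Ln \<epsilon> + \<delta> / \<epsilon> - \<delta>\<^sup>2 / (2 * \<epsilon>\<^sup>2)))"
    unfolding cubic_remainder_def Let_def \<epsilon>_def[symmetric] \<delta>_def[symmetric] norm_mult
    by (simp add: s_minus_1 norm_mult norm_power cmod_rot L_def)
  also have "\<dots> \<le> 2 * pi * L\<^sup>2 * (cmod \<delta> / (2 / 3 * L)) ^ 3"
    by (intro mult_left_mono taylor) simp
  also have "\<dots> = 27 * (pi / 4) * cmod \<delta> ^ 3 / L"
    using L by (simp add: field_simps eval_nat_numeral)
  also have "\<dots> \<le> 27 * 1 * (m / 2 + \<bar>r\<bar>) ^ 3 / L"
    using \<delta>_le pi_less_4 L m by (intro divide_right_mono mult_mono power_mono) auto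
  finally show ?thesis by (simp add: L_def)
qed

lemma cmod_phase_deriv_shifted_le:
  assumes m: "1 / 2 \<le> m" and cube: "m ^ 3 \<le> cmod \<eta>" and p: "p = \<eta> + of_real (m / 2)" "cmod \<eta> \<le> cmod p"
  shows "cmod (phase_deriv m (rot * p)) \<le> 4"
proof -
  define q where "q = rot * p"
  have L: "cmod \<eta> > 0" using \<eta>_nonzero by simp
  then have "q \<noteq> 0" using p(2) rot_nonzero by (auto simp: q_def)
  have "rot * \<eta> = q - of_real m * rot / 2" by (simp add: q_def p(1) algebra_simps)
  then have "s - 1 = - 2 * of_real pi * (q * (q - of_real m * rot) + (of_real m * rot)\<^sup>2 / 4)"
    by (simp only: s_minus_1) (simp add: power2_eq_square field_simps)
  then have "(s - 1) / q
      = - 2 * of_real pi * (q - of_real m * rot) - of_real pi * (of_real m * rot)\<^sup>2 / (2 * q)"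
    using \<open>q \<noteq> 0\<close> by (simp only:) (simp add: field_simps)
  then have "phase_deriv m q = - (of_real pi * (of_real m * rot)\<^sup>2 / (2 * q))"
    by (simp only: phase_deriv_def) (simp add: algebra_simps)
  then have "cmod (phase_deriv m q) = pi * m\<^sup>2 / (2 * cmod p)"
    by (simp add: q_def norm_divide norm_mult norm_power cmod_rot)
  also have "\<dots> \<le> 4 * (2 * cmod \<eta>) / (2 * cmod \<eta>)"
  proof (rule frac_le)
    have "(1 / 2) * m\<^sup>2 \<le> m * m\<^sup>2" using m by (intro mult_right_mono) auto
    then have "m\<^sup>2 \<le> 2 * cmod \<eta>" using cube by (simp add: power3_eq_cube power2_eq_square)
    then show "pi * m\<^sup>2 \<le> 4 * (2 * cmod \<eta>)" using pi_less_4 by (intro mult_mono) auto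
  qed (use p(2) L in auto)
  finally show ?thesis using L by (simp add: q_def)
qed

lemma cmod_\<eta>_le_shifted:
  assumes "m \<ge> 0"
  shows "cmod \<eta> \<le> cmod (\<eta> + of_real (m / 2))"
proof (rule power2_le_imp_le)
  have "(Re \<eta>)\<^sup>2 \<le> (Re \<eta> + m / 2)\<^sup>2" using Re_pos assms by (intro power_mono) auto
  then show "(cmod \<eta>)\<^sup>2 \<le> (cmod (\<eta> + of_real (m / 2)))\<^sup>2" by (simp add: cmod_power2)
qed simp

lemma Re_gaussian_plus_remainder_le:
  assumes m: "1 / 2 \<le> m" and cube: "m ^ 3 \<le> cmod \<eta>"
  shows "- (2 * pi * r\<^sup>2) + Re (cubic_remainder m r) \<le> 4 + 4 * \<bar>r\<bar> - 3 / 2 * r\<^sup>2"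
proof -
  define p where "p = \<eta> + of_real (m / 2)"
  have p: "cmod \<eta> \<le> cmod p" using cmod_\<eta>_le_shifted m by (simp add: p_def)
  have remainder_0: "Re (cubic_remainder m 0) \<le> 4"
  proof -
    have "Re (cubic_remainder m 0) \<le> cmod (cubic_remainder m 0)" by (rule complex_Re_le_cmod)
    also have "\<dots> \<le> 27 * (m / 2) ^ 3 / cmod \<eta>" using cmod_cubic_remainder_le[of m 0] m by simp
    also have "\<dots> = 27 / 8 * (m ^ 3 / cmod \<eta>)" by (simp add: power_divide)
    also have "\<dots> \<le> 27 / 8 * 1" using cube \<eta>_nonzero by (intro mult_left_mono) auto
    finally show ?thesis by simp
  qed
  have "Re (\<i> * of_real r * phase_deriv m (rot * p)) \<le> \<bar>r\<bar> * cmod (phase_deriv m (rot * p))"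
    by (rule order_trans[OF complex_Re_le_cmod]) (simp add: norm_mult)
  also have "\<dots> \<le> \<bar>r\<bar> * 4"
    using cmod_phase_deriv_shifted_le[OF m cube p_def p] by (intro mult_left_mono) auto
  finally have linear: "Re (\<i> * of_real r * phase_deriv m (rot * p)) \<le> 4 * \<bar>r\<bar>" by simp
  have "3 / 2 * r\<^sup>2 \<le> pi / 2 * r\<^sup>2" using pi_gt3 by (intro mult_right_mono) auto
  moreover have "Re (phase m (rot * p + \<i> * of_real r)) \<le>
      Re (phase m (rot * p)) + Re (\<i> * of_real r * phase_deriv m (rot * p)) - pi / 2 * r\<^sup>2"
    using m p Im_pos by (intro Re_phase_vertical_le) (auto simp: p_def)
  ultimately show ?thesis
    using phase_shifted_line[of m r] phase_shifted_line[of m 0] remainder_0 linear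
    by (simp add: p_def)
qed

lemma cmod_cubic_remainder_le_exp:
  assumes m: "1 / 2 \<le> m"
  shows "cmod (cubic_remainder m r) \<le> 27 * m ^ 3 / cmod \<eta> * exp (6 * \<bar>r\<bar>)"
proof -
  have "m / 2 + \<bar>r\<bar> \<le> m * (1 / 2 + 2 * \<bar>r\<bar>)"
    using mult_right_mono[OF m, of "2 * \<bar>r\<bar>"] by (simp add: algebra_simps)
  also have "\<dots> \<le> m * exp (2 * \<bar>r\<bar>)"
    using m exp_ge_add_one_self[of "2 * \<bar>r\<bar>"] by (intro mult_left_mono) linarith+
  finally have "(m / 2 + \<bar>r\<bar>) ^ 3 \<le> (m * exp (2 * \<bar>r\<bar>)) ^ 3" using m by (intro power_mono) auto
  also have "\<dots> = m ^ 3 * exp (6 * \<bar>r\<bar>)" by (simp add: power_mult_distrib flip: exp_of_nat_mult)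
  finally have "27 * (m / 2 + \<bar>r\<bar>) ^ 3 / cmod \<eta> \<le> 27 * (m ^ 3 * exp (6 * \<bar>r\<bar>)) / cmod \<eta>"
    by (intro divide_right_mono) auto
  then show ?thesis using cmod_cubic_remainder_le[of m r] m by simp
qed

lemma exp_phase_shifted_line:
  "exp (phase m (rot * (\<eta> + of_real (m / 2)) + \<i> * of_real r)) =
    gaussian_amplitude m * of_real (exp (- (2 * pi * r\<^sup>2))) * exp (cubic_remainder m r)"
  unfolding phase_shifted_line gaussian_amplitude_def amplitude_def
    diff_conv_add_uminus of_real_minus[symmetric] exp_add exp_of_real by simp

lemma cmod_exp_phase_minus_gaussian_le:
  assumes m: "1 / 2 \<le> m" and cube: "m ^ 3 \<le> cmod \<eta>"
  defines "G \<equiv> gaussian_amplitude m"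
  shows "cmod (exp (phase m (rot * (\<eta> + of_real (m / 2)) + \<i> * of_real r)) -
      G * of_real (exp (- (2 * pi * r\<^sup>2))))
    \<le> cmod G * (27 * exp 54 * m ^ 3 / cmod \<eta>) * exp (- (1 * r\<^sup>2))"
proof -
  define w where "w = cubic_remainder m r"
  have exponent_le: "- (2 * pi * r\<^sup>2) + max 0 (Re w) \<le> 4 + 4 * \<bar>r\<bar> - 3 / 2 * r\<^sup>2"
  proof -
    have "3 / 2 * r\<^sup>2 \<le> 2 * pi * r\<^sup>2" using pi_gt3 by (intro mult_right_mono) auto
    then have "- (2 * pi * r\<^sup>2) \<le> 4 + 4 * \<bar>r\<bar> - 3 / 2 * r\<^sup>2" by linarith
    then show ?thesis using Re_gaussian_plus_remainder_le[OF m cube, of r] by (simp add: w_def max_def)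
  qed
  have "exp (phase m (rot * (\<eta> + of_real (m / 2)) + \<i> * of_real r))
      - G * of_real (exp (- (2 * pi * r\<^sup>2)))
      = G * of_real (exp (- (2 * pi * r\<^sup>2))) * (exp w - 1)"
    unfolding exp_phase_shifted_line G_def w_def by (simp add: right_diff_distrib)
  then have "cmod (exp (phase m (rot * (\<eta> + of_real (m / 2)) + \<i> * of_real r)) -
      G * of_real (exp (- (2 * pi * r\<^sup>2))))
      = cmod G * exp (- (2 * pi * r\<^sup>2)) * cmod (exp w - 1)"
    by (simp add: norm_mult)
  also have "\<dots> \<le> cmod G * exp (- (2 * pi * r\<^sup>2)) * (exp (max 0 (Re w)) * cmod w)"
    by (intro mult_left_mono norm_exp_minus_one_le) auto
  also have "\<dots> = cmod G * (exp (- (2 * pi * r\<^sup>2) + max 0 (Re w)) * cmod w)"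
    unfolding exp_add by simp
  also have "\<dots> \<le> cmod G * (exp (4 + 4 * \<bar>r\<bar> - 3 / 2 * r\<^sup>2) * (27 * m ^ 3 / cmod \<eta> * exp (6 * \<bar>r\<bar>)))"
    using exponent_le cmod_cubic_remainder_le_exp[OF m]
    by (intro mult_left_mono mult_mono) (auto simp: w_def)
  also have "\<dots> = cmod G * (27 * m ^ 3 / cmod \<eta>) * exp ((4 + 4 * \<bar>r\<bar> - 3 / 2 * r\<^sup>2) + 6 * \<bar>r\<bar>)"
    by (simp only: exp_add mult_ac)
  also have "\<dots> \<le> cmod G * (27 * m ^ 3 / cmod \<eta>) * exp (54 - r\<^sup>2)"
  proof (intro mult_left_mono)
    have "0 \<le> (\<bar>r\<bar> - 10)\<^sup>2" by simp
    then show "exp ((4 + 4 * \<bar>r\<bar> - 3 / 2 * r\<^sup>2) + 6 * \<bar>r\<bar>) \<le> exp (54 - r\<^sup>2)" by (simp add: power2_diff)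
  qed (use m in auto)
  also have "exp (54 - r\<^sup>2) = exp 54 * exp (- (1 * r\<^sup>2))" by (simp flip: exp_add)
  finally show ?thesis by (simp add: mult_ac)
qed

lemma cmod_gaussian_amplitude: "cmod (gaussian_amplitude m)
    = cmod amplitude * exp (- (2 * pi * m * Im \<eta>))"
  by (simp add: gaussian_amplitude_def norm_mult)

lemma cmod_bromwich_minus_gaussian_term_le:
  assumes m: "1 / 2 \<le> m" and cube: "m ^ 3 \<le> cmod \<eta>"
  shows "cmod (bromwich s (of_real m * rot) (Re (rot * (\<eta> + of_real (m / 2)))) - gaussian_term m)
    \<le> cmod amplitude * (cubic_const * m ^ 3 / cmod \<eta> * exp (- (2 * pi * m * Im \<eta>)))"
proof -
  define q where "q = rot * (\<eta> + of_real (m / 2))"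
  define G where "G = gaussian_amplitude m"
  have q: "0 < Re q" unfolding q_def Re_rot_mult using Re_pos Im_pos m by simp
  have gauss: "has_bochner_integral lborel (\<lambda>r. G * of_real (exp (- (2 * pi * r\<^sup>2))))
      (G * of_real (sqrt (pi / (2 * pi))))"
    by (intro has_bochner_integral_mult_right has_bochner_integral_of_real
          has_bochner_integral_exp_neg_square) simp
  have error: "has_bochner_integral lborel (\<lambda>r. cmod G * (27 * exp 54 * m ^ 3 / cmod \<eta>)
      * exp (- (1 * r\<^sup>2)))
      (cmod G * (27 * exp 54 * m ^ 3 / cmod \<eta>) * sqrt (pi / 1))"
    by (intro has_bochner_integral_mult_right has_bochner_integral_exp_neg_square) simp
  have "cmod ((LINT r|lborel. exp (phase m (q + \<i> * of_real r)))
      - (LINT r|lborel. G * of_real (exp (- (2 * pi * r\<^sup>2)))))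
      \<le> (LINT r|lborel. cmod G * (27 * exp 54 * m ^ 3 / cmod \<eta>) * exp (- (1 * r\<^sup>2)))"
    using gauss error cmod_exp_phase_minus_gaussian_le[OF m cube]
    by (intro norm_integral_diff_le borel_measurable_exp_phase q)
       (auto simp: q_def G_def has_bochner_integral_iff)
  also have "\<dots> = cmod amplitude * (cubic_const * m ^ 3 / cmod \<eta> * exp (- (2 * pi * m * Im \<eta>)))"
    unfolding has_bochner_integral_integral_eq[OF error]
    by (simp add: G_def cubic_const_def cmod_gaussian_amplitude)
  also have "(LINT r|lborel. G * of_real (exp (- (2 * pi * r\<^sup>2)))) = gaussian_term m"
    unfolding has_bochner_integral_integral_eq[OF gauss]
    by (simp add: G_def gaussian_term_def real_sqrt_divide)
  finally show ?thesis
    unfolding q_def[symmetric] bromwich_eq_phase_integral[OF q] .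
qed

lemma cmod_gaussian_term_le:
  assumes "cmod \<eta> \<le> m ^ 3"
  shows "cmod (gaussian_term m)
    \<le> cmod amplitude * (cubic_const * m ^ 3 / cmod \<eta> * exp (- (2 * pi * m * Im \<eta>)))"
proof -
  have "1 \<le> m ^ 3 / cmod \<eta>" using assms \<eta>_nonzero by simp
  then have "1 * 1 \<le> cubic_const * (m ^ 3 / cmod \<eta>)"
    using cubic_const_ge_1 by (intro mult_mono) auto
  moreover have "1 / sqrt 2 \<le> 1" by simp
  ultimately have "1 / sqrt 2 \<le> cubic_const * (m ^ 3 / cmod \<eta>)" by linarith
  then have "cmod amplitude * exp (- (2 * pi * m * Im \<eta>)) * (1 / sqrt 2)
      \<le> cmod amplitude * exp (- (2 * pi * m * Im \<eta>)) * (cubic_const * (m ^ 3 / cmod \<eta>))"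
    by (intro mult_left_mono) auto
  then show ?thesis
    by (simp add: gaussian_term_def norm_divide cmod_gaussian_amplitude mult_ac)
qed

lemma bromwich_error_bound:
  assumes m: "1 / 2 \<le> m"
  shows "\<exists>\<kappa>>0. cmod (bromwich s (of_real m * rot) \<kappa> - gaussian_term m) \<le>
    cmod amplitude * error_bound (cmod \<eta>) (Im \<eta>) (1 - Re s) m"
proof (cases "m ^ 3 \<le> cmod \<eta>")
  case True
  let ?\<kappa> = "Re (rot * (\<eta> + of_real (m / 2)))"
  have "0 < ?\<kappa>" unfolding Re_rot_mult using Re_pos Im_pos m by simp
  moreover have "cmod (bromwich s (of_real m * rot) ?\<kappa> - gaussian_term m) \<le>
      cmod amplitude * error_bound (cmod \<eta>) (Im \<eta>) (1 - Re s) m"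
    unfolding error_bound_def using True cmod_bromwich_minus_gaussian_term_le[OF m True]
    by (simp only: if_True add_0_right)
  ultimately show ?thesis by blast
next
  case False
  have m0: "m \<ge> 0" using m by simp
  let ?\<kappa> = "Re (rot * saddle_pt m)"
  have "0 < ?\<kappa>" unfolding Re_rot_mult using saddle_pt_bounds[OF m0] Re_pos by simp
  moreover have "cmod (bromwich s (of_real m * rot) ?\<kappa> - gaussian_term m) \<le>
      cmod amplitude * error_bound (cmod \<eta>) (Im \<eta>) (1 - Re s) m"
  proof -
    have "cmod (bromwich s (of_real m * rot) ?\<kappa> - gaussian_term m) \<le>
        cmod (gaussian_term m) + cmod (bromwich s (of_real m * rot) ?\<kappa>)"
      by (metis add.commute norm_triangle_ineq4)
    also have "cmod (gaussian_term m)
        \<le> cmod amplitude * (cubic_const * m ^ 3 / cmod \<eta> * exp (- (2 * pi * m * Im \<eta>)))"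
      using False by (intro cmod_gaussian_term_le) simp
    also have "cmod (bromwich s (of_real m * rot) ?\<kappa>)
        \<le> cmod amplitude * (sqrt 2 * (1 + m / (2 * cmod \<eta>)) powr (Re s - 1))"
      by (rule cmod_bromwich_saddle_pt_le[OF m0])
    finally show ?thesis using False by (simp add: error_bound_def distrib_left)
  qed
  ultimately show ?thesis by blast
qed

end

section \<open>Summation of the error terms\<close>

lemma of_nat_mult_power_le_inverse:
  fixes y :: real
  assumes "0 \<le> y" "y < 1"
  shows "(real k + 1) * y ^ k \<le> 1 / (1 - y)"
proof -
  have "(real k + 1) * y ^ k = (\<Sum>j\<le>k. y ^ k)" by (simp add: add.commute)
  also have "\<dots> \<le> (\<Sum>j\<le>k. y ^ j)"
    using assms by (intro sum_mono power_decreasing) auto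
  also have "\<dots> = (1 - y ^ Suc k) / (1 - y)" using assms by (simp add: sum_gp0)
  also have "\<dots> \<le> 1 / (1 - y)" using assms by (intro divide_right_mono) auto
  finally show ?thesis .
qed

lemma half_le_ln_one_plus:
  fixes x :: real
  assumes "0 \<le> x" "x \<le> 1"
  shows "x / 2 \<le> ln (1 + x)"
proof -
  have "exp (x / 2) \<le> 1 + x / 2 + (x / 2)\<^sup>2" using assms by (intro exp_bound) auto
  also have "\<dots> \<le> 1 + x" using assms mult_left_le[of x x] by (simp add: power2_eq_square)
  finally show ?thesis using assms ln_ge_iff[of "1 + x" "x / 2"] by simp
qed

lemma gaussian_error_term_le:
  fixes L Y :: real and k :: nat
  assumes L: "L > 0" and Y: "Y > 0"
  defines "m \<equiv> real k + 1 / 2" and "y \<equiv> exp (- (pi * Y / 3))"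
  shows "cubic_const * m ^ 3 / L * exp (- (2 * pi * m * Y)) \<le>
    cubic_const * exp (- (pi * Y)) / (L * (1 - y) ^ 3) * (y ^ 3) ^ k"
proof -
  have y: "0 < y" "y < 1" using Y by (auto simp: y_def)
  have decay: "exp (- (2 * pi * m * Y)) = exp (- (pi * Y)) * ((y ^ k) ^ 3 * (y ^ 3) ^ k)"
  proof -
    have "(y ^ k) ^ 3 * (y ^ 3) ^ k = y ^ (6 * k)"
      by (simp add: power_mult[symmetric] power_add[symmetric])
    also have "\<dots> = exp (real (6 * k) * - (pi * Y / 3))" by (simp only: y_def exp_of_nat_mult)
    finally show ?thesis by (simp add: m_def algebra_simps flip: exp_add)
  qed
  have "m ^ 3 * (y ^ k) ^ 3 \<le> ((real k + 1) * y ^ k) ^ 3"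
    unfolding power_mult_distrib using y by (intro mult_right_mono power_mono) (auto simp: m_def)
  also have "\<dots> \<le> (1 / (1 - y)) ^ 3"
    using y by (intro power_mono of_nat_mult_power_le_inverse) auto
  finally have "m ^ 3 * (y ^ k) ^ 3 \<le> 1 / (1 - y) ^ 3" by (simp add: power_divide)
  then have "cubic_const * exp (- (pi * Y)) / L * (y ^ 3) ^ k * (m ^ 3 * (y ^ k) ^ 3) \<le>
      cubic_const * exp (- (pi * Y)) / L * (y ^ 3) ^ k * (1 / (1 - y) ^ 3)"
    using cubic_const_ge_1 L y by (intro mult_left_mono) auto
  then show ?thesis unfolding decay by (simp add: mult_ac)
qed

lemma saddle_base_powr_le:
  fixes L :: real and k :: nat
  assumes L: "L \<ge> 1"
  shows "(1 + (real k + 1 / 2) / (2 * L)) powr (- 2) \<le> 16 * L\<^sup>2 * (1 / (real k + 1)\<^sup>2)"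
proof -
  define m where "m = real k + 1 / 2"
  define B where "B = 1 + m / (2 * L)"
  have "B > 0" using L by (simp add: B_def m_def add_pos_nonneg)
  have "(real k + 1) / (4 * L) \<le> (2 * m) / (4 * L)" using L
    by (intro divide_right_mono) (auto simp: m_def)
  also have "\<dots> \<le> B" using L by (simp add: B_def)
  finally have "((real k + 1) / (4 * L))\<^sup>2 \<le> B\<^sup>2" using L by (intro power_mono) auto
  then have "1 / B\<^sup>2 \<le> 1 / ((real k + 1) / (4 * L))\<^sup>2"
    using L \<open>B > 0\<close> by (intro divide_left_mono) auto
  then show ?thesis
    unfolding m_def[symmetric] B_def[symmetric] using \<open>B > 0\<close>
    by (simp add: powr_minus inverse_eq_divide power_divide power_mult_distrib)
qed

lemma saddle_error_term_le:
  fixes L Y \<tau> :: real and k :: nat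
  assumes L: "L \<ge> 1" and Y: "Y > 0" and \<tau>: "\<tau> \<ge> 6 * L * Y" "\<tau> \<ge> 4"
  defines "m \<equiv> real k + 1 / 2" and "T \<equiv> L powr (1 / 3)"
  assumes far: "L < m ^ 3"
  shows "sqrt 2 * (1 + m / (2 * L)) powr (- \<tau>)
    \<le> 16 * sqrt 2 * L\<^sup>2 * exp (- (3 / 4 * Y * T)) * (1 / (real k + 1)\<^sup>2)"
proof -
  define B where "B = 1 + m / (2 * L)"
  define x where "x = T / (2 * L)"
  have T_cube: "T ^ 3 = L" using L by (simp add: T_def powr_power)
  have "m > T"
    using far unfolding T_cube[symmetric] by (rule power_less_imp_less_base) (simp add: m_def)
  have "1 \<le> T" "T \<le> L" using L powr_mono[of "1 / 3" 1 L] by (auto simp: T_def ge_one_powr_ge_zero)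
  then have x: "0 < x" "x \<le> 1" using L by (auto simp: x_def)
  have B: "1 + x \<le> B" "1 < B"
    using \<open>m > T\<close> L \<open>1 \<le> T\<close> by (auto simp: B_def x_def divide_right_mono)
  have "3 / 4 * Y * T \<le> (\<tau> / 2) * (x / 2)"
  proof -
    have "6 * L * Y * (T / (8 * L)) \<le> \<tau> * (T / (8 * L))"
      using \<tau> \<open>1 \<le> T\<close> L by (intro mult_right_mono) auto
    then show ?thesis using L by (simp add: x_def mult_ac)
  qed
  also have "\<dots> \<le> (\<tau> - 2) * ln B"
  proof (intro mult_mono)
    have "ln (1 + x) \<le> ln B" using B x by simp
    then show "x / 2 \<le> ln B" using half_le_ln_one_plus[of x] x by linarith
  qed (use \<tau> x in auto)
  finally have "B powr (- (\<tau> - 2)) \<le> exp (- (3 / 4 * Y * T))"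
    using B by (simp add: powr_def algebra_simps)
  moreover have "B powr (- 2) \<le> 16 * L\<^sup>2 * (1 / (real k + 1)\<^sup>2)"
    unfolding B_def m_def by (rule saddle_base_powr_le[OF L])
  ultimately have "B powr (- (\<tau> - 2)) * B powr (- 2)
      \<le> exp (- (3 / 4 * Y * T)) * (16 * L\<^sup>2 * (1 / (real k + 1)\<^sup>2))"
    by (intro mult_mono) auto
  moreover have "B powr (- \<tau>) = B powr (- (\<tau> - 2)) * B powr (- 2)" by (simp flip: powr_add)
  ultimately have "sqrt 2 * B powr (- \<tau>)
      \<le> sqrt 2 * (exp (- (3 / 4 * Y * T)) * (16 * L\<^sup>2 * (1 / (real k + 1)\<^sup>2)))"
    by (intro mult_left_mono) auto
  then show ?thesis by (simp add: B_def mult_ac)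
qed

lemma error_bound_le:
  fixes L Y \<tau> :: real
  assumes L: "L \<ge> 1" and Y: "Y > 0" and \<tau>: "\<tau> \<ge> 6 * L * Y" "\<tau> \<ge> 4"
  defines "y \<equiv> exp (- (pi * Y / 3))"
  shows "error_bound L Y \<tau> (real k + 1 / 2) \<le>
    cubic_const * exp (- (pi * Y)) / (L * (1 - y) ^ 3) * (y ^ 3) ^ k
    + 16 * sqrt 2 * L\<^sup>2 * exp (- (3 / 4 * Y * L powr (1 / 3))) * (1 / (real k + 1)\<^sup>2)"
proof -
  define b where "b = 16 * sqrt 2 * L\<^sup>2 * exp (- (3 / 4 * Y * L powr (1 / 3))) * (1 / (real k + 1)\<^sup>2)"
  have "sqrt 2 * (1 + (real k + 1 / 2) / (2 * L)) powr (- \<tau>) \<le> b" if "L < (real k + 1 / 2) ^ 3"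
    unfolding b_def using that L Y \<tau> by (intro saddle_error_term_le) auto
  moreover have "0 \<le> b" by (simp add: b_def)
  moreover have "cubic_const * (real k + 1 / 2) ^ 3 / L * exp (- (2 * pi * (real k + 1 / 2) * Y))
      \<le> cubic_const * exp (- (pi * Y)) / (L * (1 - y) ^ 3) * (y ^ 3) ^ k"
    unfolding y_def using L Y by (intro gaussian_error_term_le) auto
  ultimately show ?thesis unfolding error_bound_def b_def[symmetric] by (auto simp: not_le)
qed

lemma geometric_plus_inverse_squares_sums:
  fixes a c y :: real
  assumes "0 \<le> a" "0 \<le> c" and y: "0 \<le> y" "y < 1"
  shows "\<exists>S. (\<lambda>k. a * (y ^ 3) ^ k + c * (1 / (real k + 1)\<^sup>2)) sums S \<and> S \<le> a * (1 / (1 - y)) + c * 2"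
proof -
  have y3: "y ^ 3 < 1" "y ^ 3 \<le> y"
    using y power_decreasing[of 1 3 y] by (auto simp: power_less_one_iff)
  then have "(\<lambda>k. (y ^ 3) ^ k) sums (1 / (1 - y ^ 3))"
    using y by (intro geometric_sums) auto
  moreover have "(\<lambda>k. 1 / (real k + 1)\<^sup>2) sums (pi\<^sup>2 / 6)"
    using inverse_squares_sums by (simp add: add.commute)
  ultimately have "(\<lambda>k. a * (y ^ 3) ^ k + c * (1 / (real k + 1)\<^sup>2))
      sums (a * (1 / (1 - y ^ 3)) + c * (pi\<^sup>2 / 6))"
    by (intro sums_add sums_mult)
  moreover have "a * (1 / (1 - y ^ 3)) + c * (pi\<^sup>2 / 6) \<le> a * (1 / (1 - y)) + c * 2"
  proof (intro add_mono mult_left_mono assms)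
    show "1 / (1 - y ^ 3) \<le> 1 / (1 - y)" using y3 y by (intro divide_left_mono) auto
    have "pi\<^sup>2 \<le> (32 / 10)\<^sup>2" using pi_approx by (intro power_mono) auto
    then show "pi\<^sup>2 / 6 \<le> 2" by (simp add: power2_eq_square)
  qed
  ultimately show ?thesis by blast
qed

lemma error_bound_series_le:
  fixes L Y \<tau> :: real
  assumes L: "L \<ge> 1" and Y: "Y > 0" and \<tau>: "\<tau> \<ge> 6 * L * Y" "\<tau> \<ge> 4"
  defines "y \<equiv> exp (- (pi * Y / 3))"
  shows "summable (\<lambda>k. error_bound L Y \<tau> (real k + 1 / 2))"
    and "(\<Sum>k. error_bound L Y \<tau> (real k + 1 / 2)) \<le>
      cubic_const * exp (- (pi * Y)) / (L * (1 - y) ^ 4)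
      + 48 * L\<^sup>2 * exp (- (3 / 4 * Y * L powr (1 / 3)))"
proof -
  define a where "a = cubic_const * exp (- (pi * Y)) / (L * (1 - y) ^ 3)"
  define c where "c = 16 * sqrt 2 * L\<^sup>2 * exp (- (3 / 4 * Y * L powr (1 / 3)))"
  have y: "0 < y" "y < 1" using Y by (auto simp: y_def)
  have "a \<ge> 0" "c \<ge> 0" using cubic_const_ge_1 L y by (auto simp: a_def c_def)
  then obtain S where S: "(\<lambda>k. a * (y ^ 3) ^ k + c * (1 / (real k + 1)\<^sup>2)) sums S"
    and S_le: "S \<le> a * (1 / (1 - y)) + c * 2"
    using geometric_plus_inverse_squares_sums[of a c y] y by auto
  have term_le: "error_bound L Y \<tau> (real k + 1 / 2) \<le> a * (y ^ 3) ^ k + c * (1 / (real k + 1)\<^sup>2)" for k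
    unfolding a_def c_def y_def by (rule error_bound_le[OF L Y \<tau>])
  have term_nonneg: "0 \<le> error_bound L Y \<tau> (real k + 1 / 2)" for k
    using L cubic_const_ge_1 by (simp add: error_bound_def)
  show summable: "summable (\<lambda>k. error_bound L Y \<tau> (real k + 1 / 2))"
    by (rule summable_comparison_test'[OF sums_summable[OF S], of 0]) (use term_le term_nonneg in simp)
  have "(\<Sum>k. error_bound L Y \<tau> (real k + 1 / 2)) \<le> S"
    using suminf_le[OF term_le summable sums_summable[OF S]] sums_unique[OF S] by simp
  also note S_le
  also have "a * (1 / (1 - y)) = cubic_const * exp (- (pi * Y)) / (L * (1 - y) ^ 4)"
    by (simp add: a_def eval_nat_numeral mult_ac)
  also have "c * 2 \<le> 48 * L\<^sup>2 * exp (- (3 / 4 * Y * L powr (1 / 3)))"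
  proof -
    have "sqrt 2 \<le> 3 / 2" by (rule real_le_lsqrt) (auto simp: power2_eq_square)
    from mult_right_mono[OF this, of "32 * L\<^sup>2 * exp (- (3 / 4 * Y * L powr (1 / 3)))"] show ?thesis
      by (simp add: c_def mult_ac)
  qed
  finally show "(\<Sum>k. error_bound L Y \<tau> (real k + 1 / 2)) \<le>
      cubic_const * exp (- (pi * Y)) / (L * (1 - y) ^ 4)
      + 48 * L\<^sup>2 * exp (- (3 / 4 * Y * L powr (1 / 3)))" by simp
qed

definition main_size :: "real \<Rightarrow> real" where
  "main_size Y = exp (- (pi * Y)) * (1 - exp (- (2 * pi * Y)))"

definition errors_dominated :: "real \<Rightarrow> real \<Rightarrow> real \<Rightarrow> bool" where
  "errors_dominated L Y \<tau> \<longleftrightarrow> summable (\<lambda>k. error_bound L Y \<tau> (real k + 1 / 2)) \<and>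
     (\<Sum>k. error_bound L Y \<tau> (real k + 1 / 2)) \<le> main_size Y / 3"

lemma gaussian_error_sum_le:
  fixes L Y :: real
  defines "D \<equiv> 1 - exp (- (2 * pi * Y))"
  assumes L: "L > 0" and Y: "Y > 0" and D_large: "7776 * cubic_const \<le> L * D ^ 5"
  shows "cubic_const * exp (- (pi * Y)) / (L * (1 - exp (- (pi * Y / 3))) ^ 4) \<le> main_size Y / 6"
proof -
  define y where "y = exp (- (pi * Y / 3))"
  have D: "D > 0" and y: "0 < y" "y < 1" using Y by (simp_all add: D_def y_def)
  have "1 + 6 * (y - 1) \<le> y ^ 6" using Bernoulli_inequality[of "y - 1" 6] y by simp
  also have "\<dots> = exp (- (2 * pi * Y))" by (simp add: y_def flip: exp_of_nat_mult)
  finally have "D / 6 \<le> 1 - y" by (simp add: D_def)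
  then have "(D / 6) ^ 4 \<le> (1 - y) ^ 4" using D by (intro power_mono) auto
  have "cubic_const \<le> D / 6 * (L * (D / 6) ^ 4)"
    using D_large by (simp add: power_divide eval_nat_numeral mult_ac)
  also have "\<dots> \<le> D / 6 * (L * (1 - y) ^ 4)"
    using \<open>(D / 6) ^ 4 \<le> _\<close> L D by (intro mult_left_mono) auto
  finally have "cubic_const / (L * (1 - y) ^ 4) \<le> D / 6"
    using L y by (subst pos_divide_le_eq) auto
  then have "exp (- (pi * Y)) * (cubic_const / (L * (1 - y) ^ 4)) \<le> exp (- (pi * Y)) * (D / 6)"
    by (intro mult_left_mono) auto
  then show ?thesis by (simp add: main_size_def D_def y_def mult_ac)
qed

lemma saddle_error_sum_le:
  fixes L Y :: real
  assumes L: "L \<ge> 512" and Y: "L powr (- 1 / 5) \<le> Y"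
    and tail: "288 * L\<^sup>2 * exp (- (L powr (2 / 15) / 4)) \<le> 1 - exp (- (2 * pi * Y))"
  shows "48 * L\<^sup>2 * exp (- (3 / 4 * Y * L powr (1 / 3))) \<le> main_size Y / 6"
proof -
  define T where "T = L powr (1 / 3)"
  have "0 < L powr (- 1 / 5)" using L by simp
  then have "Y > 0" using Y by linarith
  have "8 = (512::real) powr (1 / 3)" using powr_powr[of 8 3 "1 / 3"] by simp
  also have "\<dots> \<le> T" unfolding T_def using L by (intro powr_mono2) auto
  finally have "pi * Y \<le> T / 2 * Y" using pi_less_4 \<open>Y > 0\<close> by (intro mult_right_mono) auto
  moreover have "L powr (2 / 15) \<le> Y * T"
  proof -
    have "L powr (2 / 15) = L powr (- 1 / 5) * L powr (1 / 3)" by (simp flip: powr_add)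
    also have "\<dots> \<le> Y * T" unfolding T_def using Y by (intro mult_right_mono) auto
    finally show ?thesis .
  qed
  ultimately have "exp (- (3 / 4 * Y * T)) \<le> exp (- (pi * Y)) * exp (- (L powr (2 / 15) / 4))"
    by (simp add: algebra_simps flip: exp_add)
  then have "48 * L\<^sup>2 * exp (- (3 / 4 * Y * T))
      \<le> 48 * L\<^sup>2 * (exp (- (pi * Y)) * exp (- (L powr (2 / 15) / 4)))"
    by (intro mult_left_mono) auto
  also have "\<dots> = exp (- (pi * Y)) * (288 * L\<^sup>2 * exp (- (L powr (2 / 15) / 4))) / 6" by simp
  also have "\<dots> \<le> main_size Y / 6"
    unfolding main_size_def using tail by (intro divide_right_mono mult_left_mono) auto
  finally show ?thesis by (simp add: T_def)
qed

lemma errors_dominatedI: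
  fixes L Y \<tau> :: real
  assumes L: "L \<ge> 512" and Y: "L powr (- 1 / 5) \<le> Y" and \<tau>: "\<tau> \<ge> 6 * L * Y"
    and "7776 * cubic_const \<le> L * (1 - exp (- (2 * pi * Y))) ^ 5"
    and "288 * L\<^sup>2 * exp (- (L powr (2 / 15) / 4)) \<le> 1 - exp (- (2 * pi * Y))"
  shows "errors_dominated L Y \<tau>"
proof -
  have "0 < L powr (- 1 / 5)" using L by simp
  then have "Y > 0" using Y by linarith
  have "1 powr (4 / 5) \<le> L powr (4 / 5)" using L by (intro powr_mono2) auto
  also have "L powr (4 / 5) = L * L powr (- 1 / 5)" using L powr_add[of L 1 "- 1 / 5"] by simp
  also have "\<dots> \<le> L * Y" using Y L by (intro mult_left_mono) auto
  finally have "\<tau> \<ge> 4" using \<tau> by simp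
  then have series: "summable (\<lambda>k. error_bound L Y \<tau> (real k + 1 / 2))"
    "(\<Sum>k. error_bound L Y \<tau> (real k + 1 / 2))
      \<le> cubic_const * exp (- (pi * Y)) / (L * (1 - exp (- (pi * Y / 3))) ^ 4)
      + 48 * L\<^sup>2 * exp (- (3 / 4 * Y * L powr (1 / 3)))"
    using error_bound_series_le[of L Y \<tau>] L \<open>Y > 0\<close> \<tau> by auto
  note series(2)
  also have "\<dots> \<le> main_size Y / 6 + main_size Y / 6"
    using assms \<open>Y > 0\<close> by (intro add_mono gaussian_error_sum_le saddle_error_sum_le) auto
  finally show ?thesis using series(1) by (simp add: errors_dominated_def)
qed

lemma min_half_le_one_minus_exp:
  fixes Y :: real
  assumes "Y > 0"
  shows "min Y (1 / 2) \<le> 1 - exp (- (2 * pi * Y))"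
proof -
  define x where "x = min Y (1 / 2)"
  have x: "0 < x" "x \<le> 1 / 2" "x \<le> Y" using assms by (auto simp: x_def)
  have "(1 - x) * (1 + 2 * x) = 1 + x * (1 - 2 * x)" by (simp add: algebra_simps)
  then have "1 \<le> (1 - x) * (1 + 2 * x)" using x by simp
  also have "\<dots> \<le> (1 - x) * exp (2 * x)" using x by (intro mult_left_mono) auto
  finally have "exp (- (2 * x)) \<le> 1 - x" by (simp add: exp_minus field_simps)
  moreover have "exp (- (2 * pi * Y)) \<le> exp (- (2 * x))"
    using x pi_gt3 mult_mono[of 1 pi x Y] by simp
  ultimately have "x \<le> 1 - exp (- (2 * pi * Y))" by linarith
  then show ?thesis by (simp only: x_def)
qed

text \<open>The Gaussian errors sum to \<open>O(1 / (L * D\<^sup>4))\<close> with \<open>D = 1 - exp (- 2 \<pi> Y)\<close>, so the main term, of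
  size \<open>D\<close>, dominates them as soon as \<open>L * D\<^sup>5\<close> is large.\<close>

lemma eventually_errors_dominated:
  "\<exists>K\<ge>1. \<forall>\<^sub>F L in at_top. \<forall>Y \<ge> K * L powr (- 1 / 5). \<forall>\<tau> \<ge> 6 * L * Y. errors_dominated L Y \<tau>"
proof -
  define K where "K = 7776 * cubic_const"
  have K: "K \<ge> 1" using cubic_const_ge_1 by (simp add: K_def)
  have "\<forall>\<^sub>F L :: real in at_top. K * L powr (- 1 / 5) \<le> 1 / 2" by real_asymp
  moreover have "\<forall>\<^sub>F L :: real in at_top. 288 * L\<^sup>2 * exp (- (L powr (2 / 15) / 4)) \<le> L powr (- 1 / 5)"
    by real_asymp
  ultimately have "\<forall>\<^sub>F L in at_top. \<forall>Y \<ge> K * L powr (- 1 / 5). \<forall>\<tau> \<ge> 6 * L * Y. errors_dominated L Y \<tau>"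
    using eventually_ge_at_top[of 512]
  proof eventually_elim
    case (elim L)
    have root: "L powr (- 1 / 5) > 0" "(L powr (- 1 / 5)) ^ 5 = 1 / L"
      using elim(3) by (auto simp: powr_power powr_minus inverse_eq_divide power_divide)
    then have K_root: "L powr (- 1 / 5) \<le> K * L powr (- 1 / 5)" using K by simp
    show ?case
    proof (intro allI impI)
      fix Y \<tau> :: real
      assume Y: "K * L powr (- 1 / 5) \<le> Y" and \<tau>: "6 * L * Y \<le> \<tau>"
      define D where "D = 1 - exp (- (2 * pi * Y))"
      have Y_ge: "L powr (- 1 / 5) \<le> Y" using Y K_root by linarith
      then have "Y > 0" using root by linarith
      then have D: "K * L powr (- 1 / 5) \<le> D"
        using min_half_le_one_minus_exp[of Y] Y elim(1) by (simp add: D_def min_def split: if_splits)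
      have "7776 * cubic_const \<le> K ^ 5" using K power_increasing[of 1 5 K] by (simp add: K_def)
      also have "\<dots> = L * (K * L powr (- 1 / 5)) ^ 5" using root elim(3)
        by (simp add: power_mult_distrib)
      also have "\<dots> \<le> L * D ^ 5" using D K elim(3) by (intro mult_left_mono power_mono) auto
      finally have "7776 * cubic_const \<le> L * D ^ 5" .
      moreover have "288 * L\<^sup>2 * exp (- (L powr (2 / 15) / 4)) \<le> D"
        using elim(2) D K_root by linarith
      ultimately show "errors_dominated L Y \<tau>"
        unfolding D_def by (intro errors_dominatedI elim(3) Y_ge \<tau>)
    qed
  qed
  with K show ?thesis by blast
qed

section \<open>Comparison with the main term\<close>

lemma triangular_signs_sums:
  fixes z :: complex
  assumes z: "cmod z < 1"
  shows "(\<lambda>k. (-1) ^ (k * (k + 1) div 2) * z ^ k) sums ((1 - z) / (1 + z\<^sup>2))"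
proof -
  define f where "f k = (-1) ^ (k * (k + 1) div 2) * z ^ k" for k :: nat
  have "summable f"
    by (rule summable_comparison_test'[of "\<lambda>k. cmod z ^ k" 0])
       (use z in \<open>auto simp: f_def norm_mult norm_power intro: summable_geometric\<close>)
  then obtain S where S: "f sums S" by (auto simp: summable_def)
  have "(\<lambda>n. sum f {n * 2..<n * 2 + 2}) sums S"
    by (rule sums_group[OF S]) simp
  moreover have "sum f {n * 2..<n * 2 + 2} = (1 - z) * (- (z\<^sup>2)) ^ n" for n
  proof -
    have "(2 * n) * (2 * n + 1) div 2 = n + 2 * n\<^sup>2"
      "(2 * n + 1) * (2 * n + 1 + 1) div 2 = n + 1 + 2 * (n\<^sup>2 + n)"
      by (simp_all add: power2_eq_square algebra_simps)
    then have "f (2 * n) = (-1) ^ n * (z\<^sup>2) ^ n" "f (2 * n + 1) = - ((-1) ^ n * ((z\<^sup>2) ^ n * z))"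
      by (simp_all only: f_def power_add power_mult) simp_all
    moreover have "{n * 2..<n * 2 + 2} = {2 * n, 2 * n + 1}" by auto
    ultimately have "sum f {n * 2..<n * 2 + 2} = (1 - z) * ((-1) ^ n * (z\<^sup>2) ^ n)"
      by (simp add: algebra_simps)
    then show ?thesis by (simp flip: power_mult_distrib)
  qed
  moreover have "cmod (- (z\<^sup>2)) < 1" using z by (simp add: norm_power power_less_one_iff)
  then have "(\<lambda>n. (1 - z) * (- (z\<^sup>2)) ^ n) sums ((1 - z) * (1 / (1 - - (z\<^sup>2))))"
    by (intro sums_mult geometric_sums)
  ultimately have "S = (1 - z) / (1 + z\<^sup>2)" using sums_unique2 by fastforce
  with S show ?thesis by (simp add: f_def[abs_def])
qed

lemma exp_quadratic_phase:
  "exp (\<i> * of_real (pi * (real k + 1 / 2)\<^sup>2 / 2))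
    = exp (\<i> * of_real (pi / 8)) * (-1) ^ (k * (k + 1) div 2)"
proof -
  define n where "n = k * (k + 1) div 2"
  have "k * (k + 1) = 2 * n" by (simp add: n_def)
  then have "real (k * (k + 1)) = real (2 * n)" by (simp only:)
  moreover have "(real k + 1 / 2)\<^sup>2 = real (k * (k + 1)) + 1 / 4"
    by (simp add: power2_eq_square field_simps)
  ultimately have "pi * (real k + 1 / 2)\<^sup>2 / 2 = pi / 8 + real n * pi" by (simp add: field_simps)
  then have "exp (\<i> * of_real (pi * (real k + 1 / 2)\<^sup>2 / 2))
      = exp (\<i> * of_real (pi / 8)) * cis (real n * pi)"
    by (simp only: of_real_add distrib_left exp_add cis_conv_exp)
  also have "cis (real n * pi) = (-1) ^ n" using Complex.DeMoivre[of pi n] by simp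
  finally show ?thesis by (simp only: n_def)
qed

lemma sin_div_cos_double_eq_exp:
  fixes z :: complex
  defines "w \<equiv> exp (\<i> * z)"
  shows "w * ((1 - w\<^sup>2) / (1 + (w\<^sup>2)\<^sup>2)) = - \<i> * sin z / cos (2 * z)"
proof -
  have "w \<noteq> 0" and exp: "exp (\<i> * z) = w" "exp (- (\<i> * z)) = 1 / w"
    by (simp_all add: w_def exp_minus inverse_eq_divide)
  have sin: "sin z = \<i> * (1 - w\<^sup>2) / (2 * w)"
    unfolding sin_exp_eq exp using \<open>w \<noteq> 0\<close> by (simp add: field_simps power2_eq_square)
  have "exp (\<i> * (2 * z)) = w\<^sup>2"
    by (simp add: w_def mult_ac flip: exp_double)
  then have exp_double: "exp (\<i> * (2 * z)) = w\<^sup>2" "exp (- (\<i> * (2 * z))) = 1 / w\<^sup>2"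
    unfolding exp_minus by (simp_all only: inverse_eq_divide)
  have cos: "cos (2 * z) = (1 + (w\<^sup>2)\<^sup>2) / (2 * w\<^sup>2)"
    unfolding cos_exp_eq exp_double using \<open>w \<noteq> 0\<close> by (simp add: field_simps power2_eq_square)
  have "w * (n / d) = - \<i> * (\<i> * n / (2 * w)) / (d / (2 * w\<^sup>2))" for n d
    using \<open>w \<noteq> 0\<close> by (simp add: power2_eq_square)
  then show ?thesis unfolding sin cos .
qed

lemma quadratic_phase_series:
  assumes "Im \<eta> > 0"
  shows "(\<lambda>k. exp (2 * of_real pi * \<i> * of_real (real k + 1 / 2) * \<eta> +
      \<i> * of_real (pi * (real k + 1 / 2)\<^sup>2 / 2)))
    sums (- \<i> * exp (\<i> * of_real (pi / 8)) * sin (of_real pi * \<eta>) / cos (2 * of_real pi * \<eta>))"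
proof -
  define w where "w = exp (\<i> * (of_real pi * \<eta>))"
  have w: "w \<noteq> 0" "cmod w < 1" using assms by (simp_all add: w_def)
  then have "cmod (w\<^sup>2) < 1" by (simp add: norm_power power_less_one_iff)
  then have "(\<lambda>k. exp (\<i> * of_real (pi / 8)) * w * ((-1) ^ (k * (k + 1) div 2) * (w\<^sup>2) ^ k)) sums
      (exp (\<i> * of_real (pi / 8)) * w * ((1 - w\<^sup>2) / (1 + (w\<^sup>2)\<^sup>2)))"
    by (intro sums_mult triangular_signs_sums)
  moreover have "exp (2 * of_real pi * \<i> * of_real (real k + 1 / 2) * \<eta> +
      \<i> * of_real (pi * (real k + 1 / 2)\<^sup>2 / 2))
      = exp (\<i> * of_real (pi / 8)) * w * ((-1) ^ (k * (k + 1) div 2) * (w\<^sup>2) ^ k)" for k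
  proof -
    have "2 * of_real pi * \<i> * of_real (real k + 1 / 2) * \<eta>
        = of_nat (2 * k + 1) * (\<i> * (of_real pi * \<eta>))"
      by (simp add: field_simps)
    then have "exp (2 * of_real pi * \<i> * of_real (real k + 1 / 2) * \<eta>) = w ^ (2 * k + 1)"
      by (simp only: exp_of_nat_mult w_def)
    also have "\<dots> = w * (w\<^sup>2) ^ k" by (simp add: power_mult)
    finally show ?thesis unfolding exp_add exp_quadratic_phase by (simp only: mult_ac)
  qed
  moreover have "exp (\<i> * of_real (pi / 8)) * w * ((1 - w\<^sup>2) / (1 + (w\<^sup>2)\<^sup>2))
      = - \<i> * exp (\<i> * of_real (pi / 8)) * sin (of_real pi * \<eta>) / cos (2 * of_real pi * \<eta>)"
    unfolding mult.assoc[of _ w] sin_div_cos_double_eq_exp[of "of_real pi * \<eta>", folded w_def]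
    by (simp add: mult_ac)
  ultimately show ?thesis by simp
qed

lemma abs_sinh_Im_le_cmod_cos: "\<bar>sinh (Im z)\<bar> \<le> cmod (cos z)"
proof (rule power2_le_imp_le)
  have sinh: "(sinh (Im z))\<^sup>2 = (exp (Im z) - inverse (exp (Im z)))\<^sup>2 / 4"
    by (simp add: sinh_def exp_minus power_divide)
  show "\<bar>sinh (Im z)\<bar>\<^sup>2 \<le> (cmod (cos z))\<^sup>2" unfolding norm_cos_squared power2_abs sinh by simp
qed simp

lemma cmod_sin_div_cos_ge:
  assumes "Im \<eta> > 0"
  shows "main_size (Im \<eta>) / 2 \<le> cmod (sin (of_real pi * \<eta>) / cos (2 * of_real pi * \<eta>))"
proof -
  define E where "E = exp (pi * Im \<eta>)"
  have "E > 0" "exp (2 * pi * Im \<eta>) = E\<^sup>2" by (simp_all add: E_def mult.assoc flip: exp_double)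
  then have "main_size (Im \<eta>) / 2 = sinh (pi * Im \<eta>) / exp (2 * pi * Im \<eta>)"
    by (simp add: main_size_def sinh_def exp_minus E_def[symmetric] field_simps power2_eq_square)
  also have "\<dots> \<le> cmod (sin (of_real pi * \<eta>)) / cmod (cos (2 * of_real pi * \<eta>))"
  proof (rule frac_le)
    show "sinh (pi * Im \<eta>) \<le> cmod (sin (of_real pi * \<eta>))"
      using abs_sinh_Im_le_cmod_sin[of "of_real pi * \<eta>"] by simp
    have "0 < sinh (2 * pi * Im \<eta>)" using assms by simp
    also have "\<dots> \<le> cmod (cos (2 * of_real pi * \<eta>))"
      using abs_sinh_Im_le_cmod_cos[of "2 * of_real pi * \<eta>"] by simp
    finally show "0 < cmod (cos (2 * of_real pi * \<eta>))" .
    show "cmod (cos (2 * of_real pi * \<eta>)) \<le> exp (2 * pi * Im \<eta>)"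
      using cmod_cos_le_exp[of 1 "2 * of_real pi * \<eta>"] assms by simp
  qed simp
  finally show ?thesis by (simp add: norm_divide)
qed

lemma sums_perturbed:
  fixes f g :: "nat \<Rightarrow> 'a::banach"
  assumes g: "g sums y" and e: "summable e" and le: "\<And>k. norm (f k - g k) \<le> e k"
  shows "\<exists>x. f sums x \<and> norm (x - y) \<le> suminf e"
proof -
  have diff: "summable (\<lambda>k. f k - g k)"
    by (rule summable_comparison_test'[OF e, of 0]) (rule le)
  from sums_add[OF summable_sums[OF diff] g] have "f sums ((\<Sum>k. f k - g k) + y)" by simp
  moreover have "norm ((\<Sum>k. f k - g k) + y - y) \<le> suminf e"
    using norm_suminf_le[OF le e] by simp
  ultimately show ?thesis by blast
qed

lemma relative_error:
  fixes x y :: complex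
  assumes "cmod (x - y) < cmod y"
  shows "\<exists>u. cmod u < 1 \<and> x = y * (1 + u)"
proof -
  have "y \<noteq> 0" using assms by auto
  then have "cmod ((x - y) / y) < 1" "x = y * (1 + (x - y) / y)"
    using assms by (auto simp: norm_divide field_simps)
  then show ?thesis by blast
qed

context saddle
begin

lemma exp_phase_eq_powr:
  "exp (\<i> * pi * s / 4) * amplitude * exp (\<i> * of_real (pi / 8)) =
    \<eta> powr (s - 1) * exp (- pi * \<i> * \<eta>\<^sup>2) * exp (3 * pi * \<i> / 8)"
proof -
  have Ln_rot_\<eta>: "Ln (rot * \<eta>) = Ln \<eta> - \<i> * pi / 4"
  proof -
    have "Ln rot = - (\<i> * pi / 4)" unfolding rot_def using Ln_cis[of "- pi / 4"] pi_gt_zero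
      by (simp add: mult.commute)
    then show ?thesis
      using Re_Ln_pos_lt_imp[OF Re_pos] rot_nonzero \<eta>_nonzero by (subst Ln_times_simple) auto
  qed
  have "phase 0 (rot * \<eta>) = (s - 1) * Ln \<eta> - (s - 1) * (\<i> * pi / 4) - of_real pi * \<i> * \<eta>\<^sup>2"
    unfolding phase_def power_mult_distrib rot_square Ln_rot_\<eta> by (simp add: algebra_simps)
  then have "\<i> * pi * s / 4 + phase 0 (rot * \<eta>) + \<i> * of_real (pi / 8)
      = (s - 1) * Ln \<eta> + - pi * \<i> * \<eta>\<^sup>2 + 3 * pi * \<i> / 8"
    by (simp only:) (simp add: field_simps)
  then show ?thesis
    unfolding amplitude_def powr_def exp_add[symmetric] using \<eta>_nonzero by (simp only: if_False exp_add)
qed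

definition main_sum :: complex where
  "main_sum = amplitude / sqrt 2 *
     (- \<i> * exp (\<i> * of_real (pi / 8)) * sin (of_real pi * \<eta>) / cos (2 * of_real pi * \<eta>))"

lemma gaussian_term_sums: "(\<lambda>k. gaussian_term (real k + 1 / 2)) sums main_sum"
  using sums_mult[OF quadratic_phase_series[OF Im_pos], of "amplitude / sqrt 2"]
  by (simp add: main_sum_def gaussian_term_def gaussian_amplitude_def)

lemma cmod_main_sum_ge:
  "cmod amplitude / sqrt 2 * (main_size (Im \<eta>) / 2) \<le> cmod main_sum"
proof -
  have "cmod main_sum = cmod amplitude / sqrt 2
      * cmod (sin (of_real pi * \<eta>) / cos (2 * of_real pi * \<eta>))"
    by (simp add: main_sum_def norm_mult norm_divide)
  then show ?thesis
    using mult_left_mono[OF cmod_sin_div_cos_ge[OF Im_pos], of "cmod amplitude / sqrt 2"] by simp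
qed

lemma main_sum_eq:
  "- \<i> * exp (\<i> * pi * s / 4) * main_sum = - (\<eta> powr (s - 1)) * exp (- pi * \<i> * \<eta>\<^sup>2) *
    (sqrt 2 * exp (3 * pi * \<i> / 8) * sin (pi * \<eta>)) / (2 * cos (2 * pi * \<eta>))"
proof -
  have "- \<i> * exp (\<i> * pi * s / 4) * main_sum
      = - (exp (\<i> * pi * s / 4) * amplitude * exp (\<i> * of_real (pi / 8))) *
      (1 / complex_of_real (sqrt 2)) * sin (pi * \<eta>) / cos (2 * pi * \<eta>)"
    unfolding main_sum_def by (simp add: mult_ac)
  also have "1 / complex_of_real (sqrt 2) = sqrt 2 / 2"
    using arg_cong[of "1 / sqrt 2" "sqrt 2 / 2" complex_of_real]
    by (simp add: real_div_sqrt field_simps)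
  finally show ?thesis unfolding exp_phase_eq_powr by simp
qed

lemma bromwich_sums_main_sum:
  assumes dominated: "errors_dominated (cmod \<eta>) (Im \<eta>) (1 - Re s)"
  shows "\<exists>\<kappa> U. (\<forall>k. 0 < \<kappa> k) \<and> cmod U < 1 \<and>
    (\<lambda>k. bromwich s (node k) (\<kappa> k)) sums (main_sum * (1 + U))"
proof -
  define e where "e k = error_bound (cmod \<eta>) (Im \<eta>) (1 - Re s) (real k + 1 / 2)" for k
  have size_pos: "main_size (Im \<eta>) > 0" using Im_pos by (simp add: main_size_def)
  have amplitude: "cmod amplitude > 0" by (simp add: amplitude_def)
  have "\<forall>k. \<exists>\<kappa>>0. cmod (bromwich s (node k) \<kappa> - gaussian_term (real k + 1 / 2)) \<le> cmod amplitude * e k"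
    unfolding node_def e_def by (intro allI bromwich_error_bound) simp
  from choice[OF this] obtain \<kappa> where \<kappa>: "\<And>k. 0 < \<kappa> k"
    and term_error: "\<And>k. cmod (bromwich s (node k) (\<kappa> k) - gaussian_term (real k + 1 / 2))
      \<le> cmod amplitude * e k"
    by blast
  have e: "summable e" "(\<Sum>k. e k) \<le> main_size (Im \<eta>) / 3"
    using dominated by (simp_all add: errors_dominated_def e_def[abs_def])
  obtain X where X: "(\<lambda>k. bromwich s (node k) (\<kappa> k)) sums X"
    "cmod (X - main_sum) \<le> (\<Sum>k. cmod amplitude * e k)"
    using sums_perturbed[OF gaussian_term_sums summable_mult[OF e(1)] term_error] by blast
  note X(2)
  also have "(\<Sum>k. cmod amplitude * e k) = cmod amplitude * (\<Sum>k. e k)" by (rule suminf_mult[OF e(1)])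
  also have "\<dots> \<le> cmod amplitude * (main_size (Im \<eta>) / 3)" using e(2) by (intro mult_left_mono) auto
  also have "\<dots> < cmod amplitude * (main_size (Im \<eta>) / (2 * sqrt 2))"
  proof -
    have "sqrt 2 < 3 / 2" by (rule real_less_lsqrt) (auto simp: power2_eq_square)
    then have "main_size (Im \<eta>) / 3 < main_size (Im \<eta>) / (2 * sqrt 2)"
      using size_pos by (intro divide_strict_left_mono) auto
    then show ?thesis using amplitude by (intro mult_strict_left_mono)
  qed
  also have "\<dots> \<le> cmod main_sum" using cmod_main_sum_ge by simp
  finally obtain U where "cmod U < 1" "X = main_sum * (1 + U)" using relative_error by blast
  with X(1) \<kappa> show ?thesis by blast
qed

lemma riemann_R_approx:
  assumes "Re s \<le> -1" and "errors_dominated (cmod \<eta>) (Im \<eta>) (1 - Re s)"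
  shows "\<exists>U. cmod U < 1 \<and> riemann_R s = - chi s * \<eta> powr (s - 1) * exp (- pi * \<i> * \<eta>\<^sup>2) *
    (sqrt 2 * exp (3 * pi * \<i> / 8) * sin (pi * \<eta>)) / (2 * cos (2 * pi * \<eta>)) * (1 + U)"
proof -
  obtain \<kappa> U where \<kappa>: "\<And>k. 0 < \<kappa> k" and U: "cmod U < 1"
    and sums: "(\<lambda>k. bromwich s (node k) (\<kappa> k)) sums (main_sum * (1 + U))"
    using bromwich_sums_main_sum[OF assms(2)] by blast
  have "riemann_R s = chi s * (- \<i>) * exp (\<i> * pi * s / 4) * (main_sum * (1 + U))"
    using sums_unique2[OF riemann_R_bromwich_sums[OF assms(1) \<kappa>] sums_mult[OF sums]] .
  also have "\<dots> = chi s * (- \<i> * exp (\<i> * pi * s / 4) * main_sum) * (1 + U)" by (simp add: mult_ac)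
  finally have "riemann_R s = - chi s * \<eta> powr (s - 1) * exp (- pi * \<i> * \<eta>\<^sup>2) *
    (sqrt 2 * exp (3 * pi * \<i> / 8) * sin (pi * \<eta>)) / (2 * cos (2 * pi * \<eta>)) * (1 + U)"
    unfolding main_sum_eq by simp
  with U show ?thesis by blast
qed

end

lemma
  fixes s :: complex
  shows Re_eta_radicand: "Re ((s - 1) / (2 * pi * \<i>)) = Im s / (2 * pi)"
    and Im_eta_radicand: "Im ((s - 1) / (2 * pi * \<i>)) = (1 - Re s) / (2 * pi)"
  by (simp_all add: Re_divide Im_divide power2_eq_square field_simps)

lemma eta_eq_csqrt:
  assumes "Re s < 1"
  shows "eta s = csqrt ((s - 1) / (2 * pi * \<i>))"
proof -
  define z where "z = (s - 1) / (2 * pi * \<i>)"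
  have "Im z > 0" using assms unfolding z_def Im_eta_radicand by simp
  then have "z \<noteq> 0" by auto
  then have z: "0 < Arg z" "Arg z < pi"
    using \<open>Im z > 0\<close> Im_Ln_pos_lt_imp[of z] by (simp_all add: Arg_eq_Im_Ln)
  show ?thesis
    unfolding eta_def z_def[symmetric]
  proof (rule the_equality)
    show "(csqrt z)\<^sup>2 = z \<and> - pi / 4 < Arg (csqrt z) \<and> Arg (csqrt z) < 3 * pi / 4"
      using z by simp
  next
    fix w assume w: "w\<^sup>2 = z \<and> - pi / 4 < Arg w \<and> Arg w < 3 * pi / 4"
    then have "w\<^sup>2 = (csqrt z)\<^sup>2" by simp
    then have "w = csqrt z \<or> w = - csqrt z" by (simp only: power2_eq_iff)
    moreover have "w \<noteq> - csqrt z"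
    proof
      assume "w = - csqrt z"
      then have "Arg w = Arg z / 2 - pi" using z \<open>z \<noteq> 0\<close> Arg_minus[of "csqrt z"] by auto
      then show False using w z by simp
    qed
    ultimately show "w = csqrt z" by blast
  qed
qed

lemma saddle_eta:
  assumes "Re s < 1" "Im s > 0"
  shows "saddle (eta s) s"
proof
  define z where "z = (s - 1) / (2 * pi * \<i>)"
  have eta: "eta s = csqrt z" by (simp add: eta_eq_csqrt[OF assms(1)] z_def)
  show "s = 1 + 2 * of_real pi * \<i> * (eta s)\<^sup>2" by (simp add: eta z_def)
  have "Re z > 0" "Im z > 0" using assms unfolding z_def Re_eta_radicand Im_eta_radicand by simp_all
  moreover have "Re z < cmod z"
    using \<open>Im z > 0\<close> complex_Re_le_cmod[of z] cmod_power2[of z] by (auto simp: less_le)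
  ultimately show "0 < Im (eta s)" "Im (eta s) \<le> Re (eta s)"
    by (simp_all add: eta sgn_if)
qed

lemma cmod_eta_square:
  assumes "Re s < 1"
  shows "(cmod (eta s))\<^sup>2 = cmod (s - 1) / (2 * pi)"
  by (simp add: eta_eq_csqrt[OF assms] norm_divide norm_mult)

lemma cmod_eta_powr_le:
  assumes "Re s < 1"
  shows "cmod (eta s) powr (4 / 5) \<le> max \<bar>Im s\<bar> (1 - Re s) powr (2 / 5)"
proof -
  define x where "x = max \<bar>Im s\<bar> (1 - Re s)"
  have "2 * pi * (cmod (eta s))\<^sup>2 \<le> \<bar>Re (s - 1)\<bar> + \<bar>Im (s - 1)\<bar>"
    using cmod_eta_square[OF assms] cmod_le[of "s - 1"] by simp
  also have "\<dots> \<le> 2 * x" using assms by (auto simp: x_def max_def)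
  also have "\<dots> \<le> (2 * pi) * x" using assms pi_gt3 by (intro mult_right_mono) (auto simp: x_def)
  finally have "(cmod (eta s))\<^sup>2 \<le> x" by simp
  then have "(cmod (eta s))\<^sup>2 powr (2 / 5) \<le> x powr (2 / 5)" by (intro powr_mono2) auto
  moreover have "(cmod (eta s))\<^sup>2 powr (2 / 5) = cmod (eta s) powr (4 / 5)"
    using powr_powr[of "cmod (eta s)" 2 "2 / 5"] by (cases "eta s = 0") auto
  ultimately show ?thesis by (simp add: x_def)
qed

lemma eventually_powr_max_le:
  fixes C :: real
  shows "\<forall>\<^sub>F t in at_top. \<forall>\<tau> \<ge> t powr (2 / 5) * ln t. C * max t \<tau> powr (2 / 5) \<le> \<tau>"
proof -
  have "\<forall>\<^sub>F t :: real in at_top. C \<le> t powr (3 / 5)" by real_asymp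
  moreover have "\<forall>\<^sub>F t :: real in at_top. C \<le> ln t" by real_asymp
  ultimately show ?thesis
    using eventually_ge_at_top[of 1]
  proof eventually_elim
    case (elim t)
    show ?case
    proof (intro allI impI)
      fix \<tau> assume \<tau>: "t powr (2 / 5) * ln t \<le> \<tau>"
      show "C * max t \<tau> powr (2 / 5) \<le> \<tau>"
      proof (cases "\<tau> \<le> t")
        case True
        have "C * t powr (2 / 5) \<le> ln t * t powr (2 / 5)" using elim by (intro mult_right_mono) auto
        also have "\<dots> \<le> \<tau>" using \<tau> by (simp add: mult.commute)
        finally show ?thesis using True by (simp add: max_def)
      next
        case False
        have "C \<le> \<tau> powr (3 / 5)"
          using elim False powr_mono2[of "3 / 5" t \<tau>] by linarith
        then have "C * \<tau> powr (2 / 5) \<le> \<tau> powr (3 / 5) * \<tau> powr (2 / 5)" by (intro mult_right_mono) auto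
        also have "\<dots> = \<tau>" using elim False by (simp flip: powr_add)
        finally show ?thesis using False by (simp add: max_def)
      qed
    qed
  qed
qed

context saddle
begin

lemma one_minus_Re_s_ge: "6 * cmod \<eta> * Im \<eta> \<le> 1 - Re s"
proof -
  have "cmod \<eta> / 2 \<le> Re \<eta>" using cmod_le[of \<eta>] Re_pos Im_pos Im_le by simp
  then have "3 * (cmod \<eta> / 2 * Im \<eta>) \<le> pi * (Re \<eta> * Im \<eta>)"
    using pi_gt3 Re_pos Im_pos by (intro mult_mono) auto
  then show ?thesis by (simp add: Re_s power2_eq_square mult_ac)
qed

lemma Im_\<eta>_ge:
  assumes "4 * pi * K * cmod \<eta> powr (4 / 5) \<le> 1 - Re s"
  shows "K * cmod \<eta> powr (- 1 / 5) \<le> Im \<eta>"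
proof -
  have L: "cmod \<eta> > 0" using \<eta>_nonzero by simp
  note assms
  also have "1 - Re s = 4 * pi * (Re \<eta> * Im \<eta>)" by (simp add: Re_s power2_eq_square)
  also have "\<dots> \<le> 4 * pi * (cmod \<eta> * Im \<eta>)"
    using Im_pos complex_Re_le_cmod[of \<eta>] by (intro mult_left_mono mult_right_mono) auto
  finally have "K * cmod \<eta> powr (4 / 5) \<le> cmod \<eta> * Im \<eta>" by simp
  moreover have "cmod \<eta> powr (4 / 5) = cmod \<eta> * cmod \<eta> powr (- 1 / 5)"
    using L powr_add[of "cmod \<eta>" 1 "- 1 / 5"] by simp
  ultimately have "cmod \<eta> * (K * cmod \<eta> powr (- 1 / 5)) \<le> cmod \<eta> * Im \<eta>" by (simp add: mult_ac)
  then show ?thesis using L by simp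
qed

end

text \<open>As \<open>2 \<pi> Im (\<eta>\<^sup>2) = 1 - \<sigma>\<close>, the condition on \<open>Im \<eta>\<close> asks \<open>1 - \<sigma>\<close> to exceed a multiple of
  \<open>\<bar>\<eta>\<bar> powr (4/5)\<close>, that is of \<open>t powr (2/5)\<close>; the logarithm absorbs the constant.\<close>

lemma eventually_eta_in_main_region:
  fixes K L0 :: real
  assumes K: "K \<ge> 0"
  shows "\<forall>\<^sub>F t in at_top. \<forall>\<sigma>. t powr (2 / 5) * ln t \<le> 1 - \<sigma> \<longrightarrow>
    \<sigma> \<le> -1 \<and> L0 \<le> cmod (eta (Complex \<sigma> t)) \<and>
    K * cmod (eta (Complex \<sigma> t)) powr (- 1 / 5) \<le> Im (eta (Complex \<sigma> t))"
proof -
  have "\<forall>\<^sub>F t :: real in at_top. 2 \<le> t powr (2 / 5) * ln t" by real_asymp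
  then show ?thesis
    using eventually_powr_max_le[of "4 * pi * K"]
      eventually_gt_at_top[of 0] eventually_ge_at_top[of "2 * pi * L0\<^sup>2"]
  proof eventually_elim
    case (elim t)
    show ?case
    proof (intro allI impI)
      fix \<sigma> assume \<sigma>: "t powr (2 / 5) * ln t \<le> 1 - \<sigma>"
      let ?s = "Complex \<sigma> t"
      have "\<sigma> \<le> -1" using \<sigma> elim(1) by linarith
      then have Re_s_less: "Re ?s < 1" by simp
      interpret saddle "eta ?s" ?s
        using Re_s_less elim(3) by (intro saddle_eta) auto
      have "2 * pi * L0\<^sup>2 \<le> 2 * pi * (cmod (eta ?s))\<^sup>2"
        using elim(4) abs_Im_le_cmod[of "?s - 1"] cmod_eta_square[OF Re_s_less] by simp
      then have "L0\<^sup>2 \<le> (cmod (eta ?s))\<^sup>2" by simp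
      then have "L0 \<le> cmod (eta ?s)" by (rule power2_le_imp_le) simp
      moreover have "4 * pi * K * cmod (eta ?s) powr (4 / 5) \<le> 1 - Re ?s"
      proof -
        have "4 * pi * K * cmod (eta ?s) powr (4 / 5) \<le> 4 * pi * K * max t (1 - \<sigma>) powr (2 / 5)"
          using K elim(3) cmod_eta_powr_le[OF Re_s_less] by (intro mult_left_mono) auto
        also have "\<dots> \<le> 1 - \<sigma>" using elim(2) \<sigma> by blast
        finally show ?thesis by simp
      qed
      then have "K * cmod (eta ?s) powr (- 1 / 5) \<le> Im (eta ?s)" by (rule Im_\<eta>_ge)
      ultimately show "\<sigma> \<le> -1 \<and> L0 \<le> cmod (eta ?s) \<and> K * cmod (eta ?s) powr (- 1 / 5) \<le> Im (eta ?s)"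
        using \<open>\<sigma> \<le> -1\<close> by blast
    qed
  qed
qed

theorem mainTheorem9:
  shows "\<exists>A::real. A > 0 \<and> (\<exists>t0::real. t0 > 0 \<and>
    (\<forall>\<sigma> t::real. t > t0 \<and> 1 - \<sigma> \<ge> A * t powr (2/5) * ln t \<longrightarrow>
      (let s = Complex \<sigma> t in
        \<exists>U::complex. cmod U < 1 \<and>
          riemann_R s = - chi s * eta s powr (s - 1) * exp (- pi * \<i> * (eta s)\<^sup>2) *
            (sqrt 2 * exp (3 * pi * \<i> / 8) * sin (pi * eta s)) / (2 * cos (2 * pi * eta s)) *
            (1 + U))))"
proof -
  obtain K L0 where K: "K \<ge> 1"
    and dominated: "\<And>L Y \<tau>. L0 \<le> L \<Longrightarrow> K * L powr (- 1 / 5) \<le> Y \<Longrightarrow> 6 * L * Y \<le> \<tau> \<Longrightarrow> errors_dominated L Y \<tau>"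
    using eventually_errors_dominated unfolding eventually_at_top_linorder by blast
  obtain t0 where region: "\<And>\<sigma> t. t0 \<le> t \<Longrightarrow> t powr (2 / 5) * ln t \<le> 1 - \<sigma> \<Longrightarrow>
      \<sigma> \<le> -1 \<and> L0 \<le> cmod (eta (Complex \<sigma> t)) \<and> K * cmod (eta (Complex \<sigma> t)) powr (- 1 / 5)
      \<le> Im (eta (Complex \<sigma> t))"
    using eventually_eta_in_main_region[of K L0] K by (auto simp: eventually_at_top_linorder)
  show ?thesis
    unfolding Let_def
  proof (rule exI[of _ 1], intro exI[of _ "max 1 t0"] conjI allI impI,
      goal_cases A_pos t0_pos approx)
    case (approx \<sigma> t)
    let ?s = "Complex \<sigma> t"
    have main_region: "\<sigma> \<le> -1" "L0 \<le> cmod (eta ?s)" "K * cmod (eta ?s) powr (- 1 / 5) \<le> Im (eta ?s)"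
      using region[of t \<sigma>] approx by auto
    interpret saddle "eta ?s" ?s
      using approx main_region(1) by (intro saddle_eta) auto
    show ?case
      by (intro riemann_R_approx dominated[OF main_region(2,3)] one_minus_Re_s_ge) (use main_region(1) in simp)
  qed auto
qed

end
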